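(* Let $(U,o')$ and $(V,o)$ be two connected germs of smooth complex-analytic surfaces and let $f:(U,o')\to(V,o)$ be a finite three-sheeted cover. Then there are local coordinates $z,w$ in $(U,o')$ and $u,v$ in $(V,o)$, and a non-negative integer $n\in\mathbb Z_{\ge 0}$, such that $f$ coincides with the cover $f_n:(U,o')\to(V,o)$ given by $$u=z,\qquad v=w^3-n z^n w.$$
   Context: A finite three-sheeted cover of germs $f:(U,o')\to(V,o)$ is a germ of a finite surjective holomorphic map of degree $3$ with $f^{-1}(o)=\{o'\}$. Local coordinates are complex-analytic coordinates centered at $o'$ and $o$ respectively. *)

theory Defs
  imports "HOL-Analysis.Analysis"
begin

section \<open>Holomorphy in two complex variables\<close>

text \<open>Complex differentiability: the Frechet derivative exists and is complex linear.
  The predicates below are only meant for open sets \<open>S\<close>.\<close>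

definition holomorphic2_on :: "(complex \<times> complex \<Rightarrow> complex) \<Rightarrow> (complex \<times> complex) set \<Rightarrow> bool" where
  "holomorphic2_on g S \<longleftrightarrow>
     (\<forall>p\<in>S. \<exists>a b. (g has_derivative (\<lambda>(h, k). a * h + b * k)) (at p))"

definition holomorphic2_map_on ::
    "(complex \<times> complex \<Rightarrow> complex \<times> complex) \<Rightarrow> (complex \<times> complex) set \<Rightarrow> bool" where
  "holomorphic2_map_on F S \<longleftrightarrow> holomorphic2_on (fst \<circ> F) S \<and> holomorphic2_on (snd \<circ> F) S"


section \<open>Smooth complex-analytic surfaces\<close>

type_synonym 'a chart = "'a set \<times> ('a \<Rightarrow> complex \<times> complex)"

definition is_chart :: "'a topology \<Rightarrow> 'a chart \<Rightarrow> bool" where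
  "is_chart X c \<longleftrightarrow> (case c of (D, \<phi>) \<Rightarrow>
     openin X D \<and> open (\<phi> ` D) \<and> homeomorphic_map (subtopology X D) (top_of_set (\<phi> ` D)) \<phi>)"

definition compatible :: "'a chart \<Rightarrow> 'a chart \<Rightarrow> bool" where
  "compatible c d \<longleftrightarrow> (case (c, d) of ((D, \<phi>), (E, \<psi>)) \<Rightarrow>
     holomorphic2_map_on (\<psi> \<circ> inv_into D \<phi>) (\<phi> ` (D \<inter> E)) \<and>
     holomorphic2_map_on (\<phi> \<circ> inv_into E \<psi>) (\<psi> ` (D \<inter> E)))"

definition complex_surface :: "'a topology \<Rightarrow> 'a chart set \<Rightarrow> bool" where
  "complex_surface X \<A> \<longleftrightarrow>
     Hausdorff_space X \<and> second_countable X \<and>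
     (\<forall>c\<in>\<A>. is_chart X c) \<and> (\<Union>c\<in>\<A>. fst c) = topspace X \<and>
     (\<forall>c\<in>\<A>. \<forall>d\<in>\<A>. compatible c d)"

text \<open>A coordinate system centered at \<open>p\<close> with domain \<open>D\<close>; it need not belong to the given atlas,
  only to the maximal atlas generated by it.\<close>

definition local_coordinates ::
    "'a topology \<Rightarrow> 'a chart set \<Rightarrow> 'a \<Rightarrow> 'a set \<Rightarrow> ('a \<Rightarrow> complex \<times> complex) \<Rightarrow> bool" where
  "local_coordinates X \<A> p D \<phi> \<longleftrightarrow>
     is_chart X (D, \<phi>) \<and> (\<forall>c\<in>\<A>. compatible (D, \<phi>) c) \<and> p \<in> D \<and> \<phi> p = (0, 0)"


section \<open>Holomorphic functions, analytic subsets and holomorphic maps\<close>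

definition holomorphic_function :: "'a chart set \<Rightarrow> 'a set \<Rightarrow> ('a \<Rightarrow> complex) \<Rightarrow> bool" where
  "holomorphic_function \<A> W h \<longleftrightarrow>
     (\<forall>(D, \<phi>)\<in>\<A>. holomorphic2_on (h \<circ> inv_into D \<phi>) (\<phi> ` (D \<inter> W)))"

definition analytic_subset :: "'a topology \<Rightarrow> 'a chart set \<Rightarrow> 'a set \<Rightarrow> 'a set \<Rightarrow> bool" where
  "analytic_subset X \<A> V T \<longleftrightarrow> T \<subseteq> V \<and>
     (\<forall>y\<in>V. \<exists>W H. openin X W \<and> y \<in> W \<and> W \<subseteq> V \<and> finite H \<and>
        (\<forall>h\<in>H. holomorphic_function \<A> W h) \<and> T \<inter> W = {x\<in>W. \<forall>h\<in>H. h x = 0})"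

definition holomorphic_map ::
    "'a topology \<Rightarrow> 'a chart set \<Rightarrow> 'a set \<Rightarrow> 'b topology \<Rightarrow> 'b chart set \<Rightarrow> 'b set \<Rightarrow> ('a \<Rightarrow> 'b) \<Rightarrow> bool" where
  "holomorphic_map X \<A> U Y \<B> V f \<longleftrightarrow>
     continuous_map (subtopology X U) (subtopology Y V) f \<and>
     (\<forall>(D, \<phi>)\<in>\<A>. \<forall>(E, \<psi>)\<in>\<B>.
        holomorphic2_map_on (\<psi> \<circ> f \<circ> inv_into D \<phi>) (\<phi> ` {x \<in> U \<inter> D. f x \<in> E}))"


section \<open>Finite covers of germs\<close>

definition finite_map ::
    "'a topology \<Rightarrow> 'a set \<Rightarrow> 'b topology \<Rightarrow> 'b set \<Rightarrow> ('a \<Rightarrow> 'b) \<Rightarrow> bool" where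
  "finite_map X U Y V f \<longleftrightarrow>
     proper_map (subtopology X U) (subtopology Y V) f \<and> (\<forall>y\<in>V. finite {x\<in>U. f x = y})"

text \<open>The degree of a finite surjective holomorphic map is the number of points in a generic fibre,
  that is, in every fibre over the complement of some nowhere dense analytic subset.\<close>

definition has_degree ::
    "'a set \<Rightarrow> 'b topology \<Rightarrow> 'b chart set \<Rightarrow> 'b set \<Rightarrow> ('a \<Rightarrow> 'b) \<Rightarrow> nat \<Rightarrow> bool" where
  "has_degree U Y \<B> V f d \<longleftrightarrow>
     (\<exists>T. analytic_subset Y \<B> V T \<and>
        subtopology Y V interior_of (subtopology Y V closure_of T) = {} \<and>
        (\<forall>y\<in>V - T. card {x\<in>U. f x = y} = d))"

text \<open>The germ at \<open>p\<close> of \<open>f\<close> is a finite cover of degree \<open>d\<close> if some representative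
  \<open>f : U \<rightarrow> V\<close> is. The values of \<open>f\<close> outside \<open>U\<close> are irrelevant.\<close>

definition finite_cover_germ ::
    "'a topology \<Rightarrow> 'a chart set \<Rightarrow> 'a \<Rightarrow> 'b topology \<Rightarrow> 'b chart set \<Rightarrow> 'b \<Rightarrow> nat \<Rightarrow> ('a \<Rightarrow> 'b) \<Rightarrow> bool" where
  "finite_cover_germ X \<A> p Y \<B> q d f \<longleftrightarrow>
     (\<exists>U V. openin X U \<and> connectedin X U \<and> p \<in> U \<and>
            openin Y V \<and> connectedin Y V \<and> q \<in> V \<and>
            holomorphic_map X \<A> U Y \<B> V f \<and> finite_map X U Y V f \<and> f ` U = V \<and>
            has_degree U Y \<B> V f d \<and> {x\<in>U. f x = q} = {p})"

end

theory Submission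
  imports Defs "HOL-Complex_Analysis.Complex_Analysis"
begin

text \<open>
  Why the theorem holds.  In coordinates the germ is a holomorphic map \<open>F = (F1, F2)\<close> with
  \<open>F 0 = 0\<close> which is proper near \<open>0\<close> and has exactly three preimages over generic points
  (\<open>finite_germ F S 3\<close>, obtained from the cover in \<open>finite_germ_of_cover\<close>).

  First, \<open>F\<close> has a nonzero differential at \<open>0\<close>
  (\<open>finite_germ_degree_3_noncritical\<close>).  If both components had a vanishing linear part, the
  intersection multiplicity of \<open>F1 = 0\<close> and \<open>F2 = 0\<close> would be at least \<open>2 * 2 = 4\<close>, and
  intersection multiplicity is the number of points in a generic fibre.  To make this precise,
  eliminate the second variable: let \<open>N y z\<close> be the product of \<open>y2 - F2 (z, w)\<close> over the roots
  \<open>w\<close> of \<open>F1 (z, w) = y1\<close>, with multiplicity.  It is continuous in \<open>(y, z)\<close> and holomorphic in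
  \<open>z\<close> (\<open>root_product_eq_integral\<close>), so by Hurwitz its number of zeros does not change with
  \<open>y\<close>.  At \<open>y = 0\<close> it is at least four; at a regular value, in coordinates in general position,
  the zeros are simple and correspond to the three points of the fibre
  (\<open>root_product_bounded_below\<close>).

  Hence one component can be taken as a coordinate, say \<open>F = (z, g (z, w))\<close>, and \<open>g (0, w)\<close>
  vanishes to order exactly three at \<open>w = 0\<close> (\<open>finite_germ_fibred_order\<close>).

  It remains to see that the one-parameter family \<open>g (z, _)\<close> is induced from the versal
  unfolding \<open>w^3 + a w + b\<close> of \<open>w^3\<close> (\<open>cusp_normal_form\<close>).  The two critical points of
  \<open>g (z, _)\<close> near \<open>0\<close> are, after a translation depending on \<open>z\<close>, the two square roots of a
  holomorphic function \<open>d z\<close> (\<open>quadratic_roots_germ\<close>).  Dividing twice by \<open>w^2 - d z\<close> and using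
  that the derivative vanishes at both roots gives
  \<open>g = A z + b z (w^3 - 3 d z w) + (w^2 - d z)^2 Q\<close> with \<open>b 0\<close> nonzero, so that
  \<open>(v - A u) / b u\<close> is a coordinate in the target.  The error term is then absorbed by the
  substitution \<open>W = w + (w^2 - d z) \<phi>\<close>: expanding \<open>W^3 - 3 d z W\<close> shows that \<open>\<phi>\<close> has to be a
  root of a cubic equation with an obvious simple root at the origin (\<open>cubic_root_germ\<close>).
  Finally \<open>3 d z = n \<zeta>^n\<close> for a new coordinate \<open>\<zeta>\<close> if \<open>d\<close> has order \<open>n\<close>, and \<open>n = 0\<close> if
  \<open>d\<close> is identically zero (\<open>root_of_order_germ\<close>).
\<close>

section \<open>Calculus of holomorphic functions of two variables\<close>

lemma holomorphic2_onI:
  assumes "\<And>p. p \<in> S \<Longrightarrow> \<exists>a b. (g has_derivative (\<lambda>(h, k). a * h + b * k)) (at p)"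
  shows "holomorphic2_on g S"
  using assms by (auto simp: holomorphic2_on_def)

lemma holomorphic2_onE:
  assumes "holomorphic2_on g S" "p \<in> S"
  obtains a b where "(g has_derivative (\<lambda>x. a * fst x + b * snd x)) (at p)"
  using assms unfolding holomorphic2_on_def by (auto simp: case_prod_beta')

lemma holomorphic2_onI':
  assumes "\<And>p. p \<in> S \<Longrightarrow> \<exists>a b. (g has_derivative (\<lambda>x. a * fst x + b * snd x)) (at p)"
  shows "holomorphic2_on g S"
  using assms by (auto simp: holomorphic2_on_def case_prod_beta')

lemma holomorphic2_on_subset: "holomorphic2_on g S \<Longrightarrow> T \<subseteq> S \<Longrightarrow> holomorphic2_on g T"
  by (auto simp: holomorphic2_on_def)

lemma holomorphic2_on_const: "holomorphic2_on (\<lambda>x. c) S"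
proof (rule holomorphic2_onI')
  fix p
  show "\<exists>a b. ((\<lambda>x. c) has_derivative (\<lambda>x. a * fst x + b * snd x)) (at p)"
    by (rule exI[of _ 0], rule exI[of _ 0]) auto
qed

lemma holomorphic2_on_fst: "holomorphic2_on fst S"
proof (rule holomorphic2_onI')
  fix p :: "complex \<times> complex"
  show "\<exists>a b. (fst has_derivative (\<lambda>x. a * fst x + b * snd x)) (at p)"
    by (rule exI[of _ 1], rule exI[of _ 0]) (auto intro!: derivative_eq_intros)
qed

lemma holomorphic2_on_snd: "holomorphic2_on snd S"
proof (rule holomorphic2_onI')
  fix p :: "complex \<times> complex"
  show "\<exists>a b. (snd has_derivative (\<lambda>x. a * fst x + b * snd x)) (at p)"
    by (rule exI[of _ 0], rule exI[of _ 1]) (auto intro!: derivative_eq_intros)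
qed

lemma holomorphic2_on_compose2:
  assumes "holomorphic2_on a S" "holomorphic2_on b S" "holomorphic2_on g T"
    and "\<And>x. x \<in> S \<Longrightarrow> (a x, b x) \<in> T"
  shows "holomorphic2_on (\<lambda>x. g (a x, b x)) S"
proof (rule holomorphic2_onI')
  fix p assume p: "p \<in> S"
  obtain a1 a2 where a: "(a has_derivative (\<lambda>x. a1 * fst x + a2 * snd x)) (at p)"
    using holomorphic2_onE[OF assms(1) p] .
  obtain b1 b2 where b: "(b has_derivative (\<lambda>x. b1 * fst x + b2 * snd x)) (at p)"
    using holomorphic2_onE[OF assms(2) p] .
  obtain c1 c2 where c: "(g has_derivative (\<lambda>x. c1 * fst x + c2 * snd x)) (at (a p, b p))"
    using holomorphic2_onE[OF assms(3) assms(4)[OF p]] .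
  have "((\<lambda>x. g (a x, b x)) has_derivative
      (\<lambda>x. c1 * (a1 * fst x + a2 * snd x) + c2 * (b1 * fst x + b2 * snd x))) (at p)"
    using has_derivative_compose[OF has_derivative_Pair[OF a b] c] by simp
  then show "\<exists>e f. ((\<lambda>x. g (a x, b x)) has_derivative (\<lambda>x. e * fst x + f * snd x)) (at p)"
    by (intro exI[of _ "c1 * a1 + c2 * b1"] exI[of _ "c1 * a2 + c2 * b2"])
      (simp add: algebra_simps)
qed

lemma holomorphic2_on_compose1:
  assumes "holomorphic2_on g S" "\<And>x. x \<in> S \<Longrightarrow> g x \<in> T" "f holomorphic_on T" "open T"
  shows "holomorphic2_on (\<lambda>x. f (g x)) S"
proof (rule holomorphic2_onI')
  fix p assume p: "p \<in> S"
  obtain a1 a2 where a: "(g has_derivative (\<lambda>x. a1 * fst x + a2 * snd x)) (at p)"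
    using holomorphic2_onE[OF assms(1) p] .
  have "(f has_field_derivative deriv f (g p)) (at (g p))"
    using assms p by (simp add: holomorphic_derivI)
  then have "((\<lambda>x. f (g x)) has_derivative (\<lambda>x. (a1 * fst x + a2 * snd x) * deriv f (g p))) (at p)"
    using has_derivative_compose[OF a] by (simp add: has_field_derivative_def mult.commute)
  then show "\<exists>e f'. ((\<lambda>x. f (g x)) has_derivative (\<lambda>x. e * fst x + f' * snd x)) (at p)"
    by (intro exI[of _ "a1 * deriv f (g p)"] exI[of _ "a2 * deriv f (g p)"])
      (simp add: algebra_simps)
qed

lemma holomorphic2_on_add:
  assumes "holomorphic2_on f S" "holomorphic2_on g S"
  shows "holomorphic2_on (\<lambda>x. f x + g x) S"
proof (rule holomorphic2_onI')
  fix p assume p: "p \<in> S"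
  obtain a1 a2 where a: "(f has_derivative (\<lambda>x. a1 * fst x + a2 * snd x)) (at p)"
    using holomorphic2_onE[OF assms(1) p] .
  obtain b1 b2 where b: "(g has_derivative (\<lambda>x. b1 * fst x + b2 * snd x)) (at p)"
    using holomorphic2_onE[OF assms(2) p] .
  show "\<exists>e f'. ((\<lambda>x. f x + g x) has_derivative (\<lambda>x. e * fst x + f' * snd x)) (at p)"
    using has_derivative_add[OF a b]
    by (intro exI[of _ "a1 + b1"] exI[of _ "a2 + b2"]) (simp add: algebra_simps)
qed

lemma holomorphic2_on_mult:
  assumes "holomorphic2_on f S" "holomorphic2_on g S"
  shows "holomorphic2_on (\<lambda>x. f x * g x) S"
proof (rule holomorphic2_onI')
  fix p assume p: "p \<in> S"
  obtain a1 a2 where a: "(f has_derivative (\<lambda>x. a1 * fst x + a2 * snd x)) (at p)"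
    using holomorphic2_onE[OF assms(1) p] .
  obtain b1 b2 where b: "(g has_derivative (\<lambda>x. b1 * fst x + b2 * snd x)) (at p)"
    using holomorphic2_onE[OF assms(2) p] .
  show "\<exists>e f'. ((\<lambda>x. f x * g x) has_derivative (\<lambda>x. e * fst x + f' * snd x)) (at p)"
    using has_derivative_mult[OF a b]
    by (intro exI[of _ "a1 * g p + f p * b1"] exI[of _ "a2 * g p + f p * b2"])
      (simp add: algebra_simps)
qed

lemma holomorphic2_on_uminus: "holomorphic2_on f S \<Longrightarrow> holomorphic2_on (\<lambda>x. - f x) S"
  using holomorphic2_on_mult[OF holomorphic2_on_const[of "-1"]] by simp

lemma holomorphic2_on_diff:
  "holomorphic2_on f S \<Longrightarrow> holomorphic2_on g S \<Longrightarrow> holomorphic2_on (\<lambda>x. f x - g x) S"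
  using holomorphic2_on_add[OF _ holomorphic2_on_uminus, of f S g] by simp

lemma holomorphic2_on_power:
  "holomorphic2_on f S \<Longrightarrow> holomorphic2_on (\<lambda>x. f x ^ n) S"
  by (induction n) (auto intro: holomorphic2_on_const holomorphic2_on_mult)

lemma holomorphic2_on_divide:
  assumes "holomorphic2_on f S" "holomorphic2_on g S" "\<And>x. x \<in> S \<Longrightarrow> g x \<noteq> 0"
  shows "holomorphic2_on (\<lambda>x. f x / g x) S"
proof -
  have "holomorphic2_on (\<lambda>x. inverse (g x)) S"
    by (rule holomorphic2_on_compose1[OF assms(2), where T = "-{0}"])
      (auto intro!: holomorphic_intros simp: assms(3))
  from holomorphic2_on_mult[OF assms(1) this] show ?thesis
    by (simp add: divide_inverse)
qed

lemma holomorphic2_on_compose_fst: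
  assumes "f holomorphic_on T" "open T" "\<And>x. x \<in> S \<Longrightarrow> fst x \<in> T"
  shows "holomorphic2_on (\<lambda>x. f (fst x)) S"
  by (rule holomorphic2_on_compose1[OF holomorphic2_on_fst assms(3,1,2)])

lemmas holomorphic2_intros = holomorphic2_on_const holomorphic2_on_fst holomorphic2_on_snd
  holomorphic2_on_add holomorphic2_on_diff holomorphic2_on_uminus holomorphic2_on_mult
  holomorphic2_on_power holomorphic2_on_divide

lemma holomorphic2_on_continuous: "holomorphic2_on g S \<Longrightarrow> continuous_on S g"
  unfolding holomorphic2_on_def
  by (meson continuous_at_imp_continuous_on has_derivative_continuous)

lemma holomorphic2_on_cong:
  assumes "open S" "\<And>x. x \<in> S \<Longrightarrow> f x = g x" "holomorphic2_on f S"
  shows "holomorphic2_on g S"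
  unfolding holomorphic2_on_def
proof
  fix p assume p: "p \<in> S"
  then obtain a b where "(f has_derivative (\<lambda>(h, k). a * h + b * k)) (at p)"
    using assms(3) unfolding holomorphic2_on_def by blast
  then have "(g has_derivative (\<lambda>(h, k). a * h + b * k)) (at p)"
    using has_derivative_transform_within_open assms p by blast
  then show "\<exists>a b. (g has_derivative (\<lambda>(h, k). a * h + b * k)) (at p)" by blast
qed

lemma holomorphic2_on_along_curve:
  assumes "holomorphic2_on g S" "a holomorphic_on T" "b holomorphic_on T" "open T"
    and "\<And>t. t \<in> T \<Longrightarrow> (a t, b t) \<in> S"
  shows "(\<lambda>t. g (a t, b t)) holomorphic_on T"
  unfolding holomorphic_on_def
proof
  fix t assume t: "t \<in> T"
  obtain c1 c2 where c: "(g has_derivative (\<lambda>x. c1 * fst x + c2 * snd x)) (at (a t, b t))"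
    using holomorphic2_onE[OF assms(1) assms(5)[OF t]] .
  have a: "(a has_derivative (\<lambda>x. deriv a t * x)) (at t)"
    and b: "(b has_derivative (\<lambda>x. deriv b t * x)) (at t)"
    using assms t by (auto simp: holomorphic_derivI simp flip: has_field_derivative_def)
  have "((\<lambda>t. g (a t, b t)) has_derivative (\<lambda>x. c1 * (deriv a t * x) + c2 * (deriv b t * x))) (at t)"
    using has_derivative_compose[OF has_derivative_Pair[OF a b] c] by simp
  then have "((\<lambda>t. g (a t, b t)) has_field_derivative (c1 * deriv a t + c2 * deriv b t)) (at t)"
    unfolding has_field_derivative_def
    by (rule has_derivative_eq_rhs) (auto simp: algebra_simps)
  then show "(\<lambda>t. g (a t, b t)) field_differentiable at t within T"
    using field_differentiable_at_within field_differentiable_def by blast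
qed

section \<open>Circle integrals with parameters and Osgood's lemma\<close>

lemma continuous_on_circle_integral_param:
  fixes f :: "'a::topological_space \<Rightarrow> complex \<Rightarrow> complex"
  assumes "continuous_on (U \<times> sphere a r) (\<lambda>(x, t). f x t)" "0 \<le> r"
  shows "continuous_on U (\<lambda>x. contour_integral (circlepath a r) (f x))"
proof -
  have eq: "contour_integral (circlepath a r) (f x) = integral (cbox 0 1)
      (\<lambda>t. f x (circlepath a r t) * (2 * pi * \<i> * r * exp (2 * pi * \<i> * t)))" for x
    unfolding contour_integral_integral
    unfolding cbox_interval
    by (rule integral_cong) (auto simp: vector_derivative_circlepath)
  have 1: "continuous_on (U \<times> cbox 0 (1::real)) (\<lambda>xt. f (fst xt) (circlepath a r (snd xt)))"
  proof -
    have "continuous_on (U \<times> cbox 0 (1::real))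
        (\<lambda>xt. (\<lambda>(x, t). f x t) (fst xt, circlepath a r (snd xt)))"
      by (rule continuous_on_compose2[OF assms(1)])
        (use assms(2) in \<open>auto intro!: continuous_intros simp: circlepath dist_norm norm_mult\<close>)
    then show ?thesis by simp
  qed
  show ?thesis
    unfolding eq
    by (rule integral_continuous_on_param)
      (auto simp: case_prod_beta intro!: continuous_intros 1[unfolded cbox_interval])
qed

lemma holomorphic_on_if_locally:
  assumes "\<And>x. x \<in> S \<Longrightarrow> \<exists>e>0. f holomorphic_on ball x e"
  shows "f holomorphic_on S"
  unfolding holomorphic_on_def
proof
  fix x assume "x \<in> S"
  then obtain e where e: "e > 0" "f holomorphic_on ball x e" using assms by blast
  then have "f field_differentiable at x"
    by (intro holomorphic_on_imp_differentiable_at[OF e(2)]) auto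
  then show "f field_differentiable at x within S"
    by (rule field_differentiable_at_within)
qed

text \<open>Differentiate under the integral sign.  The derivative in the parameter is jointly continuous,
  because Cauchy's formula expresses it as a circle integral of a continuous function.\<close>

lemma holomorphic_circle_integral_param:
  fixes f :: "complex \<Rightarrow> complex \<Rightarrow> complex"
  assumes U: "open U" and cont: "continuous_on (U \<times> sphere a r) (\<lambda>(x, t). f x t)" and r: "0 \<le> r"
    and hol: "\<And>t. t \<in> sphere a r \<Longrightarrow> (\<lambda>x. f x t) holomorphic_on U"
  shows "(\<lambda>x. contour_integral (circlepath a r) (f x)) holomorphic_on U"
proof (rule holomorphic_on_if_locally)
  fix x0 assume "x0 \<in> U"
  then obtain e where e: "e > 0" "cball x0 e \<subseteq> U"
    using U open_contains_cball by blast
  let ?B = "ball x0 e"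
  let ?c = "circlepath a r"
  let ?v = "\<lambda>t::real. 2 * pi * \<i> * r * exp (2 * pi * \<i> * t)"
  define fx where "fx = (\<lambda>x t. 1 / (2 * of_real pi * \<i>) *
      contour_integral (circlepath x0 e) (\<lambda>u. f u t / (u - x)^2))"
  have c_in: "?c t \<in> sphere a r" for t
    using r by (auto simp: circlepath dist_norm norm_mult)
  have cont': "continuous_on ((?B \<times> sphere a r) \<times> sphere x0 e)
      (\<lambda>(p, u). f u (snd p) / (u - fst p)^2)"
  proof -
    have "continuous_on ((?B \<times> sphere a r) \<times> sphere x0 e)
        (\<lambda>q. (\<lambda>(x, t). f x t) (snd q, snd (fst q)))"
      by (rule continuous_on_compose2[OF cont]) (use e in \<open>auto intro!: continuous_intros\<close>)
    then show ?thesis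
      by (auto simp: case_prod_beta intro!: continuous_intros)
  qed
  have fx_cont: "continuous_on (?B \<times> sphere a r) (\<lambda>p. fx (fst p) (snd p))"
    unfolding fx_def
    by (intro continuous_intros continuous_on_circle_integral_param cont') (use e in auto)
  have fx: "((\<lambda>x. f x t) has_field_derivative fx x t) (at x)" if "t \<in> sphere a r" "x \<in> ?B" for x t
  proof -
    have "(\<lambda>x. f x t) holomorphic_on cball x0 e"
      using hol[OF that(1)] e holomorphic_on_subset by blast
    then show ?thesis
      unfolding fx_def using that
      by (intro Cauchy_derivative_integral_circlepath(2))
        (auto intro: holomorphic_on_imp_continuous_on holomorphic_on_subset)
  qed
  have slice: "continuous_on {0..1} (\<lambda>t. f x (?c t))" if "x \<in> U" for x
  proof -
    have "continuous_on {0..1} (\<lambda>t. (\<lambda>(x, t). f x t) (x, ?c t))"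
    proof (rule continuous_on_compose2[OF cont])
      show "continuous_on {0..1} (\<lambda>t. (x, ?c t))"
        unfolding circlepath by (intro continuous_intros)
      show "(\<lambda>t. (x, ?c t)) ` {0..1} \<subseteq> U \<times> sphere a r"
        using c_in that by blast
    qed
    then show ?thesis by simp
  qed
  have fx_slice: "continuous_on (?B \<times> {0..1}) (\<lambda>q. fx (fst q) (?c (snd q)))"
  proof -
    have "continuous_on (?B \<times> {0..1}) (\<lambda>q. (\<lambda>p. fx (fst p) (snd p)) (fst q, ?c (snd q)))"
    proof (rule continuous_on_compose2[OF fx_cont])
      show "continuous_on (?B \<times> {0..1}) (\<lambda>q. (fst q, ?c (snd q)))"
        unfolding circlepath by (intro continuous_intros)
      show "(\<lambda>q. (fst q, ?c (snd q))) ` (?B \<times> {0..1}) \<subseteq> ?B \<times> sphere a r"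
        using c_in[unfolded mem_sphere] by auto
    qed
    then show ?thesis by simp
  qed
  have "(\<lambda>x. integral (cbox 0 1) (\<lambda>t. f x (?c t) * ?v t)) holomorphic_on ?B"
  proof (rule leibniz_rule_holomorphic[where fx = "\<lambda>x t. fx x (?c t) * ?v t"])
    fix x t assume x: "x \<in> ?B"
    show "((\<lambda>x. f x (?c t) * ?v t) has_field_derivative fx x (?c t) * ?v t) (at x within ?B)"
      by (intro has_field_derivative_at_within[OF DERIV_cmult_right[OF fx[OF c_in x]]])
    show "(\<lambda>t. f x (?c t) * ?v t) integrable_on cbox 0 1"
    proof (rule integrable_continuous)
      have "x \<in> U" using x e by auto
      from slice[OF this] show "continuous_on (cbox 0 1) (\<lambda>t. f x (?c t) * ?v t)"
        unfolding cbox_interval by (intro continuous_intros)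
    qed
  next
    show "continuous_on (?B \<times> cbox 0 1) (\<lambda>(x, t). fx x (?c t) * ?v t)"
      using fx_slice by (auto simp: case_prod_beta intro!: continuous_intros)
  qed auto
  moreover have "contour_integral ?c (f x) = integral (cbox 0 1) (\<lambda>t. f x (?c t) * ?v t)" for x
    unfolding contour_integral_integral cbox_interval
    by (rule integral_cong) (auto simp: vector_derivative_circlepath)
  ultimately have "(\<lambda>x. contour_integral ?c (f x)) holomorphic_on ?B"
    by simp
  then show "\<exists>e>0. (\<lambda>x. contour_integral ?c (f x)) holomorphic_on ball x0 e"
    using e by blast
qed

text \<open>The partial derivatives with respect to the first and the second variable.\<close>

definition d1 :: "(complex \<times> complex \<Rightarrow> complex) \<Rightarrow> complex \<times> complex \<Rightarrow> complex" where
  "d1 g p = deriv (\<lambda>z. g (z, snd p)) (fst p)"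

definition d2 :: "(complex \<times> complex \<Rightarrow> complex) \<Rightarrow> complex \<times> complex \<Rightarrow> complex" where
  "d2 g p = deriv (\<lambda>w. g (fst p, w)) (snd p)"

text \<open>The hypothesis of Osgood's lemma, stated pointwise: the slices of an open set through a
  point need not be discs.\<close>

definition separately_holomorphic_on ::
    "(complex \<times> complex \<Rightarrow> complex) \<Rightarrow> (complex \<times> complex) set \<Rightarrow> bool" where
  "separately_holomorphic_on g S \<longleftrightarrow> continuous_on S g \<and>
     (\<forall>p\<in>S. (\<lambda>z. g (z, snd p)) field_differentiable at (fst p) \<and>
            (\<lambda>w. g (fst p, w)) field_differentiable at (snd p))"

lemma separately_holomorphic_onD:
  assumes "separately_holomorphic_on g S"
  shows "continuous_on S g"
    and "(\<And>z. z \<in> A \<Longrightarrow> (z, w) \<in> S) \<Longrightarrow> (\<lambda>z. g (z, w)) holomorphic_on A"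
    and "(\<And>w. w \<in> B \<Longrightarrow> (z, w) \<in> S) \<Longrightarrow> (\<lambda>w. g (z, w)) holomorphic_on B"
proof -
  show "continuous_on S g" using assms by (simp add: separately_holomorphic_on_def)
  have *: "(\<lambda>z. g (z, w)) field_differentiable at z" "(\<lambda>w. g (z, w)) field_differentiable at w"
    if "(z, w) \<in> S" for z w
    using bspec[OF conjunct2[OF assms[unfolded separately_holomorphic_on_def]] that] by simp_all
  show "(\<And>z. z \<in> A \<Longrightarrow> (z, w) \<in> S) \<Longrightarrow> (\<lambda>z. g (z, w)) holomorphic_on A"
    unfolding holomorphic_on_def using *(1) field_differentiable_at_within by blast
  show "(\<And>w. w \<in> B \<Longrightarrow> (z, w) \<in> S) \<Longrightarrow> (\<lambda>w. g (z, w)) holomorphic_on B"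
    unfolding holomorphic_on_def using *(2) field_differentiable_at_within by blast
qed

lemma open_contains_polydisc:
  fixes S :: "('a::metric_space \<times> 'b::metric_space) set"
  assumes "open S" "(a, b) \<in> S"
  obtains e where "e > 0" "cball a e \<times> cball b e \<subseteq> S"
proof -
  obtain A B where AB: "open A" "open B" "(a, b) \<in> A \<times> B" "A \<times> B \<subseteq> S"
    using open_prod_elim[OF assms] by blast
  obtain e1 where "e1 > 0" "cball a e1 \<subseteq> A" using AB open_contains_cball by blast
  moreover obtain e2 where "e2 > 0" "cball b e2 \<subseteq> B" using AB open_contains_cball by blast
  ultimately show ?thesis
    using AB(4) by (intro that[of "min e1 e2"]) (auto simp: subset_iff)
qed

text \<open>Cauchy's formula in the second variable is a circle integral depending continuously on both
  variables and holomorphically on the first.\<close>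

lemma separately_holomorphic_on_d2:
  assumes S: "open S" and g: "separately_holomorphic_on g S"
  shows "separately_holomorphic_on (d2 g) S"
proof -
  note D = separately_holomorphic_onD[OF g]
  have loc: "\<exists>e>0. cball a e \<times> cball b e \<subseteq> S \<and> continuous_on (ball a e \<times> ball b e) (d2 g) \<and>
      (\<lambda>z. d2 g (z, b)) holomorphic_on ball a e" if ab: "(a, b) \<in> S" for a b
  proof -
    obtain e where e: "e > 0" and sub: "cball a e \<times> cball b e \<subseteq> S"
      using open_contains_polydisc[OF S ab] .
    have cont: "continuous_on (cball a e \<times> cball b e) g"
      by (rule continuous_on_subset[OF D(1) sub])
    have sl: "continuous_on (cball b e) (\<lambda>w. g (z, w))" if "z \<in> ball a e" for z
      by (rule continuous_on_compose2[OF cont]) (use that in \<open>auto intro!: continuous_intros\<close>)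
    have formula: "d2 g (z, w) = 1 / (2 * of_real pi * \<i>) *
        contour_integral (circlepath b e) (\<lambda>u. g (z, u) / (u - w)^2)"
      if zw: "z \<in> ball a e" "w \<in> ball b e" for z w
    proof -
      have "(\<lambda>w. g (z, w)) holomorphic_on ball b e"
        by (rule D(3)) (use sub zw in auto)
      from DERIV_imp_deriv[OF Cauchy_derivative_integral_circlepath(2)[OF sl[OF zw(1)] this zw(2)]]
      show ?thesis by (simp add: d2_def)
    qed
    have "continuous_on (ball a e \<times> ball b e) (\<lambda>p. 1 / (2 * of_real pi * \<i>) *
        contour_integral (circlepath b e) (\<lambda>u. g (fst p, u) / (u - snd p)^2))"
    proof (intro continuous_intros continuous_on_circle_integral_param)
      have "continuous_on ((ball a e \<times> ball b e) \<times> sphere b e) (\<lambda>q. g (fst (fst q), snd q))"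
        by (rule continuous_on_compose2[OF cont]) (use e in \<open>auto intro!: continuous_intros\<close>)
      then show "continuous_on ((ball a e \<times> ball b e) \<times> sphere b e)
          (\<lambda>(p, u). g (fst p, u) / (u - snd p)^2)"
        by (auto simp: case_prod_beta intro!: continuous_intros)
    qed (use e in auto)
    then have 1: "continuous_on (ball a e \<times> ball b e) (d2 g)"
      by (rule continuous_on_eq) (auto simp: formula)
    have "(\<lambda>z. contour_integral (circlepath b e) (\<lambda>u. g (z, u) / (u - b)^2)) holomorphic_on ball a e"
    proof (rule holomorphic_circle_integral_param)
      have "continuous_on (ball a e \<times> sphere b e) g"
        using cont by (rule continuous_on_subset) auto
      then show "continuous_on (ball a e \<times> sphere b e) (\<lambda>(x, t). g (x, t) / (t - b)\<^sup>2)"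
        using e by (auto simp: case_prod_beta intro!: continuous_intros)
      fix t assume t: "t \<in> sphere b e"
      have "(\<lambda>x. g (x, t)) holomorphic_on ball a e"
        by (rule D(2)) (use sub t in auto)
      then show "(\<lambda>x. g (x, t) / (t - b)\<^sup>2) holomorphic_on ball a e"
        using t e by (auto intro!: holomorphic_intros)
    qed (use e in auto)
    then have "(\<lambda>z. 1 / (2 * of_real pi * \<i>) *
        contour_integral (circlepath b e) (\<lambda>u. g (z, u) / (u - b)^2)) holomorphic_on ball a e"
      by (intro holomorphic_intros)
    then have "(\<lambda>z. d2 g (z, b)) holomorphic_on ball a e"
      by (rule holomorphic_transform) (use formula e in simp)
    then show ?thesis using e sub 1 by blast
  qed
  show ?thesis
    unfolding separately_holomorphic_on_def
  proof (intro conjI ballI)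
    show "continuous_on S (d2 g)"
      unfolding continuous_on_eq_continuous_at[OF S]
    proof
      fix p assume "p \<in> S"
      then obtain e where e: "e > 0" "continuous_on (ball (fst p) e \<times> ball (snd p) e) (d2 g)"
        using loc[of "fst p" "snd p"] by auto
      moreover have "p \<in> ball (fst p) e \<times> ball (snd p) e"
        using e(1) by (simp add: mem_Times_iff)
      ultimately show "isCont (d2 g) p"
        using continuous_on_eq_continuous_at[OF open_Times[OF open_ball open_ball]] by blast
    qed
    fix p assume p: "p \<in> S"
    then obtain e where e: "e > 0" and sub: "cball (fst p) e \<times> cball (snd p) e \<subseteq> S"
        and hol: "(\<lambda>z. d2 g (z, snd p)) holomorphic_on ball (fst p) e"
      using loc[of "fst p" "snd p"] by auto
    show "(\<lambda>z. d2 g (z, snd p)) field_differentiable at (fst p)"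
      by (rule holomorphic_on_imp_differentiable_at[OF hol]) (use e in auto)
    have "(\<lambda>v. g (fst p, v)) holomorphic_on ball (snd p) e"
      by (rule D(3)) (use sub e in auto)
    then have "deriv (\<lambda>v. g (fst p, v)) holomorphic_on ball (snd p) e"
      by (rule holomorphic_deriv) simp
    then have "deriv (\<lambda>v. g (fst p, v)) field_differentiable at (snd p)"
      by (rule holomorphic_on_imp_differentiable_at) (use e in auto)
    then show "(\<lambda>v. d2 g (fst p, v)) field_differentiable at (snd p)"
      by (simp add: d2_def)
  qed
qed

text \<open>One partial derivative exists and the other is continuous, which suffices for differentiability.\<close>

lemma separately_holomorphic_on_has_derivative:
  assumes S: "open S" and g: "separately_holomorphic_on g S" and p: "p \<in> S"
  shows "(g has_derivative (\<lambda>x. d1 g p * fst x + d2 g p * snd x)) (at p)"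
proof -
  obtain a b where ab: "p = (a, b)" by fastforce
  obtain e where e: "e > 0" "cball a e \<times> cball b e \<subseteq> S"
    using open_contains_polydisc[OF S] p ab by blast
  have sep: "(\<lambda>z. g (z, w)) field_differentiable at z" "(\<lambda>w. g (z, w)) field_differentiable at w"
    if "(z, w) \<in> S" for z w
    using bspec[OF conjunct2[OF g[unfolded separately_holomorphic_on_def]] that] by simp_all
  have c: "continuous_on S (d2 g)"
    by (rule separately_holomorphic_onD(1)[OF separately_holomorphic_on_d2[OF S g]])
  have c': "continuous (at p within ball a e \<times> ball b e) (d2 g)"
    using c p S continuous_at_imp_continuous_at_within continuous_on_eq_continuous_at by blast
  have "((\<lambda>(x, y). g (x, y)) has_derivative
      (\<lambda>(tx, ty). d1 g p * tx + blinfun_apply (blinfun_mult_right (d2 g (a, b))) ty))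
      (at (a, b) within ball a e \<times> ball b e)"
  proof (rule has_derivative_partialsI[of "\<lambda>x y. g (x, y)" b "(*) (d1 g p)" a "ball a e" "ball b e"
        "\<lambda>x y. blinfun_mult_right (d2 g (x, y))"])
    have "(\<lambda>z. g (z, b)) field_differentiable at a"
      by (rule sep) (use p ab in simp)
    then show "((\<lambda>x. g (x, b)) has_derivative (*) (d1 g p)) (at a within ball a e)"
      unfolding has_field_derivative_def[symmetric] d1_def ab
      by (simp add: field_differentiable_derivI has_field_derivative_at_within)
  next
    fix x y assume xy: "x \<in> ball a e" "y \<in> ball b e"
    have "(\<lambda>w. g (x, w)) field_differentiable at y"
      by (rule sep) (use xy e in auto)
    then have "((\<lambda>y. g (x, y)) has_field_derivative d2 g (x, y)) (at y within ball b e)"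
      unfolding d2_def by (simp add: field_differentiable_derivI has_field_derivative_at_within)
    then show "((\<lambda>y. g (x, y)) has_derivative blinfun_apply (blinfun_mult_right (d2 g (x, y))))
        (at y within ball b e)"
      unfolding has_field_derivative_def by (rule has_derivative_eq_rhs) auto
  next
    show "continuous (at (a, b) within ball a e \<times> ball b e)
        (\<lambda>(x, y). blinfun_mult_right (d2 g (x, y)))"
      using bounded_linear.tendsto[OF bounded_linear_blinfun_mult_right c'[unfolded continuous_within ab]]
      unfolding continuous_within by (simp add: case_prod_beta')
  qed (use e in auto)
  then show ?thesis
    using e(1) by (simp add: ab case_prod_beta' at_within_open[OF _ open_Times])
qed

text \<open>Osgood's lemma: it reduces the holomorphy of everything given by an integral to one variable at a time.\<close>

lemma separately_holomorphic_on_imp_holomorphic2_on: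
  assumes "open S" "separately_holomorphic_on g S"
  shows "holomorphic2_on g S"
  by (rule holomorphic2_onI') (use separately_holomorphic_on_has_derivative[OF assms] in blast)

lemma holomorphic2_on_imp_separately_holomorphic_on:
  assumes "holomorphic2_on g S"
  shows "separately_holomorphic_on g S"
  unfolding separately_holomorphic_on_def
proof (intro conjI ballI)
  show "continuous_on S g" by (rule holomorphic2_on_continuous[OF assms])
  fix p assume "p \<in> S"
  obtain c1 c2 where c: "(g has_derivative (\<lambda>x. c1 * fst x + c2 * snd x)) (at (fst p, snd p))"
    using holomorphic2_onE[OF assms \<open>p \<in> S\<close>] by auto
  have "((\<lambda>z. g (z, snd p)) has_derivative (*) c1) (at (fst p))"
    using has_derivative_compose[OF has_derivative_Pair[OF has_derivative_ident has_derivative_const] c]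
    by simp
  then show "(\<lambda>z. g (z, snd p)) field_differentiable at (fst p)"
    unfolding field_differentiable_def has_field_derivative_def by blast
  have "((\<lambda>w. g (fst p, w)) has_derivative (*) c2) (at (snd p))"
    using has_derivative_compose[OF has_derivative_Pair[OF has_derivative_const has_derivative_ident] c]
    by simp
  then show "(\<lambda>w. g (fst p, w)) field_differentiable at (snd p)"
    unfolding field_differentiable_def has_field_derivative_def by blast
qed

lemma holomorphic2_on_d2:
  assumes "open S" "holomorphic2_on g S"
  shows "holomorphic2_on (d2 g) S"
  by (rule separately_holomorphic_on_imp_holomorphic2_on[OF assms(1) separately_holomorphic_on_d2[OF
          assms(1) holomorphic2_on_imp_separately_holomorphic_on[OF assms(2)]]])

lemma holomorphic2_on_has_derivative:
  assumes "open S" "holomorphic2_on g S" "p \<in> S"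
  shows "(g has_derivative (\<lambda>x. d1 g p * fst x + d2 g p * snd x)) (at p)"
  by (rule separately_holomorphic_on_has_derivative[OF assms(1)
        holomorphic2_on_imp_separately_holomorphic_on[OF assms(2)] assms(3)])

lemma holomorphic2_on_d1:
  assumes S: "open S" and g: "holomorphic2_on g S"
  shows "holomorphic2_on (d1 g) S"
proof -
  let ?T = "(\<lambda>x. (snd x, fst x)) -` S"
  define h where "h = (\<lambda>x. g (snd x, fst x))"
  have T: "open ?T"
    by (intro open_vimage S continuous_intros)
  have "holomorphic2_on h ?T"
    unfolding h_def
    by (rule holomorphic2_on_compose2[OF holomorphic2_on_snd holomorphic2_on_fst g]) simp
  then have "holomorphic2_on (d2 h) ?T"
    by (rule holomorphic2_on_d2[OF T])
  then have "holomorphic2_on (\<lambda>x. d2 h (snd x, fst x)) S"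
    by (rule holomorphic2_on_compose2[OF holomorphic2_on_snd holomorphic2_on_fst]) simp
  moreover have "d2 h (snd p, fst p) = d1 g p" for p
    by (simp add: d1_def d2_def h_def)
  ultimately show ?thesis by simp
qed

section \<open>Counting zeros in a disc\<close>

lemma winding_number_circlepath_eq_1:
  assumes "dist a z < r"
  shows "winding_number (circlepath a r) z = 1"
  using assms by (intro winding_number_circlepath) (simp add: dist_norm norm_minus_commute)

lemma winding_number_circlepath_outside:
  assumes "r < dist a z" "0 \<le> r"
  shows "winding_number (circlepath a r) z = 0"
  by (rule winding_number_zero_outside[of _ "cball a r"]) (use assms in auto)

text \<open>The argument principle needs finitely many zeros in an open set around the
  contour; the zeros of a function on a disc may accumulate at its boundary, so the disc is shrunk.\<close>

lemma finite_zeros_slightly_larger_disc: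
  fixes f :: "complex \<Rightarrow> complex"
  assumes f: "f holomorphic_on ball a R" and r: "0 < r" "r < R"
    and nz: "\<And>z. z \<in> sphere a r \<Longrightarrow> f z \<noteq> 0"
  obtains R' where "r < R'" "R' < R" "finite {z \<in> ball a R'. f z = 0}"
proof -
  define R' where "R' = (r + R) / 2"
  have R': "r < R'" "R' < R" using r by (auto simp: R'_def)
  have "finite {z \<in> cball a R'. f z = 0}"
  proof (cases "f constant_on ball a R")
    case True
    then obtain c where c: "\<And>z. z \<in> ball a R \<Longrightarrow> f z = c" by (auto simp: constant_on_def)
    have "a + of_real r \<in> sphere a r" using r by (simp add: dist_norm)
    moreover have "a + of_real r \<in> ball a R" using r by (simp add: dist_norm)
    ultimately have "c \<noteq> 0" using nz c by metis
    then have "{z \<in> cball a R'. f z = 0} = {}"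
      using c R' by fastforce
    then show ?thesis by (simp only: finite.emptyI)
  next
    case False
    show ?thesis
      by (rule holomorphic_compact_finite_zeros[OF f]) (use False R' in auto)
  qed
  then have "finite {z \<in> ball a R'. f z = 0}"
    by (rule rev_finite_subset) auto
  then show ?thesis using that R' by blast
qed

text \<open>The weighted argument principle.  With weights \<open>w^k\<close> and \<open>Ln (1 + g w / t)\<close> it turns
  symmetric functions of the zeros into integrals, which depend holomorphically on parameters.\<close>

lemma argument_principle_circle:
  fixes f h :: "complex \<Rightarrow> complex"
  assumes f: "f holomorphic_on ball a R" and h: "h holomorphic_on ball a R" and r: "0 < r" "r < R"
    and nz: "\<And>z. z \<in> sphere a r \<Longrightarrow> f z \<noteq> 0"
  shows "finite {z \<in> ball a r. f z = 0}"
    and "contour_integral (circlepath a r) (\<lambda>x. deriv f x * h x / f x) =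
      2 * of_real pi * \<i> * (\<Sum>z | z \<in> ball a r \<and> f z = 0. h z * of_int (zorder f z))"
proof -
  obtain R' where R': "r < R'" "R' < R" and fin: "finite {z \<in> ball a R'. f z = 0}"
    using finite_zeros_slightly_larger_disc[OF f r nz] by blast
  have sub: "ball a R' \<subseteq> ball a R" using R' by auto
  show "finite {z \<in> ball a r. f z = 0}"
    using fin by (rule rev_finite_subset) (use R' in auto)
  have "contour_integral (circlepath a r) (\<lambda>x. deriv f x * h x / f x) = 2 * pi * \<i> *
      (\<Sum>p\<in>{w \<in> ball a R'. f w = 0 \<or> w \<in> {}}. winding_number (circlepath a r) p * h p * zorder f p)"
  proof (rule argument_principle)
    show "f holomorphic_on ball a R' - {}" using f sub holomorphic_on_subset by auto
    show "h holomorphic_on ball a R'" using h sub holomorphic_on_subset by auto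
    show "path_image (circlepath a r) \<subseteq> ball a R' - {w \<in> ball a R'. f w = 0 \<or> w \<in> {}}"
      using nz r R' by (auto simp: path_image_circlepath)
    show "\<forall>z. z \<notin> ball a R' \<longrightarrow> winding_number (circlepath a r) z = 0"
      using R' r by (auto intro!: winding_number_circlepath_outside)
  qed (use fin in auto)
  also have "(\<Sum>p\<in>{w \<in> ball a R'. f w = 0 \<or> w \<in> {}}. winding_number (circlepath a r) p * h p * zorder f p)
      = (\<Sum>z | z \<in> ball a r \<and> f z = 0. h z * of_int (zorder f z))"
  proof (rule sum.mono_neutral_cong_right)
    show "\<forall>i\<in>{w \<in> ball a R'. f w = 0 \<or> w \<in> {}} - {z \<in> ball a r. f z = 0}.
        winding_number (circlepath a r) i * h i * of_int (zorder f i) = 0"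
    proof
      fix i assume i: "i \<in> {w \<in> ball a R'. f w = 0 \<or> w \<in> {}} - {z \<in> ball a r. f z = 0}"
      then have "i \<notin> sphere a r" using nz by auto
      then have "r < dist a i" using i by auto
      then show "winding_number (circlepath a r) i * h i * of_int (zorder f i) = 0"
        using winding_number_circlepath_outside r by simp
    qed
    show "winding_number (circlepath a r) z * h z * of_int (zorder f z) = h z * of_int (zorder f z)"
      if "z \<in> {z \<in> ball a r. f z = 0}" for z
      using that winding_number_circlepath_eq_1[of a z r] by simp
  qed (use fin R' in auto)
  finally show "contour_integral (circlepath a r) (\<lambda>x. deriv f x * h x / f x) =
      2 * of_real pi * \<i> * (\<Sum>z | z \<in> ball a r \<and> f z = 0. h z * of_int (zorder f z))"
    by simp
qed

lemma Rouche_circle: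
  fixes f g :: "complex \<Rightarrow> complex"
  assumes f: "f holomorphic_on ball a R" and g: "g holomorphic_on ball a R" and r: "0 < r" "r < R"
    and less: "\<And>z. z \<in> sphere a r \<Longrightarrow> cmod (g z - f z) < cmod (f z)"
  shows "(\<Sum>z | z \<in> ball a r \<and> g z = 0. zorder g z) = (\<Sum>z | z \<in> ball a r \<and> f z = 0. zorder f z)"
proof -
  have nzf: "f z \<noteq> 0" if "z \<in> sphere a r" for z using less[OF that] by auto
  have nzg: "g z \<noteq> 0" if "z \<in> sphere a r" for z using less[OF that] by auto
  obtain R1 where R1: "r < R1" "R1 < R" and fin1: "finite {z \<in> ball a R1. f z = 0}"
    using finite_zeros_slightly_larger_disc[OF f r nzf] by blast
  obtain R' where R': "r < R'" "R' < R1" and fin2: "finite {z \<in> ball a R'. g z = 0}"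
    using finite_zeros_slightly_larger_disc[of g a R1 r] g R1 r nzg holomorphic_on_subset[OF g, of "ball a R1"]
    by (metis less_imp_le subset_ball)
  have fin1': "finite {z \<in> ball a R'. f z = 0}"
    using fin1 by (rule rev_finite_subset) (use R' in auto)
  have sub: "ball a R' \<subseteq> ball a R" using R' R1 by auto
  let ?\<gamma> = "circlepath a r"
  have "(\<Sum>p | p \<in> ball a R' \<and> f p + (g p - f p) = 0.
          winding_number ?\<gamma> p * zorder (\<lambda>p. f p + (g p - f p)) p)
      = (\<Sum>p | p \<in> ball a R' \<and> f p = 0. winding_number ?\<gamma> p * zorder f p)"
  proof (rule Rouche_theorem)
    show "f holomorphic_on ball a R'" using f sub holomorphic_on_subset by auto
    show "(\<lambda>z. g z - f z) holomorphic_on ball a R'"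
      using f g sub holomorphic_on_subset by (auto intro!: holomorphic_intros)
    show "path_image ?\<gamma> \<subseteq> ball a R'"
      using r R' by (auto simp: path_image_circlepath)
    show "\<forall>z. z \<notin> ball a R' \<longrightarrow> winding_number ?\<gamma> z = 0"
      using R' r by (auto intro!: winding_number_circlepath_outside)
    show "\<forall>z\<in>path_image ?\<gamma>. cmod (g z - f z) < cmod (f z)"
      using less r by (auto simp: path_image_circlepath)
  qed (use fin1' fin2 in auto)
  moreover have "(\<Sum>p | p \<in> ball a R' \<and> k p = 0. winding_number ?\<gamma> p * zorder k p)
      = of_int (\<Sum>z | z \<in> ball a r \<and> k z = 0. zorder k z)"
    if fin: "finite {z \<in> ball a R'. k z = 0}" and nz: "\<And>z. z \<in> sphere a r \<Longrightarrow> k z \<noteq> 0" for k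
    unfolding of_int_sum
  proof (rule sum.mono_neutral_cong_right)
    show "\<forall>i\<in>{w \<in> ball a R'. k w = 0} - {z \<in> ball a r. k z = 0}.
        winding_number ?\<gamma> i * of_int (zorder k i) = 0"
    proof
      fix i assume i: "i \<in> {w \<in> ball a R'. k w = 0} - {z \<in> ball a r. k z = 0}"
      then have "i \<notin> sphere a r" using nz by auto
      then have "r < dist a i" using i by auto
      then show "winding_number ?\<gamma> i * of_int (zorder k i) = 0"
        using winding_number_circlepath_outside r by simp
    qed
    show "winding_number ?\<gamma> z * of_int (zorder k z) = of_int (zorder k z)"
      if "z \<in> {z \<in> ball a r. k z = 0}" for z
      using that winding_number_circlepath_eq_1[of a z r] by simp
  qed (use fin R' in auto)
  ultimately have "complex_of_int (\<Sum>z | z \<in> ball a r \<and> g z = 0. zorder g z)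
      = of_int (\<Sum>z | z \<in> ball a r \<and> f z = 0. zorder f z)"
    using fin1' fin2 nzf nzg by simp
  then show ?thesis by (simp only: of_int_eq_iff)
qed

text \<open>Hurwitz: by compactness of the circle, nearby parameters satisfy the hypothesis of Rouche's
  theorem, so the number of zeros in the disc, counted with multiplicity, is constant.\<close>

lemma zero_count_stable:
  fixes h :: "'a::metric_space \<Rightarrow> complex \<Rightarrow> complex"
  assumes P: "open P" "p0 \<in> P"
    and cont: "continuous_on (P \<times> sphere a r) (\<lambda>(p, z). h p z)"
    and hol: "\<And>p. p \<in> P \<Longrightarrow> h p holomorphic_on ball a R" and r: "0 < r" "r < R"
    and nz: "\<And>z. z \<in> cball a r - {a} \<Longrightarrow> h p0 z \<noteq> 0" and z0: "h p0 a = 0"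
  obtains e where "e > 0" "ball p0 e \<subseteq> P"
    "\<And>p z. p \<in> ball p0 e \<Longrightarrow> z \<in> sphere a r \<Longrightarrow> h p z \<noteq> 0"
    "\<And>p. p \<in> ball p0 e \<Longrightarrow> finite {z \<in> ball a r. h p z = 0}"
    "\<And>p. p \<in> ball p0 e \<Longrightarrow> (\<Sum>z | z \<in> ball a r \<and> h p z = 0. zorder (h p) z) = zorder (h p0) a"
proof -
  have nzS: "h p0 z \<noteq> 0" if "z \<in> sphere a r" for z using that r by (intro nz) auto
  have "continuous_on (sphere a r) (\<lambda>z. (\<lambda>(p, z). h p z) (p0, z))"
    by (rule continuous_on_compose2[OF cont]) (use P in \<open>auto intro!: continuous_intros\<close>)
  then have c0: "continuous_on (sphere a r) (\<lambda>z. norm (h p0 z))"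
    by (intro continuous_intros) simp
  have ne: "sphere a r \<noteq> {}" using r by simp
  obtain z1 where z1: "z1 \<in> sphere a r" "\<And>z. z \<in> sphere a r \<Longrightarrow> norm (h p0 z1) \<le> norm (h p0 z)"
    using continuous_attains_inf[OF compact_sphere ne c0] by blast
  define m where "m = norm (h p0 z1) / 2"
  have m: "m > 0" using nzS[OF z1(1)] by (simp add: m_def)
  obtain X where X: "p0 \<in> X" "open X"
    "\<forall>p\<in>X \<inter> P. \<forall>z\<in>sphere a r. dist ((\<lambda>(p, z). h p z) (p, z)) ((\<lambda>(p, z). h p z) (p0, z)) \<le> m"
    using continuous_on_prod_compactE[OF cont compact_sphere P(2) m] by metis
  obtain e where e: "e > 0" "ball p0 e \<subseteq> X \<inter> P"
    using X P by (meson IntI open_Int open_contains_ball)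
  have less: "cmod (h p z - h p0 z) < cmod (h p0 z)" if "p \<in> ball p0 e" "z \<in> sphere a r" for p z
  proof -
    have "p \<in> X \<inter> P" using that(1) e(2) by blast
    from X(3)[rule_format, OF this that(2)] have "cmod (h p z - h p0 z) \<le> m"
      by (simp add: dist_norm)
    also have "\<dots> < cmod (h p0 z)" using z1(2)[OF that(2)] m unfolding m_def by linarith
    finally show ?thesis .
  qed
  have nzp: "h p z \<noteq> 0" if "p \<in> ball p0 e" "z \<in> sphere a r" for p z
    using less[OF that] by auto
  show ?thesis
  proof (rule that[of e])
    fix p assume p: "p \<in> ball p0 e"
    then have pP: "p \<in> P" using e by auto
    show "finite {z \<in> ball a r. h p z = 0}"
      by (rule argument_principle_circle(1)[OF hol[OF pP] hol[OF pP] r]) (use nzp p in auto)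
    have "(\<Sum>z | z \<in> ball a r \<and> h p z = 0. zorder (h p) z)
        = (\<Sum>z | z \<in> ball a r \<and> h p0 z = 0. zorder (h p0) z)"
      by (rule Rouche_circle[OF hol[OF P(2)] hol[OF pP] r]) (use less p in auto)
    also have "{z. z \<in> ball a r \<and> h p0 z = 0} = {a}"
    proof (intro equalityI subsetI)
      fix z assume z: "z \<in> {z. z \<in> ball a r \<and> h p0 z = 0}"
      then have "z \<in> cball a r" by simp
      then show "z \<in> {a}" using nz[of z] z by blast
    qed (use z0 r in auto)
    finally show "(\<Sum>z | z \<in> ball a r \<and> h p z = 0. zorder (h p) z) = zorder (h p0) a"
      by simp
  qed (use e nzp in auto)
qed

section \<open>Inverse function theorem and regular values\<close>

lemma holomorphic2_map_onD:
  assumes "holomorphic2_map_on F S"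
  shows "holomorphic2_on (\<lambda>x. fst (F x)) S" "holomorphic2_on (\<lambda>x. snd (F x)) S"
  using assms by (auto simp: holomorphic2_map_on_def o_def)

lemma holomorphic2_map_onI:
  assumes "holomorphic2_on (\<lambda>x. fst (F x)) S" "holomorphic2_on (\<lambda>x. snd (F x)) S"
  shows "holomorphic2_map_on F S"
  using assms by (auto simp: holomorphic2_map_on_def o_def)

definition jacobian :: "(complex \<times> complex \<Rightarrow> complex \<times> complex) \<Rightarrow> complex \<times> complex \<Rightarrow> complex" where
  "jacobian F p = d1 (\<lambda>x. fst (F x)) p * d2 (\<lambda>x. snd (F x)) p - d2 (\<lambda>x. fst (F x)) p * d1 (\<lambda>x. snd (F x)) p"

text \<open>The complex linear map with matrix rows \<open>(a, b)\<close> and \<open>(c, d)\<close>.\<close>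

definition linear2 :: "complex \<Rightarrow> complex \<Rightarrow> complex \<Rightarrow> complex \<Rightarrow> complex \<times> complex \<Rightarrow> complex \<times> complex" where
  "linear2 a b c d v = (a * fst v + b * snd v, c * fst v + d * snd v)"

lemma bounded_linear_linear2: "bounded_linear (linear2 a b c d)"
  unfolding linear2_def
  by (intro bounded_linear_Pair bounded_linear_add bounded_linear_const_mult
      bounded_linear_fst bounded_linear_snd)

lemma inj_linear2_iff: "inj (linear2 a b c d) \<longleftrightarrow> a * d - b * c \<noteq> 0"
proof
  assume inj: "inj (linear2 a b c d)"
  show "a * d - b * c \<noteq> 0"
  proof
    assume 0: "a * d - b * c = 0"
    have "linear2 a b c d (d, - c) = linear2 a b c d 0" "linear2 a b c d (b, - a) = linear2 a b c d 0"
      using 0 by (auto simp: linear2_def algebra_simps)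
    then have "(d, - c) = (0 :: complex \<times> complex)" "(b, - a) = (0 :: complex \<times> complex)"
      using inj by (auto dest: injD)
    then have "linear2 a b c d (1, 0) = linear2 a b c d 0"
      by (simp add: linear2_def prod_eq_iff)
    then show False using inj by (auto dest!: injD simp: zero_prod_def)
  qed
next
  assume nz: "a * d - b * c \<noteq> 0"
  show "inj (linear2 a b c d)"
  proof (rule injI)
    fix v w assume eq: "linear2 a b c d v = linear2 a b c d w"
    have e: "a * fst v + b * snd v = a * fst w + b * snd w" "c * fst v + d * snd v = c * fst w + d * snd w"
      using eq by (simp_all add: linear2_def)
    have "(a * d - b * c) * (fst v - fst w) = 0" using e by algebra
    moreover have "(a * d - b * c) * (snd v - snd w) = 0" using e by algebra
    ultimately show "v = w" using nz by (simp add: prod_eq_iff)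
  qed
qed

lemma linear2_inverse:
  fixes a b c d :: complex
  defines "D \<equiv> a * d - b * c"
  assumes "D \<noteq> 0"
  shows "linear2 (d / D) (- b / D) (- c / D) (a / D) (linear2 a b c d v) = v"
    and "linear2 a b c d (linear2 (d / D) (- b / D) (- c / D) (a / D) v) = v"
proof -
  have 1: "x = y" if "D * x = D * y" for x y using that assms(2) by simp
  show "linear2 (d / D) (- b / D) (- c / D) (a / D) (linear2 a b c d v) = v"
    unfolding linear2_def prod_eq_iff fst_conv snd_conv
    by (intro conjI; rule 1; use assms(2) in \<open>simp add: field_simps\<close>; simp add: D_def algebra_simps)
  show "linear2 a b c d (linear2 (d / D) (- b / D) (- c / D) (a / D) v) = v"
    unfolding linear2_def prod_eq_iff fst_conv snd_conv
    by (intro conjI; rule 1; use assms(2) in \<open>simp add: field_simps\<close>; simp add: D_def algebra_simps)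
qed

lemma holomorphic2_map_on_has_derivative:
  assumes S: "open S" and F: "holomorphic2_map_on F S" and p: "p \<in> S"
  shows "(F has_derivative linear2 (d1 (\<lambda>x. fst (F x)) p) (d2 (\<lambda>x. fst (F x)) p)
     (d1 (\<lambda>x. snd (F x)) p) (d2 (\<lambda>x. snd (F x)) p)) (at p)"
proof -
  have "((\<lambda>x. (fst (F x), snd (F x))) has_derivative (\<lambda>v.
      (d1 (\<lambda>x. fst (F x)) p * fst v + d2 (\<lambda>x. fst (F x)) p * snd v,
       d1 (\<lambda>x. snd (F x)) p * fst v + d2 (\<lambda>x. snd (F x)) p * snd v))) (at p)"
    by (rule has_derivative_Pair[OF
          holomorphic2_on_has_derivative[OF S holomorphic2_map_onD(1)[OF F] p]
          holomorphic2_on_has_derivative[OF S holomorphic2_map_onD(2)[OF F] p]])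
  then show ?thesis by (simp add: linear2_def[abs_def])
qed

lemma holomorphic2_map_on_if_has_derivative:
  assumes "\<And>p. p \<in> S \<Longrightarrow> \<exists>a b c d. (F has_derivative linear2 a b c d) (at p)"
  shows "holomorphic2_map_on F S"
proof (rule holomorphic2_map_onI; rule holomorphic2_onI')
  fix p assume "p \<in> S"
  then obtain a b c d where F: "(F has_derivative linear2 a b c d) (at p)" using assms by blast
  show "\<exists>a b. ((\<lambda>x. fst (F x)) has_derivative (\<lambda>x. a * fst x + b * snd x)) (at p)"
    using has_derivative_fst[OF F] by (auto simp: linear2_def)
  show "\<exists>a b. ((\<lambda>x. snd (F x)) has_derivative (\<lambda>x. a * fst x + b * snd x)) (at p)"
    using has_derivative_snd[OF F] by (auto simp: linear2_def)
qed

text \<open>The real inverse function theorem applies, as the partial derivatives are continuous.  The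
  derivative of the inverse is the inverse of a complex linear map, hence complex linear.\<close>

lemma holomorphic2_inverse_function:
  assumes S: "open S" and F: "holomorphic2_map_on F S" and p: "p \<in> S" and J: "jacobian F p \<noteq> 0"
  obtains U V G where "open U" "U \<subseteq> S" "p \<in> U" "open V" "homeomorphism U V F G"
    "holomorphic2_map_on G V"
proof -
  let ?A = "\<lambda>x. fst (F x)" and ?B = "\<lambda>x. snd (F x)"
  define L where "L x = linear2 (d1 ?A x) (d2 ?A x) (d1 ?B x) (d2 ?B x)" for x
  define f' where "f' x = Blinfun (L x)" for x
  have f'_apply: "blinfun_apply (f' x) = L x" for x
    unfolding f'_def L_def by (simp add: bounded_linear_linear2 bounded_linear_Blinfun_apply)
  note FA = holomorphic2_map_onD(1)[OF F] and FB = holomorphic2_map_onD(2)[OF F]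
  have cont: "continuous_on S (d1 ?A)" "continuous_on S (d2 ?A)" "continuous_on S (d1 ?B)" "continuous_on S (d2 ?B)"
    using holomorphic2_on_continuous holomorphic2_on_d1[OF S] holomorphic2_on_d2[OF S] FA FB by blast+
  define D where "D = jacobian F p"
  define invf where "invf = Blinfun (linear2 (d2 ?B p / D) (- d2 ?A p / D) (- d1 ?B p / D) (d1 ?A p / D))"
  have invf: "invf o\<^sub>L f' p = id_blinfun"
    using linear2_inverse(1)[of "d1 ?A p" "d2 ?B p" "d2 ?A p" "d1 ?B p"] J
    by (intro blinfun_eqI) (simp add: f'_apply L_def invf_def bounded_linear_linear2
        bounded_linear_Blinfun_apply D_def jacobian_def)
  obtain U V G g' where U: "open U" "U \<subseteq> S" "p \<in> U" and V: "open V" "F p \<in> V"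
    and hom: "homeomorphism U V F G"
    and G: "\<And>y. y \<in> V \<Longrightarrow> (G has_derivative (g' y)) (at y)"
    "\<And>y. y \<in> V \<Longrightarrow> g' y = inv (blinfun_apply (f' (G y)))"
    "\<And>y. y \<in> V \<Longrightarrow> bij (blinfun_apply (f' (G y)))"
  proof (rule inverse_function_theorem[of S F f' p invf])
    show "(F has_derivative blinfun_apply (f' x)) (at x)" if "x \<in> S" for x
      unfolding f'_apply L_def by (rule holomorphic2_map_on_has_derivative[OF S F that])
    show "continuous_on S f'"
    proof (rule continuous_on_blinfun_componentwise)
      fix i :: "complex \<times> complex"
      show "continuous_on S (\<lambda>x. blinfun_apply (f' x) i)"
        unfolding f'_apply L_def linear2_def by (intro continuous_intros cont)
    qed
  qed (use S p invf in auto)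
  have "holomorphic2_map_on G V"
  proof (rule holomorphic2_map_on_if_has_derivative)
    fix y assume y: "y \<in> V"
    let ?x = "G y"
    define E where "E = d1 ?A ?x * d2 ?B ?x - d2 ?A ?x * d1 ?B ?x"
    have "inj (L ?x)" using G(3)[OF y] by (simp add: f'_apply bij_is_inj)
    then have E: "E \<noteq> 0" by (simp add: L_def inj_linear2_iff E_def)
    let ?M = "linear2 (d2 ?B ?x / E) (- d2 ?A ?x / E) (- d1 ?B ?x / E) (d1 ?A ?x / E)"
    have "inv (L ?x) = ?M"
      using linear2_inverse[of "d1 ?A ?x" "d2 ?B ?x" "d2 ?A ?x" "d1 ?B ?x"] E
      unfolding L_def E_def by (intro inv_equality) auto
    then have "(G has_derivative ?M) (at y)"
      using G(1)[OF y] G(2)[OF y] by (simp add: f'_apply)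
    then show "\<exists>a b c d. (G has_derivative linear2 a b c d) (at y)" by blast
  qed
  then show ?thesis using that U V hom by blast
qed

text \<open>Sard's theorem: the set of critical values has measure zero and therefore contains no open set.\<close>

lemma critical_values_no_interior:
  assumes S: "open S" and F: "holomorphic2_map_on F S" and O: "open O'" "O' \<noteq> {}"
  obtains y where "y \<in> O'" "\<And>x. x \<in> S \<Longrightarrow> F x = y \<Longrightarrow> jacobian F x \<noteq> 0"
proof -
  obtain T :: "complex \<times> complex \<Rightarrow> real^4" and Ti where T: "linear T" "linear Ti"
    and TiT: "\<And>x. Ti (T x) = x" and TTi: "\<And>y. T (Ti y) = y"
  proof (rule isomorphisms_UNIV_UNIV[where 'M = "complex \<times> complex" and 'N = "real^4"])
    show "DIM(complex \<times> complex) = DIM(real^4)" by simp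
  qed blast
  have bl: "bounded_linear T" "bounded_linear Ti" using T by (auto simp: linear_linear)
  let ?K = "{x \<in> S. jacobian F x = 0}"
  define L where "L x = linear2 (d1 (\<lambda>x. fst (F x)) x) (d2 (\<lambda>x. fst (F x)) x)
     (d1 (\<lambda>x. snd (F x)) x) (d2 (\<lambda>x. snd (F x)) x)" for x
  have "negligible ((\<lambda>x. T (F (Ti x))) ` (T ` ?K))"
  proof (rule baby_Sard[where f' = "\<lambda>x. T \<circ> L (Ti x) \<circ> Ti"])
    fix x assume "x \<in> T ` ?K"
    then have x: "Ti x \<in> S" "jacobian F (Ti x) = 0" by (auto simp: TiT)
    have "(F has_derivative L (Ti x)) (at (Ti x))"
      unfolding L_def by (rule holomorphic2_map_on_has_derivative[OF S F x(1)])
    then have "((\<lambda>x. T (F (Ti x))) has_derivative (\<lambda>v. T (L (Ti x) (Ti v)))) (at x)"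
      by (intro bounded_linear.has_derivative[OF bl(1)]
          has_derivative_compose[OF bounded_linear_imp_has_derivative[OF bl(2)]])
    then show "((\<lambda>x. T (F (Ti x))) has_derivative T \<circ> L (Ti x) \<circ> Ti) (at x within T ` ?K)"
      by (simp add: o_def has_derivative_at_withinI)
    have lin: "linear (T \<circ> L (Ti x) \<circ> Ti)"
      using bounded_linear_compose[OF bl(1) bounded_linear_compose[OF
          bounded_linear_linear2 bl(2)]] unfolding L_def o_def by (rule bounded_linear.linear)
    have "\<not> inj (L (Ti x))"
      using x(2) by (simp add: L_def inj_linear2_iff jacobian_def)
    then have "\<not> inj (T \<circ> L (Ti x) \<circ> Ti)"
      unfolding inj_def comp_apply by (metis TiT)
    then show "rank (matrix (T \<circ> L (Ti x) \<circ> Ti)) < CARD(4)"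
      unfolding less_rank_noninjective
      by (simp only: matrix_vector_mul(2)[OF lin] not_False_eq_True)
  qed simp
  moreover have "open (T ` O')"
  proof -
    have "T ` O' = Ti -` O'"
    proof (intro equalityI subsetI)
      fix x assume "x \<in> Ti -` O'"
      then show "x \<in> T ` O'" using TTi[of x] by (metis imageI vimageD)
    qed (auto simp: TiT)
    then show ?thesis using O(1) bl(2) by (simp add: open_vimage linear_continuous_on)
  qed
  ultimately have "\<not> T ` O' \<subseteq> (\<lambda>x. T (F (Ti x))) ` (T ` ?K)"
    using O(2) open_not_negligible[of "T ` O'"] negligible_subset by blast
  then obtain y where y: "y \<in> O'" "T y \<notin> (\<lambda>x. T (F (Ti x))) ` (T ` ?K)" by blast
  then have "F x \<noteq> y" if "x \<in> ?K" for x
    using that by (auto simp: image_image TiT)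
  then show ?thesis using y(1) that by blast
qed

lemma isCont_if_holomorphic_on_cball:
  assumes "g holomorphic_on cball z s" "s > 0"
  shows "isCont g z"
proof -
  have "continuous_on (ball z s) g"
    by (rule continuous_on_subset[OF holomorphic_on_imp_continuous_on[OF assms(1)]]) auto
  then show ?thesis using assms(2) by (simp add: continuous_on_eq_continuous_at)
qed

section \<open>Orders of zeros\<close>

lemma zorder_factorization:
  fixes f :: "complex \<Rightarrow> complex"
  assumes f: "f holomorphic_on ball a R" and z: "z \<in> ball a R" and w: "w \<in> ball a R" "f w \<noteq> 0"
  obtains n g s where "zorder f z = int n" "(n > 0) = (f z = 0)" "s > 0" "cball z s \<subseteq> ball a R"
    "g holomorphic_on cball z s" "\<And>w. w \<in> cball z s \<Longrightarrow> f w = g w * (w - z) ^ n"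
    "\<And>w. w \<in> cball z s \<Longrightarrow> g w \<noteq> 0"
proof -
  have *: "(if f z = 0 then zorder f z > 0 else zorder f z = 0) \<and>
    (\<exists>r>0. cball z r \<subseteq> ball a R \<and> zor_poly f z holomorphic_on cball z r \<and>
      (\<forall>w\<in>cball z r. f w = zor_poly f z w * (w - z) ^ nat (zorder f z) \<and> zor_poly f z w \<noteq> 0))"
    by (rule zorder_exist_zero[OF f]) (use z w in auto)
  then obtain s where s: "s > 0" "cball z s \<subseteq> ball a R" "zor_poly f z holomorphic_on cball z s"
    "\<forall>w\<in>cball z s. f w = zor_poly f z w * (w - z) ^ nat (zorder f z) \<and> zor_poly f z w \<noteq> 0"
    by blast
  show ?thesis
    by (rule that[of "nat (zorder f z)" s "zor_poly f z"]) (use * s in \<open>auto split: if_splits\<close>)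
qed

lemma zorder_ge_if_bounded:
  fixes f :: "complex \<Rightarrow> complex"
  assumes f: "f holomorphic_on ball a R" and z: "z \<in> ball a R" and w: "w \<in> ball a R" "f w \<noteq> 0"
    and s: "s > 0" and bound: "\<And>w. w \<in> ball z s \<Longrightarrow> norm (f w) \<le> C * norm (w - z) ^ m"
  shows "int m \<le> zorder f z"
proof (rule ccontr)
  assume "\<not> int m \<le> zorder f z"
  obtain n g t where n: "zorder f z = int n" and t: "t > 0" and g: "g holomorphic_on cball z t"
    "\<And>w. w \<in> cball z t \<Longrightarrow> f w = g w * (w - z) ^ n" "\<And>w. w \<in> cball z t \<Longrightarrow> g w \<noteq> 0"
    using zorder_factorization[OF f z w] by metis
  have nm: "n < m" using n \<open>\<not> int m \<le> zorder f z\<close> by simp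
  have "isCont g z"
    using isCont_if_holomorphic_on_cball[OF g(1) t] .
  then have lim: "((\<lambda>w. norm (g w)) \<longlongrightarrow> norm (g z)) (at z)"
    by (intro tendsto_norm) (simp add: isCont_def)
  have "((\<lambda>w. C * norm (w - z) ^ (m - n)) \<longlongrightarrow> C * norm (z - z) ^ (m - n)) (at z)"
    by (intro tendsto_intros)
  then have lim2: "((\<lambda>w. C * norm (w - z) ^ (m - n)) \<longlongrightarrow> 0) (at z)" using nm by (simp add: zero_power)
  have "norm (g z) \<le> 0"
  proof (rule tendsto_le[OF _ lim2 lim])
    show "\<forall>\<^sub>F x in at z. norm (g x) \<le> C * norm (x - z) ^ (m - n)"
      unfolding eventually_at
    proof (intro exI[of _ "min s t"] conjI ballI impI)
      fix x assume x: "x \<noteq> z \<and> dist x z < min s t"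
      then have "x \<in> ball z s" "x \<in> cball z t" by (auto simp: dist_commute)
      then have "norm (g x) * norm (x - z) ^ n \<le> C * norm (x - z) ^ m"
        using bound[of x] g(2)[of x] by (simp add: norm_mult norm_power)
      also have "\<dots> = C * norm (x - z) ^ (m - n) * norm (x - z) ^ n"
        using nm by (simp flip: power_add)
      finally show "norm (g x) \<le> C * norm (x - z) ^ (m - n)"
        using x by simp
    qed (use s t in auto)
  qed simp
  then show False using g(3)[of z] t by simp
qed

lemma zorder_le_1_if_bounded_below:
  fixes f :: "complex \<Rightarrow> complex"
  assumes f: "f holomorphic_on ball a R" and z: "z \<in> ball a R"
    and c: "c > 0" and ev: "\<forall>\<^sub>F w in at z. c * norm (w - z) \<le> norm (f w)"
  shows "zorder f z \<le> 1"
proof (rule ccontr)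
  assume n1: "\<not> zorder f z \<le> 1"
  obtain w where w: "w \<in> ball a R" "f w \<noteq> 0"
  proof -
    obtain d where d: "d > 0" "\<And>w. w \<noteq> z \<Longrightarrow> dist w z < d \<Longrightarrow> c * norm (w - z) \<le> norm (f w)"
      using ev unfolding eventually_at by blast
    obtain e where e: "e > 0" "ball z e \<subseteq> ball a R" using z by (meson open_ball open_contains_ball)
    define w where "w = z + of_real (min d e / 2)"
    have w': "dist w z = min d e / 2" using d(1) e(1) by (simp add: w_def dist_norm)
    then have "w \<noteq> z" "dist w z < d" "dist w z < e" using d(1) e(1) by auto
    moreover have "0 < c * norm (w - z)" using c \<open>w \<noteq> z\<close> by simp
    ultimately have "w \<in> ball z e" "f w \<noteq> 0" using d(2)[of w] by (auto simp: dist_commute)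
    then have "w \<in> ball a R" "f w \<noteq> 0" using e(2) by blast+
    then show ?thesis using that by blast
  qed
  obtain n g t where n: "zorder f z = int n" and t: "t > 0" and g: "g holomorphic_on cball z t"
    "\<And>w. w \<in> cball z t \<Longrightarrow> f w = g w * (w - z) ^ n" "\<And>w. w \<in> cball z t \<Longrightarrow> g w \<noteq> 0"
    using zorder_factorization[OF f z w] by metis
  have n2: "n > 1" using n n1 by simp
  have "isCont g z"
    using isCont_if_holomorphic_on_cball[OF g(1) t] .
  then have "((\<lambda>w. norm (g w * (w - z) ^ (n - 1))) \<longlongrightarrow> norm (g z * (z - z) ^ (n - 1))) (at z)"
    by (intro tendsto_intros) (simp add: isCont_def)
  then have lim: "((\<lambda>w. norm (g w * (w - z) ^ (n - 1))) \<longlongrightarrow> 0) (at z)" using n2 by (simp add: zero_power)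
  have "c \<le> 0"
  proof (rule tendsto_le[OF _ lim tendsto_const])
    have "\<forall>\<^sub>F x in at z. x \<in> cball z t"
      unfolding eventually_at by (intro exI[of _ t]) (use t in \<open>auto simp: dist_commute\<close>)
    moreover have "\<forall>\<^sub>F x in at z. x \<noteq> z" by (simp add: eventually_at_filter)
    ultimately show "\<forall>\<^sub>F x in at z. c \<le> norm (g x * (x - z) ^ (n - 1))"
      using ev
    proof eventually_elim
      case (elim x)
      have "c * norm (x - z) \<le> norm (g x * (x - z) ^ n)" using elim g(2) by simp
      also have "\<dots> = norm (g x * (x - z) ^ (n - 1)) * norm (x - z)"
        using power_minus_mult[of n "x - z"] n2 by (simp add: mult.assoc flip: norm_mult)
      finally show ?case using elim by simp
    qed
  qed simp
  then show False using c by simp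
qed

section \<open>Elimination: the product over the roots\<close>

lemma Re_one_plus_pos:
  fixes u t :: complex
  assumes "norm u < M" "norm t = M"
  shows "Re (1 + u / t) > 0"
proof -
  have "norm (u / t) < 1" using assms
    by (simp add: norm_divide divide_less_eq_1) (metis norm_ge_zero not_less order.trans zero_less_norm_iff)
  then have "\<bar>Re (u / t)\<bar> < 1" using abs_Re_le_cmod[of "u / t"] by linarith
  then show ?thesis by (simp add: abs_less_iff)
qed

lemma Re_pos_imp_not_nonpos_Reals: "Re x > 0 \<Longrightarrow> x \<notin> \<real>\<^sub>\<le>\<^sub>0"
  by (auto simp: complex_nonpos_Reals_iff)

text \<open>The norm of \<open>g\<close> over the roots of \<open>f\<close> in a disc (the resultant, if both are polynomials).\<close>

definition root_product :: "real \<Rightarrow> (complex \<Rightarrow> complex) \<Rightarrow> (complex \<Rightarrow> complex) \<Rightarrow> complex" where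
  "root_product r f g = (\<Prod>w | w \<in> ball 0 r \<and> f w = 0. g w ^ nat (zorder f w))"

text \<open>The product \<open>\<Prod> (t + g w)\<close> over the roots is a polynomial \<open>q t\<close> of degree \<open>m\<close>, and
  the value wanted is \<open>q 0\<close>.  On a circle larger than all values of \<open>g\<close> it can be written as
  \<open>t^m * exp (\<Sum> Ln (1 + g w / t))\<close> with the principal logarithm, and the argument principle
  turns the sum into an integral.  Cauchy's formula recovers \<open>q 0\<close> from the values on the circle.
  All ingredients are integrals over fixed circles, so that the dependence on parameters is visible.\<close>

lemma root_product_eq_integral:
  assumes f: "f holomorphic_on ball 0 R" and g: "g holomorphic_on ball 0 R" and r: "0 < r" "r < R"
    and nz: "\<And>w. w \<in> sphere 0 r \<Longrightarrow> f w \<noteq> 0"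
    and bound: "\<And>w. w \<in> ball 0 R \<Longrightarrow> norm (g w) < M"
    and m: "(\<Sum>w | w \<in> ball 0 r \<and> f w = 0. zorder f w) = int m"
  shows "root_product r f g = 1 / (2 * of_real pi * \<i>) * contour_integral (circlepath 0 M)
     (\<lambda>t. t ^ m * exp (1 / (2 * of_real pi * \<i>) *
        contour_integral (circlepath 0 r) (\<lambda>w. deriv f w * Ln (1 + g w / t) / f w)) / t)"
proof -
  let ?Z = "{w. w \<in> ball 0 r \<and> f w = 0}"
  have fin: "finite ?Z"
    using argument_principle_circle(1)[OF f f r nz] by simp
  have rR: "of_real r \<in> ball (0::complex) R" "of_real r \<in> sphere (0::complex) r" using r by auto
  have M: "M > 0" using bound[OF rR(1)] norm_ge_zero le_less_trans by blast
  have ord: "zorder f w = int (nat (zorder f w))" if "w \<in> ?Z" for w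
  proof -
    have "w \<in> ball 0 R" using that r by auto
    from zorder_factorization[OF f this rR(1) nz[OF rR(2)]] show ?thesis
      by (metis nat_int)
  qed
  have m': "m = (\<Sum>w\<in>?Z. nat (zorder f w))"
  proof -
    have "int m = int (\<Sum>w\<in>?Z. nat (zorder f w))"
      unfolding m[symmetric] of_nat_sum by (rule sum.cong) (use ord in auto)
    then show ?thesis by (simp only: of_nat_eq_iff)
  qed
  define q where "q t = (\<Prod>w\<in>?Z. (t + g w) ^ nat (zorder f w))" for t
  have integrand: "t ^ m * exp (1 / (2 * of_real pi * \<i>) *
        contour_integral (circlepath 0 r) (\<lambda>w. deriv f w * Ln (1 + g w / t) / f w)) / t = q t / (t - 0)"
    if t: "norm t = M" for t :: complex
  proof -
    have t0: "t \<noteq> 0" using t M by auto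
    have re: "Re (1 + g w / t) > 0" if "w \<in> ball 0 R" for w
      using Re_one_plus_pos[OF bound[OF that] t] .
    have "(\<lambda>w. Ln (1 + g w / t)) holomorphic_on ball 0 R"
      using re t0 by (auto intro!: holomorphic_intros g Re_pos_imp_not_nonpos_Reals)
    from argument_principle_circle(2)[OF f this r nz]
    have "1 / (2 * of_real pi * \<i>) *
        contour_integral (circlepath 0 r) (\<lambda>w. deriv f w * Ln (1 + g w / t) / f w)
        = (\<Sum>w\<in>?Z. Ln (1 + g w / t) * of_int (zorder f w))"
      by simp
    also have "\<dots> = (\<Sum>w\<in>?Z. of_nat (nat (zorder f w)) * Ln (1 + g w / t))"
    proof (rule sum.cong)
      fix w assume "w \<in> ?Z"
      from ord[OF this] have "complex_of_int (zorder f w) = of_nat (nat (zorder f w))"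
        by (metis of_int_of_nat_eq)
      then show "Ln (1 + g w / t) * of_int (zorder f w) = of_nat (nat (zorder f w)) * Ln (1 + g w / t)"
        by (simp only: mult.commute)
    qed simp
    finally have I: "1 / (2 * of_real pi * \<i>) *
        contour_integral (circlepath 0 r) (\<lambda>w. deriv f w * Ln (1 + g w / t) / f w)
        = (\<Sum>w\<in>?Z. of_nat (nat (zorder f w)) * Ln (1 + g w / t))" .
    have e: "exp (\<Sum>w\<in>?Z. of_nat (nat (zorder f w)) * Ln (1 + g w / t)) = (\<Prod>w\<in>?Z. (1 + g w / t) ^ nat (zorder f w))"
      unfolding exp_sum[OF fin] exp_of_nat_mult
    proof (rule prod.cong)
      fix w assume "w \<in> ?Z"
      then have "w \<in> ball 0 R" using r by simp
      from re[OF this] have "1 + g w / t \<noteq> 0"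
        by (metis less_irrefl zero_complex.sel(1))
      then show "exp (Ln (1 + g w / t)) ^ nat (zorder f w) = (1 + g w / t) ^ nat (zorder f w)"
        by simp
    qed simp
    have "t ^ m * (\<Prod>w\<in>?Z. (1 + g w / t) ^ nat (zorder f w)) = q t"
    proof -
      have "t * (1 + g w / t) = t + g w" for w using t0 by (simp add: distrib_left)
      then show ?thesis
        unfolding q_def m' power_sum prod.distrib[symmetric] power_mult_distrib[symmetric] by simp
    qed
    then show ?thesis by (simp only: I e diff_zero)
  qed
  have "q holomorphic_on cball 0 M"
    unfolding q_def by (intro holomorphic_intros)
  then have "((\<lambda>u. q u / (u - 0)) has_contour_integral 2 * of_real pi * \<i> * q 0) (circlepath 0 M)"
    using M by (intro Cauchy_integral_circlepath_simple) auto
  then have "contour_integral (circlepath 0 M) (\<lambda>u. q u / (u - 0)) = 2 * of_real pi * \<i> * q 0"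
    by (rule contour_integral_unique)
  moreover have "q 0 = root_product r f g" by (simp add: q_def root_product_def)
  moreover have "contour_integral (circlepath 0 M) (\<lambda>t. t ^ m * exp (1 / (2 * of_real pi * \<i>) *
        contour_integral (circlepath 0 r) (\<lambda>w. deriv f w * Ln (1 + g w / t) / f w)) / t)
      = contour_integral (circlepath 0 M) (\<lambda>u. q u / (u - 0))"
    by (rule contour_integral_eq) (use M integrand in \<open>auto simp: path_image_circlepath\<close>)
  ultimately show ?thesis by simp
qed

lemma continuous_on_root_product:
  fixes f g :: "'a::topological_space \<Rightarrow> complex \<Rightarrow> complex"
  assumes f: "\<And>p. p \<in> P \<Longrightarrow> f p holomorphic_on ball 0 R"
    and g: "\<And>p. p \<in> P \<Longrightarrow> g p holomorphic_on ball 0 R" and r: "0 < r" "r < R"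
    and nz: "\<And>p w. p \<in> P \<Longrightarrow> w \<in> sphere 0 r \<Longrightarrow> f p w \<noteq> 0"
    and bound: "\<And>p w. p \<in> P \<Longrightarrow> w \<in> ball 0 R \<Longrightarrow> norm (g p w) < M"
    and m: "\<And>p. p \<in> P \<Longrightarrow> (\<Sum>w | w \<in> ball 0 r \<and> f p w = 0. zorder (f p) w) = int m"
    and cont: "continuous_on (P \<times> sphere 0 r) (\<lambda>q. f (fst q) (snd q))"
      "continuous_on (P \<times> sphere 0 r) (\<lambda>q. deriv (f (fst q)) (snd q))"
      "continuous_on (P \<times> sphere 0 r) (\<lambda>q. g (fst q) (snd q))"
    and M: "M > 0"
  shows "continuous_on P (\<lambda>p. root_product r (f p) (g p))"
proof -
  note re = Re_one_plus_pos[OF bound]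
  have c: "continuous_on ((P \<times> sphere 0 M) \<times> sphere 0 r) (\<lambda>q. k (fst (fst q)) (snd q))"
    if "continuous_on (P \<times> sphere 0 r) (\<lambda>q. k (fst q) (snd q))" for k :: "'a \<Rightarrow> complex \<Rightarrow> complex"
  proof -
    have "continuous_on ((P \<times> sphere 0 M) \<times> sphere 0 r)
        (\<lambda>q. (\<lambda>q. k (fst q) (snd q)) (fst (fst q), snd q))"
      by (rule continuous_on_compose2[OF that]) (auto intro!: continuous_intros)
    then show ?thesis by simp
  qed
  have in_R: "w \<in> ball 0 R" if "norm w = r" for w :: complex using that r by simp
  have "continuous_on (P \<times> sphere 0 M) (\<lambda>q. contour_integral (circlepath 0 r)
      (\<lambda>w. deriv (f (fst q)) w * Ln (1 + g (fst q) w / snd q) / f (fst q) w))"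
  proof (rule continuous_on_circle_integral_param)
    show "continuous_on ((P \<times> sphere 0 M) \<times> sphere 0 r)
        (\<lambda>(q, w). deriv (f (fst q)) w * Ln (1 + g (fst q) w / snd q) / f (fst q) w)"
      unfolding case_prod_beta
    proof (intro continuous_intros c cont ballI)
      fix q :: "('a \<times> complex) \<times> complex" assume q: "q \<in> (P \<times> sphere 0 M) \<times> sphere 0 r"
      show "f (fst (fst q)) (snd q) \<noteq> 0" using q nz by auto
      show "snd (fst q) \<noteq> 0" using q M by auto
      show "1 + g (fst (fst q)) (snd q) / snd (fst q) \<notin> \<real>\<^sub>\<le>\<^sub>0"
        by (rule Re_pos_imp_not_nonpos_Reals, rule re) (use q in_R in auto)
    qed
  qed (use r in auto)
  note inner = this
  have "continuous_on P (\<lambda>p. 1 / (2 * of_real pi * \<i>) * contour_integral (circlepath 0 M)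
     (\<lambda>t. t ^ m * exp (1 / (2 * of_real pi * \<i>) *
        contour_integral (circlepath 0 r) (\<lambda>w. deriv (f p) w * Ln (1 + g p w / t) / f p w)) / t))"
    by (intro continuous_intros continuous_on_circle_integral_param)
      (use M in \<open>auto simp: case_prod_beta intro!: continuous_intros inner\<close>)
  then show ?thesis
    by (rule continuous_on_eq)
      (use root_product_eq_integral[OF f g r nz bound m, symmetric] in blast)
qed

lemma holomorphic_on_root_product:
  fixes f g :: "complex \<Rightarrow> complex \<Rightarrow> complex"
  assumes P: "open P" and f: "\<And>p. p \<in> P \<Longrightarrow> f p holomorphic_on ball 0 R"
    and g: "\<And>p. p \<in> P \<Longrightarrow> g p holomorphic_on ball 0 R" and r: "0 < r" "r < R"
    and nz: "\<And>p w. p \<in> P \<Longrightarrow> w \<in> sphere 0 r \<Longrightarrow> f p w \<noteq> 0"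
    and bound: "\<And>p w. p \<in> P \<Longrightarrow> w \<in> ball 0 R \<Longrightarrow> norm (g p w) < M"
    and m: "\<And>p. p \<in> P \<Longrightarrow> (\<Sum>w | w \<in> ball 0 r \<and> f p w = 0. zorder (f p) w) = int m"
    and cont: "continuous_on (P \<times> sphere 0 r) (\<lambda>q. f (fst q) (snd q))"
      "continuous_on (P \<times> sphere 0 r) (\<lambda>q. deriv (f (fst q)) (snd q))"
      "continuous_on (P \<times> sphere 0 r) (\<lambda>q. g (fst q) (snd q))"
    and hol: "\<And>w. w \<in> sphere 0 r \<Longrightarrow> (\<lambda>p. f p w) holomorphic_on P"
      "\<And>w. w \<in> sphere 0 r \<Longrightarrow> (\<lambda>p. deriv (f p) w) holomorphic_on P"
      "\<And>w. w \<in> sphere 0 r \<Longrightarrow> (\<lambda>p. g p w) holomorphic_on P"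
    and M: "M > 0"
  shows "(\<lambda>p. root_product r (f p) (g p)) holomorphic_on P"
proof -
  note re = Re_one_plus_pos[OF bound]
  have c: "continuous_on ((P \<times> sphere 0 M) \<times> sphere 0 r) (\<lambda>q. k (fst (fst q)) (snd q))"
    if "continuous_on (P \<times> sphere 0 r) (\<lambda>q. k (fst q) (snd q))" for k :: "complex \<Rightarrow> complex \<Rightarrow> complex"
  proof -
    have "continuous_on ((P \<times> sphere 0 M) \<times> sphere 0 r)
        (\<lambda>q. (\<lambda>q. k (fst q) (snd q)) (fst (fst q), snd q))"
      by (rule continuous_on_compose2[OF that]) (auto intro!: continuous_intros)
    then show ?thesis by simp
  qed
  have in_R: "w \<in> ball 0 R" if "norm w = r" for w :: complex using that r by simp
  have cc: "continuous_on ((P \<times> sphere 0 M) \<times> sphere 0 r)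
        (\<lambda>q. deriv (f (fst (fst q))) (snd q) * Ln (1 + g (fst (fst q)) (snd q) / snd (fst q)) / f (fst (fst q)) (snd q))"
  proof (intro continuous_intros c cont ballI)
    fix q :: "(complex \<times> complex) \<times> complex" assume q: "q \<in> (P \<times> sphere 0 M) \<times> sphere 0 r"
    show "f (fst (fst q)) (snd q) \<noteq> 0" using q nz by auto
    show "snd (fst q) \<noteq> 0" using q M by auto
    show "1 + g (fst (fst q)) (snd q) / snd (fst q) \<notin> \<real>\<^sub>\<le>\<^sub>0"
      by (rule Re_pos_imp_not_nonpos_Reals, rule re) (use q in_R in auto)
  qed
  have inner: "continuous_on (P \<times> sphere 0 M) (\<lambda>q. contour_integral (circlepath 0 r)
      (\<lambda>w. deriv (f (fst q)) w * Ln (1 + g (fst q) w / snd q) / f (fst q) w))"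
    by (rule continuous_on_circle_integral_param) (use r cc in \<open>auto simp: case_prod_beta\<close>)
  have inner_hol: "(\<lambda>p. contour_integral (circlepath 0 r)
      (\<lambda>w. deriv (f p) w * Ln (1 + g p w / t) / f p w)) holomorphic_on P" if t: "t \<in> sphere 0 M" for t
  proof (rule holomorphic_circle_integral_param[OF P])
    have "continuous_on (P \<times> sphere 0 r) (\<lambda>q. (\<lambda>q. deriv (f (fst (fst q))) (snd q) *
        Ln (1 + g (fst (fst q)) (snd q) / snd (fst q)) / f (fst (fst q)) (snd q)) ((fst q, t), snd q))"
      by (rule continuous_on_compose2[OF cc]) (use t in \<open>auto intro!: continuous_intros\<close>)
    then show "continuous_on (P \<times> sphere 0 r)
        (\<lambda>(p, w). deriv (f p) w * Ln (1 + g p w / t) / f p w)"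
      by (simp add: case_prod_beta)
    fix w assume w: "w \<in> sphere (0::complex) r"
    have ln: "1 + g p w / t \<notin> \<real>\<^sub>\<le>\<^sub>0" if "p \<in> P" for p
      by (rule Re_pos_imp_not_nonpos_Reals, rule re) (use that in_R t w in auto)
    have "t \<noteq> 0" using t M by auto
    then show "(\<lambda>p. deriv (f p) w * Ln (1 + g p w / t) / f p w) holomorphic_on P"
      using w nz ln by (intro holomorphic_intros hol) auto
  qed (use r in auto)
  have "(\<lambda>p. 1 / (2 * of_real pi * \<i>) * contour_integral (circlepath 0 M)
     (\<lambda>t. t ^ m * exp (1 / (2 * of_real pi * \<i>) *
        contour_integral (circlepath 0 r) (\<lambda>w. deriv (f p) w * Ln (1 + g p w / t) / f p w)) / t)) holomorphic_on P"
  proof (rule holomorphic_on_mult[OF holomorphic_on_const], rule holomorphic_circle_integral_param[OF P])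
    show "continuous_on (P \<times> sphere 0 M) (\<lambda>(p, t). t ^ m * exp (1 / (2 * of_real pi * \<i>) *
        contour_integral (circlepath 0 r) (\<lambda>w. deriv (f p) w * Ln (1 + g p w / t) / f p w)) / t)"
      unfolding case_prod_beta by (intro continuous_intros inner) (use M in auto)
    fix t assume t: "t \<in> sphere (0::complex) M"
    show "(\<lambda>p. t ^ m * exp (1 / (2 * of_real pi * \<i>) *
        contour_integral (circlepath 0 r) (\<lambda>w. deriv (f p) w * Ln (1 + g p w / t) / f p w)) / t) holomorphic_on P"
      using t M by (intro holomorphic_intros inner_hol) auto
  qed (use M in auto)
  then show ?thesis
    by (rule holomorphic_transform)
      (use root_product_eq_integral[OF f g r nz bound m, symmetric] in blast)
qed

text \<open>The zeros of the product are the parameters for which the two equations have a common solution.\<close>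

lemma root_product_eq_0_iff:
  assumes f: "f holomorphic_on ball 0 R" and r: "0 < r" "r < R"
    and nz: "\<And>w. w \<in> sphere 0 r \<Longrightarrow> f w \<noteq> 0"
  shows "root_product r f g = 0 \<longleftrightarrow> (\<exists>w\<in>ball 0 r. f w = 0 \<and> g w = 0)"
proof -
  have fin: "finite {w. w \<in> ball 0 r \<and> f w = 0}"
    using argument_principle_circle(1)[OF f f r nz] by simp
  have rR: "of_real r \<in> ball (0::complex) R" "of_real r \<in> sphere (0::complex) r" using r by auto
  have pos: "nat (zorder f w) > 0" if w: "w \<in> ball 0 r" "f w = 0" for w
  proof -
    have "w \<in> ball 0 R" using w r by auto
    from zorder_factorization[OF f this rR(1) nz[OF rR(2)]] w(2) show ?thesis
      by (metis nat_int)
  qed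
  show ?thesis
    unfolding root_product_def prod_zero_iff[OF fin] using pos by fastforce
qed

lemma zorder_pos_at_zero:
  fixes f :: "complex \<Rightarrow> complex"
  assumes "f holomorphic_on ball a R" "z \<in> ball a R" "w \<in> ball a R" "f w \<noteq> 0" "f z = 0"
  shows "zorder f z \<ge> 1"
proof -
  obtain n where "zorder f z = int n" "(n > 0) = (f z = 0)"
    using zorder_factorization[OF assms(1-4)] by metis
  then show ?thesis using assms(5) by simp
qed

section \<open>Order of vanishing along lines\<close>

definition vanishes_to_order :: "nat \<Rightarrow> (complex \<Rightarrow> complex) \<Rightarrow> bool" where
  "vanishes_to_order m f \<longleftrightarrow>
     (\<exists>k s. s > 0 \<and> k holomorphic_on ball 0 s \<and> (\<forall>t\<in>ball 0 s. f t = t ^ m * k t))"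

lemma vanishes_to_order_2:
  assumes f: "f holomorphic_on ball 0 R" and R: "R > 0" and 0: "f 0 = 0" "deriv f 0 = 0"
  shows "vanishes_to_order 2 f"
proof (cases "\<exists>w\<in>ball 0 R. f w \<noteq> 0")
  case False
  then show ?thesis
    unfolding vanishes_to_order_def using R by (intro exI[of _ "\<lambda>_. 0"] exI[of _ R]) auto
next
  case True
  then obtain w where w: "w \<in> ball 0 R" "f w \<noteq> 0" by blast
  have z: "0 \<in> ball 0 R" using R by simp
  obtain n g s where n: "(n > 0) = (f 0 = 0)" "s > 0" "g holomorphic_on cball 0 s"
    and g: "\<And>w. w \<in> cball 0 s \<Longrightarrow> f w = g w * (w - 0) ^ n" "\<And>w. w \<in> cball 0 s \<Longrightarrow> g w \<noteq> 0"
    using zorder_factorization[OF f z w] by metis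
  have gb: "g holomorphic_on ball 0 s" by (rule holomorphic_on_subset[OF n(3)]) auto
  have "n \<noteq> 1"
  proof
    assume "n = 1"
    have "(g has_field_derivative deriv g 0) (at 0)"
      using holomorphic_derivI[OF gb] n(2) by simp
    then have "((\<lambda>w. g w * w) has_field_derivative g 0) (at 0)"
      by (auto intro!: derivative_eq_intros)
    then have "(f has_field_derivative g 0) (at 0)"
      by (rule has_field_derivative_transform_within_open[of _ _ _ "ball 0 s"])
        (use n g(1) \<open>n = 1\<close> in auto)
    then have "g 0 = 0" using 0(2) DERIV_imp_deriv by force
    then show False using g(2)[of 0] n(2) by simp
  qed
  then have n2: "n \<ge> 2" using n(1) 0(1) by simp
  have "f t = t ^ 2 * (g t * t ^ (n - 2))" if "t \<in> ball 0 s" for t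
  proof -
    have "t ^ n = t ^ 2 * t ^ (n - 2)" using n2 by (metis le_add_diff_inverse power_add)
    then show ?thesis using g(1)[of t] that by simp
  qed
  moreover have "(\<lambda>t. g t * t ^ (n - 2)) holomorphic_on ball 0 s"
    by (intro holomorphic_intros gb)
  ultimately show ?thesis
    unfolding vanishes_to_order_def using n(2) by blast
qed

lemma norm_complex_scale:
  "norm (t * fst v, t * snd v) = norm t * norm (v :: complex \<times> complex)"
  by (simp add: norm_prod_def norm_mult power_mult_distrib real_sqrt_mult flip: distrib_left)

text \<open>If a function vanishes to order \<open>m\<close> along the line through each \<open>v \<in> V\<close>, the quotient by
  \<open>t^m\<close> is a Cauchy integral over a circle away from \<open>t = 0\<close>, and is therefore continuous in the
  direction as well.\<close>

lemma radial_quotient: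
  assumes H: "holomorphic2_on H (ball 0 \<rho>)" and V: "\<And>v. v \<in> V \<Longrightarrow> norm v \<le> c"
    and r: "0 < r" "c * r < \<rho>"
    and van: "\<And>v. v \<in> V \<Longrightarrow> vanishes_to_order m (\<lambda>t. H (t * fst v, t * snd v))"
  obtains K where "continuous_on (V \<times> ball 0 r) (\<lambda>q. K (fst q) (snd q))"
    "\<And>v t. v \<in> V \<Longrightarrow> t \<in> ball 0 r \<Longrightarrow> H (t * fst v, t * snd v) = t ^ m * K v t"
    "\<And>v. v \<in> V \<Longrightarrow> K v holomorphic_on ball 0 r"
proof -
  have in_ball: "(t * fst v, t * snd v) \<in> ball 0 \<rho>" if "v \<in> V" "t \<in> cball 0 r" for v t
  proof -
    have "norm t * norm v \<le> r * c"
      using V[OF that(1)] that(2) r(1) by (intro mult_mono) auto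
    also have "\<dots> < \<rho>" using r(2) by (simp add: mult.commute)
    finally show ?thesis by (simp add: norm_complex_scale)
  qed
  define K where "K v t = 1 / (2 * of_real pi * \<i>) *
      contour_integral (circlepath 0 r) (\<lambda>\<tau>. H (\<tau> * fst v, \<tau> * snd v) / \<tau> ^ m / (\<tau> - t))" for v t
  have "continuous_on ((V \<times> ball 0 r) \<times> sphere 0 r)
      (\<lambda>q. H (snd q * fst (fst (fst q)), snd q * snd (fst (fst q))))"
    by (rule continuous_on_compose2[OF holomorphic2_on_continuous[OF H]])
      (auto intro!: continuous_intros in_ball simp del: mem_ball)
  then have "continuous_on (V \<times> ball 0 r) (\<lambda>q. K (fst q) (snd q))"
    unfolding K_def
    by (intro continuous_intros continuous_on_circle_integral_param)
      (use r in \<open>auto simp: case_prod_beta intro!: continuous_intros\<close>)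
  moreover have "H (t * fst v, t * snd v) = t ^ m * K v t \<and>
      (\<exists>\<kappa>. \<kappa> holomorphic_on ball 0 r \<and> (\<forall>t\<in>ball 0 r. K v t = \<kappa> t))" if v: "v \<in> V" and t: "t \<in> ball 0 r" for v t
  proof -
    define D where "D = (\<lambda>t. (t * fst v, t * snd v)) -` ball 0 \<rho>"
    have D: "open D" unfolding D_def by (intro open_vimage continuous_intros) auto
    have hol: "(\<lambda>t. H (t * fst v, t * snd v)) holomorphic_on D"
      by (rule holomorphic2_on_along_curve[OF H _ _ D])
        (auto simp: D_def intro!: holomorphic_intros)
    obtain k s where s: "s > 0" "k holomorphic_on ball 0 s"
      and k: "\<And>t. t \<in> ball 0 s \<Longrightarrow> H (t * fst v, t * snd v) = t ^ m * k t"
      using van[OF v] unfolding vanishes_to_order_def by blast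
    define \<kappa> where "\<kappa> t = (if t = 0 then k 0 else H (t * fst v, t * snd v) / t ^ m)" for t
    have "(\<lambda>t. H (t * fst v, t * snd v) / t ^ m) holomorphic_on (D - {0})"
      by (intro holomorphic_intros holomorphic_on_subset[OF hol]) auto
    then have 1: "\<kappa> holomorphic_on (D - {0})"
      by (rule holomorphic_transform) (auto simp: \<kappa>_def)
    have 2: "\<kappa> holomorphic_on ball 0 s"
      by (rule holomorphic_transform[OF s(2)]) (use k in \<open>auto simp: \<kappa>_def\<close>)
    have "\<kappa> holomorphic_on (D - {0} \<union> ball 0 s)"
      by (rule holomorphic_on_Un[OF 1 2]) (use D in auto)
    then have \<kappa>: "\<kappa> holomorphic_on cball 0 r"
      by (rule holomorphic_on_subset) (use in_ball[OF v] s(1) in \<open>auto simp: D_def\<close>)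
    have eq: "K v t = \<kappa> t" if t: "t \<in> ball 0 r" for t
    proof -
      have "((\<lambda>u. \<kappa> u / (u - t)) has_contour_integral 2 * of_real pi * \<i> * \<kappa> t) (circlepath 0 r)"
        by (rule Cauchy_integral_circlepath_simple[OF \<kappa>]) (use t in simp)
      then have "contour_integral (circlepath 0 r) (\<lambda>u. \<kappa> u / (u - t)) = 2 * of_real pi * \<i> * \<kappa> t"
        by (rule contour_integral_unique)
      moreover have "contour_integral (circlepath 0 r) (\<lambda>\<tau>. H (\<tau> * fst v, \<tau> * snd v) / \<tau> ^ m / (\<tau> - t))
          = contour_integral (circlepath 0 r) (\<lambda>u. \<kappa> u / (u - t))"
        by (rule contour_integral_eq) (use r in \<open>auto simp: \<kappa>_def path_image_circlepath\<close>)
      ultimately show ?thesis by (simp add: K_def)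
    qed
    have "H (t * fst v, t * snd v) = t ^ m * K v t"
      using k[of 0] s(1) t by (auto simp: eq[OF t] \<kappa>_def)
    moreover have "\<kappa> holomorphic_on ball 0 r"
      by (rule holomorphic_on_subset[OF \<kappa>]) auto
    ultimately show ?thesis using eq by blast
  qed
  moreover have "K v holomorphic_on ball 0 r" if "v \<in> V" for v
    using calculation(2)[OF that, of 0] r(1) by (auto intro: holomorphic_transform)
  ultimately show ?thesis using that by blast
qed

lemma continuous_factor_unique:
  fixes a b :: "complex \<Rightarrow> complex"
  assumes s: "s > 0" and "isCont a 0" "isCont b 0"
    and eq: "\<And>t. t \<in> ball 0 s \<Longrightarrow> t ^ m * a t = t ^ m * b t"
  shows "a 0 = b 0"
proof -
  have "(a \<longlongrightarrow> a 0) (at 0)" "(b \<longlongrightarrow> b 0) (at 0)" using assms by (auto simp: isCont_def)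
  moreover have "\<forall>\<^sub>F t in at 0. a t = b t"
    unfolding eventually_at
  proof (intro exI[of _ s] conjI ballI impI)
    fix t :: complex assume t: "t \<noteq> 0 \<and> dist t 0 < s"
    then have "t ^ m * a t = t ^ m * b t" by (intro eq) auto
    then show "a t = b t" using t by simp
  qed (use s in auto)
  ultimately have "(b \<longlongrightarrow> a 0) (at 0)" using tendsto_cong by blast
  then show ?thesis using \<open>(b \<longlongrightarrow> b 0) (at 0)\<close> tendsto_unique[of "at (0::complex)"] by auto
qed

lemma deriv_along_line:
  assumes H: "holomorphic2_on H (ball 0 \<rho>)" and \<rho>: "\<rho> > 0" and d: "d1 H 0 = 0" "d2 H 0 = 0"
  shows "deriv (\<lambda>t. H (t * a, t * b)) 0 = 0"
proof -
  have "(H has_derivative (\<lambda>x. d1 H 0 * fst x + d2 H 0 * snd x)) (at 0)"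
    by (rule holomorphic2_on_has_derivative[OF open_ball H]) (use \<rho> in simp)
  then have h: "(H has_derivative (\<lambda>x. 0)) (at (0 * a, 0 * b))"
    using d by (simp add: zero_prod_def)
  have "((\<lambda>t. (t * a, t * b)) has_derivative (\<lambda>t. (t * a, t * b))) (at 0)"
    by (auto intro!: derivative_eq_intros)
  from has_derivative_compose[OF this h]
  have "((\<lambda>t. H (t * a, t * b)) has_field_derivative 0) (at 0)"
    unfolding has_field_derivative_def by (rule has_derivative_eq_rhs) auto
  then show ?thesis by (rule DERIV_imp_deriv)
qed

lemma holomorphic_on_line:
  assumes H: "holomorphic2_on H (ball 0 \<rho>)" and c: "norm (a, b) < c" and \<rho>: "\<rho> > 0"
  shows "(\<lambda>t. H (t * a, t * b)) holomorphic_on ball 0 (\<rho> / c)"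
proof (rule holomorphic2_on_along_curve[OF H])
  fix t :: complex assume t: "t \<in> ball 0 (\<rho> / c)"
  have c0: "c > 0" using c norm_ge_zero[of "(a, b)"] by linarith
  have "norm t * norm (a, b) \<le> norm t * c" using c by (intro mult_left_mono) auto
  also have "\<dots> < \<rho>" using t c0 by (simp add: pos_less_divide_eq)
  finally show "(t * a, t * b) \<in> ball 0 \<rho>" using norm_complex_scale[of t "(a, b)"] by simp
qed (auto intro!: holomorphic_intros)

text \<open>Divide by \<open>t^2\<close> along the lines through the unit sphere; the quotient is bounded by compactness.\<close>

lemma quadratic_bound:
  assumes H: "holomorphic2_on H (ball 0 \<rho>)" and \<rho>: "\<rho> > 0"
    and 0: "H 0 = 0" "d1 H 0 = 0" "d2 H 0 = 0"
  obtains C s where "s > 0" "C > 0" "\<And>x. x \<in> ball 0 s \<Longrightarrow> norm (H x) \<le> C * norm x ^ 2"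
proof -
  let ?V = "sphere (0 :: complex \<times> complex) 1"
  have van: "vanishes_to_order 2 (\<lambda>t. H (t * fst v, t * snd v))" if "v \<in> ?V" for v
  proof (rule vanishes_to_order_2)
    show "(\<lambda>t. H (t * fst v, t * snd v)) holomorphic_on ball 0 (\<rho> / 2)"
      by (rule holomorphic_on_line[OF H _ \<rho>]) (use that in auto)
  qed (use deriv_along_line[OF H \<rho> 0(2,3)] 0(1) \<rho> in \<open>auto simp: zero_prod_def\<close>)
  obtain K where K: "continuous_on (?V \<times> ball 0 (\<rho> / 2)) (\<lambda>q. K (fst q) (snd q))"
    "\<And>v t. v \<in> ?V \<Longrightarrow> t \<in> ball 0 (\<rho> / 2) \<Longrightarrow> H (t * fst v, t * snd v) = t ^ 2 * K v t"
  proof (rule radial_quotient[OF H, of ?V 1 "\<rho> / 2" 2])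
    show "vanishes_to_order 2 (\<lambda>t. H (t * fst v, t * snd v))" if "v \<in> ?V" for v
      by (rule van[OF that])
  qed (use \<rho> in auto)
  have "compact ((\<lambda>q. K (fst q) (snd q)) ` (?V \<times> cball 0 (\<rho> / 4)))"
    by (intro compact_continuous_image continuous_on_subset[OF K(1)] compact_Times) (use \<rho> in auto)
  then have "bounded ((\<lambda>q. K (fst q) (snd q)) ` (?V \<times> cball 0 (\<rho> / 4)))"
    by (rule compact_imp_bounded)
  then obtain B where B': "\<forall>x\<in>(\<lambda>q. K (fst q) (snd q)) ` (?V \<times> cball 0 (\<rho> / 4)). norm x \<le> B"
    unfolding bounded_iff by blast
  have B: "norm (K v t) \<le> B" if "v \<in> ?V" "t \<in> cball 0 (\<rho> / 4)" for v t
    using B'[rule_format, OF imageI, of "(v, t)"] that by simp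
  have "norm (H x) \<le> (\<bar>B\<bar> + 1) * norm x ^ 2" if x: "x \<in> ball 0 (\<rho> / 4)" for x
  proof (cases "x = 0")
    case True
    then show ?thesis using 0 by simp
  next
    case False
    define v where "v = (fst x / of_real (norm x), snd x / of_real (norm x))"
    have xv: "x = (of_real (norm x) * fst v, of_real (norm x) * snd v)"
      using False by (simp add: v_def prod_eq_iff)
    have "norm x = norm x * norm v"
      using norm_complex_scale[of "of_real (norm x)" v] xv by simp
    then have v: "v \<in> ?V" using False by simp
    have "norm (of_real (norm x) :: complex) < \<rho> / 4" using x by simp
    then have "H x = of_real (norm x) ^ 2 * K v (of_real (norm x))" "norm (K v (of_real (norm x))) \<le> B"
      using K(2)[OF v, of "of_real (norm x)"] B[OF v, of "of_real (norm x)"] xv \<rho> by auto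
    then have "norm (H x) = norm x ^ 2 * norm (K v (of_real (norm x)))"
      by (simp add: norm_mult norm_power)
    also have "\<dots> \<le> norm x ^ 2 * (\<bar>B\<bar> + 1)"
      using \<open>norm (K v (of_real (norm x))) \<le> B\<close> by (intro mult_left_mono) auto
    finally show ?thesis by (simp add: mult.commute)
  qed
  then show ?thesis using that[of "\<rho> / 4" "\<bar>B\<bar> + 1"] \<rho> by auto
qed

text \<open>Take a direction \<open>(\<mu>0, 1)\<close> along which \<open>H\<close> vanishes to the least possible order \<open>m\<close>.
  Then \<open>H (t v) / t^m\<close> is continuous in the direction and nonzero at \<open>(\<mu>0, 1)\<close>, so \<open>H\<close> has no
  zeros other than \<open>0\<close> in a cone around that direction.  In coordinates whose second axis lies in
  the cone, the roots \<open>w\<close> of \<open>H (z, w) = 0\<close> are bounded by a multiple of \<open>z\<close>.\<close>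

lemma noncharacteristic_directions:
  assumes H: "holomorphic2_on H (ball 0 \<rho>)" and x: "x \<in> ball 0 \<rho>" "H x \<noteq> 0"
  obtains \<mu>0 \<epsilon> where "\<epsilon> > 0" "\<And>\<mu> z w. \<mu> \<in> ball \<mu>0 \<epsilon> \<Longrightarrow> norm z < \<epsilon> * norm w \<Longrightarrow> norm w < \<epsilon> \<Longrightarrow>
    H (z + \<mu> * w, w) \<noteq> 0"
proof -
  have \<rho>: "\<rho> > 0" using x(1) norm_ge_zero[of x] by (simp del: norm_ge_zero)
  define exact where "exact n \<mu> k s \<longleftrightarrow> s > 0 \<and> k holomorphic_on ball 0 s \<and> k 0 \<noteq> 0 \<and>
      (\<forall>t\<in>ball 0 s. H (t * \<mu>, t * 1) = t ^ n * k t)" for n \<mu> s and k :: "complex \<Rightarrow> complex"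
  have dich: "(\<exists>n k s. exact n \<mu> k s)" if c: "norm (\<mu>, 1::complex) < c"
    and w: "w \<in> ball 0 (\<rho> / c)" "H (w * \<mu>, w * 1) \<noteq> 0" for \<mu> c w
  proof -
    have hol: "(\<lambda>t. H (t * \<mu>, t * 1)) holomorphic_on ball 0 (\<rho> / c)"
      by (rule holomorphic_on_line[OF H c \<rho>])
    have "c > 0" using c norm_ge_zero[of "(\<mu>, 1::complex)"] by linarith
    then have z: "0 \<in> ball 0 (\<rho> / c)" using \<rho> by simp
    obtain n k s where "s > 0" "k holomorphic_on cball 0 s"
      "\<And>w. w \<in> cball 0 s \<Longrightarrow> H (w * \<mu>, w * 1) = k w * (w - 0) ^ n" "\<And>w. w \<in> cball 0 s \<Longrightarrow> k w \<noteq> 0"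
      using zorder_factorization[OF hol z w] by metis
    then have "exact n \<mu> k s"
      unfolding exact_def by (auto intro: holomorphic_on_subset)
    then show ?thesis by blast
  qed
  have ex: "\<exists>n \<mu> k s. exact n \<mu> k s"
  proof -
    have "open (ball 0 \<rho> \<inter> H -` (- {0}))"
      by (rule continuous_open_preimage[OF holomorphic2_on_continuous[OF H]]) auto
    then obtain e where e: "e > 0" "cball (fst x) e \<times> cball (snd x) e \<subseteq> ball 0 \<rho> \<inter> H -` (- {0})"
      using open_contains_polydisc[of "ball 0 \<rho> \<inter> H -` (- {0})" "fst x" "snd x"] x by auto
    define w where "w = (if snd x = 0 then of_real e else snd x)"
    have "w \<noteq> 0" using e(1) by (simp add: w_def)
    have "(fst x, w) \<in> cball (fst x) e \<times> cball (snd x) e" using e(1) by (simp add: w_def)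
    from subsetD[OF e(2) this] have xw: "(fst x, w) \<in> ball 0 \<rho>" "H (fst x, w) \<noteq> 0" by auto
    define \<mu> where "\<mu> = fst x / w"
    have eq: "(fst x, w) = (w * \<mu>, w * 1)" using \<open>w \<noteq> 0\<close> by (simp add: \<mu>_def)
    have "norm w * norm (\<mu>, 1::complex) < \<rho>"
      using xw(1) norm_complex_scale[of w "(\<mu>, 1)"] unfolding eq by simp
    moreover have n0: "norm (\<mu>, 1::complex) > 0" by (simp add: zero_prod_def)
    ultimately have "norm w * norm (\<mu>, 1::complex) / norm w < \<rho> / norm w"
      using \<open>w \<noteq> 0\<close> by (intro divide_strict_right_mono) auto
    then have "norm (\<mu>, 1::complex) < \<rho> / norm w" using \<open>w \<noteq> 0\<close> by simp
    then obtain c where c: "norm (\<mu>, 1::complex) < c" "c < \<rho> / norm w" using dense by blast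
    have "c > 0" using c(1) n0 by linarith
    moreover have "c * norm w < \<rho>" using c(2) \<open>w \<noteq> 0\<close> by (simp add: pos_less_divide_eq)
    ultimately have "norm w < \<rho> / c" by (simp add: pos_less_divide_eq mult.commute)
    then show ?thesis using dich[OF c(1), of w] xw(2) unfolding eq by auto
  qed
  define m where "m = (LEAST n. \<exists>\<mu> k s. exact n \<mu> k s)"
  have "\<exists>\<mu> k s. exact m \<mu> k s" unfolding m_def using ex by (rule LeastI_ex)
  then obtain \<mu>0 k0 s0 where k0: "exact m \<mu>0 k0 s0" by blast
  have m_le: "m \<le> n" if "exact n \<mu> k s" for n \<mu> k s
    unfolding m_def using that by (intro Least_le) blast
  let ?V = "{(\<mu>, 1::complex) | \<mu>. \<mu> \<in> ball \<mu>0 1}"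
  define c where "c = norm \<mu>0 + 3"
  have V: "norm v < c" if v: "v \<in> ?V" for v
  proof -
    obtain \<mu> where \<mu>: "v = (\<mu>, 1)" "\<mu> \<in> ball \<mu>0 1" using v by blast
    have "norm v \<le> norm \<mu> + norm (1::complex)" unfolding \<mu> by (rule norm_Pair_le)
    moreover have "norm \<mu> \<le> norm \<mu>0 + 1"
      using \<mu>(2) norm_triangle_ineq2[of \<mu> \<mu>0] by (simp add: dist_norm norm_minus_commute)
    ultimately show ?thesis by (simp add: c_def)
  qed
  have van: "vanishes_to_order m (\<lambda>t. H (t * fst v, t * snd v))" if v: "v \<in> ?V" for v
  proof -
    obtain \<mu> where \<mu>: "v = (\<mu>, 1)" using v by blast
    have c': "norm (\<mu>, 1::complex) < c" using V[OF v] \<mu> by simp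
    show ?thesis
    proof (cases "\<exists>w\<in>ball 0 (\<rho> / c). H (w * \<mu>, w * 1) \<noteq> 0")
      case False
      have "c > 0" unfolding c_def using norm_ge_zero[of \<mu>0] by linarith
      then show ?thesis
        unfolding vanishes_to_order_def using False \<rho>
        by (intro exI[of _ "\<lambda>_. 0"] exI[of _ "\<rho> / c"]) (auto simp: \<mu>)
    next
      case True
      then obtain n k s where nks: "exact n \<mu> k s" using dich[OF c'] by blast
      have "t ^ n * k t = t ^ m * (t ^ (n - m) * k t)" for t
        using m_le[OF nks] by (simp flip: power_add mult.assoc)
      then show ?thesis
        using nks unfolding vanishes_to_order_def exact_def
        by (intro exI[of _ "\<lambda>t. t ^ (n - m) * k t"] exI[of _ s])
          (auto simp: \<mu> intro!: holomorphic_intros)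
    qed
  qed
  have c0: "c > 0" unfolding c_def using norm_ge_zero[of \<mu>0] by linarith
  define r where "r = \<rho> / (2 * c)"
  have r: "r > 0" "c * r < \<rho>" using c0 \<rho> by (auto simp: r_def field_simps)
  obtain K where K: "continuous_on (?V \<times> ball 0 r) (\<lambda>q. K (fst q) (snd q))"
    "\<And>v t. v \<in> ?V \<Longrightarrow> t \<in> ball 0 r \<Longrightarrow> H (t * fst v, t * snd v) = t ^ m * K v t"
    "\<And>v. v \<in> ?V \<Longrightarrow> K v holomorphic_on ball 0 r"
  proof (rule radial_quotient[OF H, of ?V c r m])
    show "norm v \<le> c" if "v \<in> ?V" for v using V[OF that] by simp
    show "vanishes_to_order m (\<lambda>t. H (t * fst v, t * snd v))" if "v \<in> ?V" for v
      by (rule van[OF that])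
  qed (use r in blast)+
  have v0: "(\<mu>0, 1) \<in> ?V" by simp
  have K0: "K (\<mu>0, 1) 0 \<noteq> 0"
  proof -
    have 0: "s0 > 0" "k0 holomorphic_on ball 0 s0" "k0 0 \<noteq> 0"
      "\<And>t. t \<in> ball 0 s0 \<Longrightarrow> H (t * \<mu>0, t * 1) = t ^ m * k0 t"
      using k0 unfolding exact_def by auto
    have "K (\<mu>0, 1) 0 = k0 0"
    proof (rule continuous_factor_unique[of "min r s0" _ _ m])
      show "isCont (K (\<mu>0, 1)) 0"
        using holomorphic_on_imp_continuous_on[OF K(3)[OF v0]] r(1)
        by (simp add: continuous_on_eq_continuous_at)
      show "isCont k0 0"
        using holomorphic_on_imp_continuous_on[OF 0(2)] 0(1)
        by (simp add: continuous_on_eq_continuous_at)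
      show "t ^ m * K (\<mu>0, 1) t = t ^ m * k0 t" if "t \<in> ball 0 (min r s0)" for t
      proof -
        have "t \<in> ball 0 r" "t \<in> ball 0 s0" using that by auto
        then show ?thesis using K(2)[OF v0, of t] 0(4)[of t] by (simp only: fst_conv snd_conv)
      qed
    qed (use r 0 in simp)
    then show ?thesis using 0(3) by simp
  qed
  have cK: "continuous_on (ball \<mu>0 1 \<times> ball 0 r) (\<lambda>p. K (fst p, 1) (snd p))"
  proof -
    have "continuous_on (ball \<mu>0 1 \<times> ball 0 r) (\<lambda>p. (\<lambda>q. K (fst q) (snd q)) ((fst p, 1), snd p))"
      by (rule continuous_on_compose2[OF K(1)]) (auto intro!: continuous_intros)
    then show ?thesis by simp
  qed
  let ?O = "(ball \<mu>0 1 \<times> ball 0 r) \<inter> (\<lambda>p. K (fst p, 1) (snd p)) -` (- {0})"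
  have "open ?O"
    by (rule continuous_open_preimage[OF cK]) (auto intro: open_Times)
  moreover have "(\<mu>0, 0) \<in> ?O" using K0 r(1) by simp
  ultimately obtain \<eta> where \<eta>: "\<eta> > 0" "cball \<mu>0 \<eta> \<times> cball 0 \<eta> \<subseteq> ?O"
    by (rule open_contains_polydisc)
  show ?thesis
  proof (rule that[of "\<eta> / 2" \<mu>0])
    fix \<mu> z w :: complex assume *: "\<mu> \<in> ball \<mu>0 (\<eta> / 2)" "norm z < \<eta> / 2 * norm w" "norm w < \<eta> / 2"
    then have w0: "w \<noteq> 0" by auto
    have "norm (z / w) < \<eta> / 2" using *(2) w0 by (simp add: norm_divide field_simps)
    then have "norm (\<mu>0 - (\<mu> + z / w)) < \<eta>"
      using *(1) norm_triangle_ineq4[of "\<mu>0 - \<mu>" "z / w"] by (simp add: dist_norm algebra_simps)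
    then have "(\<mu> + z / w, w) \<in> cball \<mu>0 \<eta> \<times> cball 0 \<eta>" using *(3) \<eta>(1) by (simp add: dist_norm)
    then have 1: "(\<mu> + z / w, w) \<in> (ball \<mu>0 1 \<times> ball 0 r) \<inter> (\<lambda>p. K (fst p, 1) (snd p)) -` (- {0})"
      using \<eta>(2) by blast
    then have "H (w * fst (\<mu> + z / w, 1::complex), w * snd (\<mu> + z / w, 1::complex)) = w ^ m * K (\<mu> + z / w, 1) w"
      by (intro K(2)) auto
    moreover have "w * (\<mu> + z / w) = z + \<mu> * w" using w0 by (simp add: field_simps)
    ultimately show "H (z + \<mu> * w, w) \<noteq> 0" using 1 w0 by simp
  qed (use \<eta> in simp)
qed

section \<open>Simple zeros of the product over the roots\<close>

lemma has_derivative_bounded_below: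
  fixes F :: "'a::euclidean_space \<Rightarrow> 'b::euclidean_space"
  assumes F: "(F has_derivative L) (at p)" and inj: "inj L"
  obtains c s where "c > 0" "s > 0" "\<And>x. x \<in> ball p s \<Longrightarrow> c * norm (x - p) \<le> norm (F x - F p)"
proof -
  have lin: "linear L" using F has_derivative_linear by blast
  obtain B where B: "B > 0" "\<And>x. B * norm x \<le> norm (L x)"
    using linear_inj_bounded_below_pos[OF lin inj] by (metis mult.commute)
  have "\<forall>e>0. \<exists>d>0. \<forall>y. norm (y - p) < d \<longrightarrow> norm (F y - F p - L (y - p)) \<le> e * norm (y - p)"
    using F unfolding has_derivative_at_alt by blast
  then obtain d where d: "d > 0" "\<And>y. norm (y - p) < d \<Longrightarrow> norm (F y - F p - L (y - p)) \<le> B / 2 * norm (y - p)"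
    using B(1) half_gt_zero by blast
  show ?thesis
  proof (rule that[of "B / 2" d])
    fix x assume "x \<in> ball p d"
    then have "norm (F x - F p - L (x - p)) \<le> B / 2 * norm (x - p)"
      by (intro d(2)) (simp add: dist_norm norm_minus_commute)
    moreover have "norm (L (x - p)) \<le> norm (F x - F p) + norm (F x - F p - L (x - p))"
      using norm_triangle_ineq4[of "F x - F p" "F x - F p - L (x - p)"] by simp
    ultimately show "B / 2 * norm (x - p) \<le> norm (F x - F p)"
      using B(2)[of "x - p"] by simp
  qed (use B d in auto)
qed

lemma zorder_simple:
  fixes f :: "complex \<Rightarrow> complex"
  assumes "f holomorphic_on S" "open S" "z \<in> S" "f z = 0" "deriv f z \<noteq> 0"
  shows "zorder f z = 1"
  by (rule zorder_zero_eqI[OF assms(1-3)]) (use assms in auto)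

lemma sum_eq_1_ge_1:
  fixes h :: "'a \<Rightarrow> int"
  assumes "finite Z" "\<And>z. z \<in> Z \<Longrightarrow> 1 \<le> h z" "sum h Z = 1"
  obtains z where "Z = {z}" "h z = 1"
proof -
  have "int (card Z) \<le> sum h Z"
    using sum_bounded_below[of Z 1 h] assms by simp
  moreover have "Z \<noteq> {}" using assms(3) by auto
  ultimately have "card Z = 1" using assms by (simp add: card_gt_0_iff le_antisym Suc_leI)
  then obtain z where "Z = {z}" by (rule card_1_singletonE)
  then show ?thesis using assms that by auto
qed

lemmas holomorphic2_on_slices =
  separately_holomorphic_onD(2,3)[OF holomorphic2_on_imp_separately_holomorphic_on]

text \<open>At a point \<open>(z0, w0)\<close> where \<open>(A, B)\<close> is regular and which is the only common solution over
  \<open>z0\<close>, the product over the roots has a zero of order at most one.  For \<open>z\<close> near \<open>z0\<close>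
  there is one simple root near \<open>w0\<close>, and its factor is at least a multiple of
  \<open>z - z0\<close>, as \<open>(A, B)\<close> expands distances at a regular point up to a constant; the factors of
  the other roots stay away from zero by compactness.\<close>

lemma root_product_bounded_below:
  fixes A B :: "complex \<times> complex \<Rightarrow> complex"
  assumes S: "open S" and AB: "holomorphic2_on A S" "holomorphic2_on B S"
    and sub: "\<And>z w. z \<in> ball z0 \<delta> \<Longrightarrow> w \<in> ball 0 R \<Longrightarrow> (z, w) \<in> S" and \<delta>: "\<delta> > 0"
    and r: "0 < r" "r < R"
    and nz: "\<And>z w. z \<in> ball z0 \<delta> \<Longrightarrow> w \<in> sphere 0 r \<Longrightarrow> A (z, w) \<noteq> y1"
    and m: "\<And>z. z \<in> ball z0 \<delta> \<Longrightarrow>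
      (\<Sum>w | w \<in> ball 0 r \<and> A (z, w) - y1 = 0. zorder (\<lambda>w. A (z, w) - y1) w) = int m"
    and w0: "w0 \<in> ball 0 r" "A (z0, w0) = y1" "B (z0, w0) = y2"
    and uniq: "\<And>w. w \<in> ball 0 r \<Longrightarrow> A (z0, w) = y1 \<Longrightarrow> B (z0, w) = y2 \<Longrightarrow> w = w0"
    and d2: "d2 A (z0, w0) \<noteq> 0" and J: "jacobian (\<lambda>x. (A x, B x)) (z0, w0) \<noteq> 0"
  obtains c where "c > 0" "\<forall>\<^sub>F z in at z0.
    c * norm (z - z0) \<le> norm (root_product r (\<lambda>w. A (z, w) - y1) (\<lambda>w. y2 - B (z, w)))"
proof -
  let ?F = "\<lambda>x. (A x, B x)"
  have z0: "z0 \<in> ball z0 \<delta>" using \<delta> by simp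
  have w0R: "w0 \<in> ball 0 R" using w0(1) r by auto
  have p: "(z0, w0) \<in> S" by (rule sub[OF z0 w0R])
  have F: "holomorphic2_map_on ?F S" using AB by (intro holomorphic2_map_onI) auto
  obtain c1 s1 where c1: "c1 > 0" "s1 > 0"
    "\<And>x. x \<in> ball (z0, w0) s1 \<Longrightarrow> c1 * norm (x - (z0, w0)) \<le> norm (?F x - ?F (z0, w0))"
    by (rule has_derivative_bounded_below[OF holomorphic2_map_on_has_derivative[OF S F p]])
      (use J in \<open>simp_all add: inj_linear2_iff jacobian_def\<close>)
  have holA: "(\<lambda>w. A (z, w) - y1) holomorphic_on ball 0 R" if "z \<in> ball z0 \<delta>" for z
    by (intro holomorphic_intros holomorphic2_on_slices(2)[OF AB(1)] sub[OF that])
  have contAB: "continuous_on S A" "continuous_on S B" using AB holomorphic2_on_continuous by blast+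
  \<comment> \<open>Near the point w0 the function has exactly one root, a simple one.\<close>
  have dA: "((\<lambda>w. A (z0, w) - y1) has_field_derivative d2 A (z0, w0)) (at w0)"
  proof -
    have "(\<lambda>w. A (z0, w)) holomorphic_on ball 0 R"
      by (intro holomorphic2_on_slices(2)[OF AB(1)] sub[OF z0])
    from holomorphic_derivI[OF this open_ball w0R] show ?thesis
      by (auto simp: d2_def intro!: derivative_eq_intros)
  qed
  have ord1: "zorder (\<lambda>w. A (z0, w) - y1) w0 = 1"
    by (rule zorder_simple[OF holA[OF z0] open_ball w0R])
      (use w0 d2 DERIV_imp_deriv[OF dA] in auto)
  have rR: "of_real r \<in> ball (0::complex) R" "of_real r \<in> sphere (0::complex) r" using r by auto
  obtain n g s2 where n: "s2 > 0" "cball w0 s2 \<subseteq> ball 0 R"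
    "\<And>w. w \<in> cball w0 s2 \<Longrightarrow> A (z0, w) - y1 = g w * (w - w0) ^ n"
    "\<And>w. w \<in> cball w0 s2 \<Longrightarrow> g w \<noteq> 0"
  proof -
    have "A (z0, of_real r) - y1 \<noteq> 0" using nz[OF z0 rR(2)] by simp
    from zorder_factorization[OF holA[OF z0] w0R rR(1) this] show ?thesis using that by metis
  qed
  obtain s3 where s3: "s3 > 0" "ball w0 s3 \<subseteq> ball 0 r"
    using w0(1) by (meson open_ball open_contains_ball)
  define e where "e = min (s1 / 2) (min s2 s3) / 2"
  have e: "e > 0" "e < s1 / 2" "e < s2" "e < s3" using c1(2) n(1) s3(1) by (auto simp: e_def)
  have s2R: "ball w0 s2 \<subseteq> ball 0 R" using n(2) ball_subset_cball by blast
  obtain e1 where e1: "e1 > 0" "ball z0 e1 \<subseteq> ball z0 \<delta>"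
    "\<And>z. z \<in> ball z0 e1 \<Longrightarrow> finite {w \<in> ball w0 e. A (z, w) - y1 = 0}"
    "\<And>z. z \<in> ball z0 e1 \<Longrightarrow>
      (\<Sum>w | w \<in> ball w0 e \<and> A (z, w) - y1 = 0. zorder (\<lambda>w. A (z, w) - y1) w) = zorder (\<lambda>w. A (z0, w) - y1) w0"
  proof (rule zero_count_stable[of "ball z0 \<delta>" z0 w0 e "\<lambda>z w. A (z, w) - y1" s2])
    have "continuous_on (ball z0 \<delta> \<times> sphere w0 e) A"
      by (rule continuous_on_subset[OF contAB(1)]) (use sub s2R e(3) in \<open>auto intro!: sub\<close>)
    then show "continuous_on (ball z0 \<delta> \<times> sphere w0 e) (\<lambda>(p, z). A (p, z) - y1)"
      by (auto simp: case_prod_beta intro!: continuous_intros)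
    show "(\<lambda>w. A (z, w) - y1) holomorphic_on ball w0 s2" if "z \<in> ball z0 \<delta>" for z
      by (rule holomorphic_on_subset[OF holA[OF that] s2R])
    show "A (z0, w) - y1 \<noteq> 0" if "w \<in> cball w0 e - {w0}" for w
      using n(3)[of w] n(4)[of w] that e by auto
  qed (use z0 w0 e in auto)
  \<comment> \<open>Away from w0 the two equations have no common root.\<close>
  define K where "K = cball 0 r - ball w0 e"
  have K: "compact K" unfolding K_def by (intro compact_diff) auto
  have KR: "K \<subseteq> ball 0 R" using r by (auto simp: K_def)
  define q where "q x = norm (A x - y1) + norm (y2 - B x)" for x
  have cq: "continuous_on (ball z0 \<delta> \<times> K) q"
    unfolding q_def
    by (intro continuous_intros continuous_on_subset[OF contAB(1)] continuous_on_subset[OF contAB(2)])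
      (use sub KR in auto)
  have qpos: "q (z0, w) > 0" if "w \<in> K" for w
  proof (rule ccontr)
    assume "\<not> q (z0, w) > 0"
    then have "norm (A (z0, w) - y1) + norm (y2 - B (z0, w)) \<le> 0" by (simp add: q_def)
    then have "norm (A (z0, w) - y1) = 0" "norm (y2 - B (z0, w)) = 0"
      using norm_ge_zero[of "A (z0, w) - y1"] norm_ge_zero[of "y2 - B (z0, w)"] by linarith+
    then have *: "A (z0, w) = y1" "B (z0, w) = y2" by auto
    then have "w \<notin> sphere 0 r" using nz[OF z0] by blast
    then have "w = w0" using that * by (intro uniq) (auto simp: K_def)
    then show False using that e by (simp add: K_def)
  qed
  obtain c2 e2 where c2: "c2 > 0" "e2 > 0" "\<And>z w. z \<in> ball z0 e2 \<Longrightarrow> w \<in> K \<Longrightarrow> z \<in> ball z0 \<delta> \<Longrightarrow> c2 \<le> q (z, w)"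
  proof (cases "K = {}")
    case True
    then show ?thesis using that[of 1 1] by auto
  next
    case False
    have "continuous_on K (\<lambda>w. q (z0, w))"
      by (rule continuous_on_compose2[OF cq]) (use z0 in \<open>auto intro!: continuous_intros\<close>)
    then obtain w1 where w1: "w1 \<in> K" "\<And>w. w \<in> K \<Longrightarrow> q (z0, w1) \<le> q (z0, w)"
      using continuous_attains_inf[OF K False] by blast
    define c2 where "c2 = q (z0, w1) / 2"
    have c2: "c2 > 0" using qpos[OF w1(1)] by (simp add: c2_def)
    obtain X where X: "z0 \<in> X" "open X" "\<forall>z\<in>X \<inter> ball z0 \<delta>. \<forall>w\<in>K. dist (q (z, w)) (q (z0, w)) \<le> c2"
      using continuous_on_prod_compactE[OF cq K z0 c2] by metis
    obtain e2 where e2: "e2 > 0" "ball z0 e2 \<subseteq> X" using X by (meson open_contains_ball)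
    have "c2 \<le> q (z, w)" if *: "z \<in> ball z0 e2" "w \<in> K" "z \<in> ball z0 \<delta>" for z w
    proof -
      have "z \<in> X \<inter> ball z0 \<delta>" using * e2(2) by blast
      from X(3)[rule_format, OF this *(2)] have "q (z0, w) - q (z, w) \<le> c2"
        by (simp add: dist_real_def)
      then show ?thesis using w1(2)[OF *(2)] unfolding c2_def by linarith
    qed
    then show ?thesis using that c2 e2 by blast
  qed
  define \<eta> where "\<eta> = min e1 (min e2 (s1 / 2))"
  have \<eta>: "\<eta> > 0" using e1 c2 c1 by (simp add: \<eta>_def)
  let ?c = "c1 * min 1 c2 ^ m"
  have main: "?c * norm (z - z0) \<le> norm (root_product r (\<lambda>w. A (z, w) - y1) (\<lambda>w. y2 - B (z, w)))"
    if z: "z \<in> ball z0 \<eta>" for z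
  proof -
    let ?f = "\<lambda>w. A (z, w) - y1" and ?g = "\<lambda>w. y2 - B (z, w)"
    let ?Z = "{w. w \<in> ball 0 r \<and> ?f w = 0}"
    let ?k = "\<lambda>w. nat (zorder ?f w)"
    have z1: "z \<in> ball z0 e1" "z \<in> ball z0 e2" "norm (z - z0) < s1 / 2"
      using z by (auto simp: \<eta>_def dist_norm norm_minus_commute)
    have z\<delta>: "z \<in> ball z0 \<delta>" using e1(2) z1(1) by blast
    have fin: "finite ?Z"
      using argument_principle_circle(1)[OF holA[OF z\<delta>] holA[OF z\<delta>] r] nz[OF z\<delta>] by simp
    have pos: "1 \<le> zorder ?f w" if "w \<in> ball 0 R" "?f w = 0" for w
      by (rule zorder_pos_at_zero[OF holA[OF z\<delta>] that(1) rR(1) _ that(2)]) (use nz[OF z\<delta> rR(2)] in simp)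
    obtain w1 where w1: "{w. w \<in> ball w0 e \<and> ?f w = 0} = {w1}" "zorder ?f w1 = 1"
    proof (rule sum_eq_1_ge_1[of "{w. w \<in> ball w0 e \<and> ?f w = 0}" "zorder ?f"])
      show "finite {w. w \<in> ball w0 e \<and> ?f w = 0}" using e1(3)[OF z1(1)] by simp
      show "1 \<le> zorder ?f w" if "w \<in> {w. w \<in> ball w0 e \<and> ?f w = 0}" for w
      proof (rule pos)
        have "w \<in> ball w0 s2" using that e(3) by simp
        then show "w \<in> ball 0 R" using s2R by blast
      qed (use that in simp)
      show "(\<Sum>w | w \<in> ball w0 e \<and> ?f w = 0. zorder ?f w) = 1"
        using e1(4)[OF z1(1)] ord1 by simp
    qed
    have w1': "w1 \<in> ball w0 e" "?f w1 = 0" using w1(1) by auto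
    have "w1 \<in> ball w0 s3" using w1'(1) e(4) by simp
    then have w1Z: "w1 \<in> ?Z" using s3(2) w1'(2) by blast
    have g1: "c1 * norm (z - z0) \<le> norm (?g w1)"
    proof -
      have "norm ((z, w1) - (z0, w0)) \<le> norm (z - z0) + norm (w1 - w0)"
        using norm_Pair_le[of "z - z0" "w1 - w0"] by simp
      moreover have "norm (w1 - w0) < e" using w1'(1) by (simp add: dist_norm norm_minus_commute)
      ultimately have "norm ((z, w1) - (z0, w0)) < s1" using z1(3) e(2) by linarith
      then have "(z, w1) \<in> ball (z0, w0) s1" by (metis mem_ball dist_norm dist_commute)
      from c1(3)[OF this] have "c1 * norm ((z, w1) - (z0, w0)) \<le> norm (?F (z, w1) - ?F (z0, w0))" .
      also have "?F (z, w1) - ?F (z0, w0) = (0, B (z, w1) - y2)" using w1'(2) w0 by simp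
      also have "norm \<dots> = norm (?g w1)" by (simp add: norm_Pair norm_minus_commute)
      finally have "c1 * norm ((z, w1) - (z0, w0)) \<le> norm (?g w1)" .
      moreover have "c1 * norm (z - z0) \<le> c1 * norm ((z, w1) - (z0, w0))"
        using c1(1) norm_fst_le[of "z - z0" "w1 - w0"] by (intro mult_left_mono) auto
      ultimately show ?thesis by linarith
    qed
    have other: "min 1 c2 \<le> norm (?g w)" if w: "w \<in> ?Z - {w1}" for w
    proof -
      have "w \<in> K" using w w1(1) by (auto simp: K_def)
      then have "c2 \<le> q (z, w)" using c2(3) z1(2) z\<delta> by blast
      then show ?thesis using w by (simp add: q_def)
    qed
    have sumk: "sum ?k ?Z = m"
    proof -
      have "int (sum ?k ?Z) = (\<Sum>w\<in>?Z. zorder ?f w)"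
        unfolding of_nat_sum
      proof (rule sum.cong)
        fix w assume "w \<in> ?Z"
        then have "1 \<le> zorder ?f w" using r by (intro pos) auto
        then show "int (?k w) = zorder ?f w" by simp
      qed simp
      also have "\<dots> = int m" by (rule m[OF z\<delta>])
      finally show ?thesis by (simp only: of_nat_eq_iff)
    qed
    have "min 1 c2 ^ m \<le> min 1 c2 ^ (sum ?k (?Z - {w1}))"
    proof (rule power_decreasing)
      show "sum ?k (?Z - {w1}) \<le> m" unfolding sumk[symmetric] using fin by (intro sum_mono2) auto
    qed (use c2 in auto)
    also have "\<dots> = (\<Prod>w\<in>?Z - {w1}. min 1 c2 ^ ?k w)" by (rule power_sum)
    also have "\<dots> \<le> (\<Prod>w\<in>?Z - {w1}. norm (?g w) ^ ?k w)"
      using other c2 by (intro prod_mono) (auto intro!: power_mono)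
    finally have rest: "min 1 c2 ^ m \<le> (\<Prod>w\<in>?Z - {w1}. norm (?g w) ^ ?k w)" .
    have "norm (root_product r ?f ?g) = (\<Prod>w\<in>?Z. norm (?g w) ^ ?k w)"
      by (simp add: root_product_def prod_norm[symmetric] norm_power)
    also have "\<dots> = norm (?g w1) ^ ?k w1 * (\<Prod>w\<in>?Z - {w1}. norm (?g w) ^ ?k w)"
      by (rule prod.remove[OF fin w1Z])
    also have "norm (?g w1) ^ ?k w1 = norm (?g w1)" using w1(2) by simp
    finally have eq: "norm (root_product r ?f ?g) = norm (?g w1) * (\<Prod>w\<in>?Z - {w1}. norm (?g w) ^ ?k w)" .
    have "(c1 * norm (z - z0)) * min 1 c2 ^ m \<le> norm (?g w1) * (\<Prod>w\<in>?Z - {w1}. norm (?g w) ^ ?k w)"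
      by (intro mult_mono g1 rest) (use c2 in auto)
    then show ?thesis unfolding eq by (simp add: mult_ac)
  qed
  show ?thesis
  proof (rule that[of ?c])
    show "?c > 0" using c1 c2 by simp
    show "\<forall>\<^sub>F z in at z0. ?c * norm (z - z0) \<le>
        norm (root_product r (\<lambda>w. A (z, w) - y1) (\<lambda>w. y2 - B (z, w)))"
      unfolding eventually_at by (intro exI[of _ \<eta>]) (use \<eta> main in \<open>auto simp: dist_commute\<close>)
  qed
qed

section \<open>Germs of finite maps of degree three are not critical\<close>

text \<open>Properness of a germ with \<open>F 0 = 0\<close> as the only zero: fibres over points near \<open>0\<close>
  concentrate at \<open>0\<close>.\<close>

definition proper_at_0 ::
    "(complex \<times> complex \<Rightarrow> complex \<times> complex) \<Rightarrow> (complex \<times> complex) set \<Rightarrow> bool" where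
  "proper_at_0 F S \<longleftrightarrow>
     (\<forall>N. open N \<longrightarrow> 0 \<in> N \<longrightarrow> (\<exists>e>0. \<forall>x\<in>S. F x \<in> ball 0 e \<longrightarrow> x \<in> N))"

text \<open>A form of \<open>d\<close> points in the generic fibre that needs no analytic sets: the exceptional set
  contains no open set, and its complement is open near a dense set of points.\<close>

definition generic_degree_at_0 ::
    "(complex \<times> complex \<Rightarrow> complex \<times> complex) \<Rightarrow> (complex \<times> complex) set \<Rightarrow> nat \<Rightarrow> bool" where
  "generic_degree_at_0 F S d \<longleftrightarrow>
     (\<exists>e>0. \<forall>W. open W \<longrightarrow> W \<noteq> {} \<longrightarrow> W \<subseteq> ball 0 e \<longrightarrow>
        (\<exists>W'. open W' \<and> W' \<noteq> {} \<and> W' \<subseteq> W \<and> (\<forall>y\<in>W'. card {x \<in> S. F x = y} = d)))"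

definition finite_germ ::
    "(complex \<times> complex \<Rightarrow> complex \<times> complex) \<Rightarrow> (complex \<times> complex) set \<Rightarrow> nat \<Rightarrow> bool" where
  "finite_germ F S d \<longleftrightarrow> open S \<and> 0 \<in> S \<and> holomorphic2_map_on F S \<and> F 0 = 0 \<and>
     proper_at_0 F S \<and> generic_degree_at_0 F S d"

lemma finite_germD:
  assumes "finite_germ F S d"
  shows "open S" "0 \<in> S" "holomorphic2_map_on F S" "F 0 = 0"
  using assms by (simp_all add: finite_germ_def)

lemma finite_germ_proper:
  assumes germ: "finite_germ F S d" and N: "open N" "0 \<in> N"
  obtains e where "e > 0" "\<And>x. x \<in> S \<Longrightarrow> F x \<in> ball 0 e \<Longrightarrow> x \<in> N"
proof -
  have "proper_at_0 F S" using germ by (simp add: finite_germ_def)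
  from this[unfolded proper_at_0_def, rule_format, OF N] show ?thesis using that by blast
qed

text \<open>Points with a full fibre fill an open set, and by Sard this set contains regular values.\<close>

lemma finite_germ_regular_value:
  assumes germ: "finite_germ F S d" and W: "open W" "\<And>e. e > 0 \<Longrightarrow> W \<inter> ball 0 e \<noteq> {}"
  obtains y where "y \<in> W" "card {x \<in> S. F x = y} = d" "\<And>x. x \<in> S \<Longrightarrow> F x = y \<Longrightarrow> jacobian F x \<noteq> 0"
proof -
  obtain e where e: "e > 0" "\<forall>W. open W \<longrightarrow> W \<noteq> {} \<longrightarrow> W \<subseteq> ball 0 e \<longrightarrow>
        (\<exists>W'. open W' \<and> W' \<noteq> {} \<and> W' \<subseteq> W \<and> (\<forall>y\<in>W'. card {x \<in> S. F x = y} = d))"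
  proof -
    have "generic_degree_at_0 F S d" using germ by (simp add: finite_germ_def)
    then show ?thesis using that unfolding generic_degree_at_0_def by (elim exE conjE)
  qed
  obtain W' where W': "open W'" "W' \<noteq> {}" "W' \<subseteq> W \<inter> ball 0 e" "\<forall>y\<in>W'. card {x \<in> S. F x = y} = d"
  proof -
    have "open (W \<inter> ball 0 e)" using W(1) by blast
    from e(2)[rule_format, OF this W(2)[OF e(1)] Int_lower2] show ?thesis using that by blast
  qed
  show ?thesis
  proof (rule critical_values_no_interior[OF finite_germD(1)[OF germ] finite_germD(3)[OF germ] W'(1,2)])
    fix y assume y: "y \<in> W'" "\<And>x. x \<in> S \<Longrightarrow> F x = y \<Longrightarrow> jacobian F x \<noteq> 0"
    have "y \<in> W" "card {x \<in> S. F x = y} = d" using W'(3,4) y(1) by auto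
    then show ?thesis using that y(2) by blast
  qed
qed

lemma partials_unique:
  assumes "(g has_derivative (\<lambda>x. a * fst x + b * snd x)) (at p)"
  shows "d1 g p = a" "d2 g p = b"
proof -
  have p: "(g has_derivative (\<lambda>x. a * fst x + b * snd x)) (at (fst p, snd p))" using assms by simp
  have "((\<lambda>z. g (z, snd p)) has_derivative (*) a) (at (fst p))"
    using has_derivative_compose[OF has_derivative_Pair[OF has_derivative_ident has_derivative_const] p]
    by simp
  then show "d1 g p = a"
    unfolding d1_def by (intro DERIV_imp_deriv) (simp add: has_field_derivative_def)
  have "((\<lambda>w. g (fst p, w)) has_derivative (*) b) (at (snd p))"
    using has_derivative_compose[OF has_derivative_Pair[OF has_derivative_const has_derivative_ident] p]
    by simp
  then show "d2 g p = b"
    unfolding d2_def by (intro DERIV_imp_deriv) (simp add: has_field_derivative_def)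
qed

lemma partials_shear:
  assumes g: "holomorphic2_on g S" and S: "open S" and p: "(fst p + \<mu> * snd p, snd p) \<in> S"
  shows "d1 (\<lambda>p. g (fst p + \<mu> * snd p, snd p)) p = d1 g (fst p + \<mu> * snd p, snd p)"
    and "d2 (\<lambda>p. g (fst p + \<mu> * snd p, snd p)) p =
      \<mu> * d1 g (fst p + \<mu> * snd p, snd p) + d2 g (fst p + \<mu> * snd p, snd p)"
proof -
  let ?q = "(fst p + \<mu> * snd p, snd p)"
  have "((\<lambda>p. (fst p + \<mu> * snd p, snd p)) has_derivative (\<lambda>p. (fst p + \<mu> * snd p, snd p))) (at p)"
    by (auto intro!: derivative_eq_intros)
  from has_derivative_compose[OF this holomorphic2_on_has_derivative[OF S g p]]
  have "((\<lambda>p. g (fst p + \<mu> * snd p, snd p)) has_derivative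
      (\<lambda>x. d1 g ?q * fst x + (\<mu> * d1 g ?q + d2 g ?q) * snd x)) (at p)"
    by (simp add: algebra_simps)
  from partials_unique[OF this]
  show "d1 (\<lambda>p. g (fst p + \<mu> * snd p, snd p)) p = d1 g ?q"
    "d2 (\<lambda>p. g (fst p + \<mu> * snd p, snd p)) p = \<mu> * d1 g ?q + d2 g ?q" .
qed

lemma finite_affine_zero:
  fixes a b :: complex
  assumes "a \<noteq> 0 \<or> b \<noteq> 0"
  shows "finite {\<mu>. \<mu> * a + b = 0}"
proof (cases "a = 0")
  case True
  then show ?thesis using assms by simp
next
  case False
  have "{\<mu>. \<mu> * a + b = 0} \<subseteq> {- b / a}" using False by (auto simp: field_simps eq_neg_iff_add_eq_0)
  then show ?thesis using finite_subset by blast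
qed

lemma d2_minus_const:
  assumes "holomorphic2_on g S" "open S" "p \<in> S"
  shows "deriv (\<lambda>w. g (fst p, w) - c) (snd p) = d2 g p"
proof -
  have p: "(g has_derivative (\<lambda>x. d1 g p * fst x + d2 g p * snd x)) (at (fst p, snd p))"
    using holomorphic2_on_has_derivative[OF assms(2,1,3)] by simp
  have "((\<lambda>w. g (fst p, w)) has_derivative (*) (d2 g p)) (at (snd p))"
    using has_derivative_compose[OF has_derivative_Pair[OF has_derivative_const has_derivative_ident] p]
    by simp
  then have "((\<lambda>w. g (fst p, w)) has_field_derivative d2 g p) (at (snd p))"
    by (simp add: has_field_derivative_def)
  then have "((\<lambda>w. g (fst p, w) - c) has_field_derivative d2 g p) (at (snd p))"
    by (auto intro!: derivative_eq_intros)
  then show ?thesis by (rule DERIV_imp_deriv)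
qed

text \<open>For each of countably many finite fibres, a shear \<open>(z, w) \<mapsto> (z + \<mu> w, w)\<close> is bad if the
  new second axis is tangent to a level set of the first component at a point of the fibre or
  parallel to the line through two of its points.  Each condition excludes at most one \<open>\<mu>\<close>.\<close>

lemma countable_bad_shears:
  assumes fin: "\<And>n::nat. finite (fib n)"
    and nz: "\<And>n x. x \<in> fib n \<Longrightarrow> a x \<noteq> 0 \<or> b x \<noteq> (0::complex)"
  shows "countable ((\<Union>n. \<Union>x\<in>fib n. {\<mu>. \<mu> * a x + b x = 0}) \<union>
     (\<Union>n. \<Union>x\<in>fib n. \<Union>x'\<in>fib n - {x}. {\<mu>::complex. \<mu> * (snd x - snd x') + (fst x' - fst x) = 0}))"
proof (intro countable_Un countable_UN)
  fix n x assume x: "x \<in> fib n"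
  show "countable {\<mu>. \<mu> * a x + b x = 0}"
    using finite_affine_zero[OF nz[OF x]] by (rule countable_finite)
next
  fix n x x' assume x: "x \<in> fib n" "x' \<in> fib n - {x}"
  have "snd x - snd x' \<noteq> 0 \<or> fst x' - fst x \<noteq> 0" using x(2) by (auto simp: prod_eq_iff)
  from finite_affine_zero[OF this] show "countable {\<mu>. \<mu> * (snd x - snd x') + (fst x' - fst x) = 0}"
    by (rule countable_finite)
qed (use fin in \<open>auto intro: countable_finite\<close>)

text \<open>Both components vanish to order two, so the product over the roots vanishes to order at least
  four at \<open>y = 0\<close>, but at regular values it has three simple zeros.\<close>

theorem finite_germ_degree_3_noncritical:
  assumes germ: "finite_germ F S 3"
    and crit: "d1 (\<lambda>x. fst (F x)) 0 = 0" "d2 (\<lambda>x. fst (F x)) 0 = 0"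
      "d1 (\<lambda>x. snd (F x)) 0 = 0" "d2 (\<lambda>x. snd (F x)) 0 = 0"
  shows False
proof -
  define A0 where "A0 x = fst (F x)" for x
  define B0 where "B0 x = snd (F x)" for x
  note gD = finite_germD[OF germ]
  have FAB: "F x = (A0 x, B0 x)" for x by (simp add: A0_def B0_def)
  have A0S: "holomorphic2_on A0 S" and B0S: "holomorphic2_on B0 S"
    using holomorphic2_map_onD[OF gD(3)] by (simp_all add: A0_def[abs_def] B0_def[abs_def])
  have critA: "d1 A0 0 = 0" "d2 A0 0 = 0" and critB: "d1 B0 0 = 0" "d2 B0 0 = 0"
    using crit by (simp_all add: A0_def[abs_def] B0_def[abs_def])
  have A00: "A0 0 = 0" "B0 0 = 0" using gD(4) by (simp_all add: A0_def B0_def)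
  obtain e where "e > 0" "ball 0 e \<subseteq> S" using gD by (meson open_contains_ball)
  moreover obtain e' where "e' > 0" "\<And>x. x \<in> S \<Longrightarrow> F x \<in> ball 0 e' \<Longrightarrow> x \<in> ball 0 e"
    using finite_germ_proper[OF germ, of "ball 0 e"] \<open>e > 0\<close> by auto
  ultimately obtain \<rho> e0 where \<rho>: "\<rho> > 0" "ball 0 \<rho> \<subseteq> S"
    and e0: "e0 > 0" "\<And>x. x \<in> S \<Longrightarrow> F x \<in> ball 0 e0 \<Longrightarrow> x \<in> ball 0 \<rho>" by blast
  have A0: "holomorphic2_on A0 (ball 0 \<rho>)" and B0: "holomorphic2_on B0 (ball 0 \<rho>)"
    using A0S B0S \<rho>(2) holomorphic2_on_subset by blast+
  \<comment> \<open>The first component does not vanish identically, as otherwise the fibres over points off a line would be empty.\<close>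
  obtain x1 where x1: "x1 \<in> ball 0 \<rho>" "A0 x1 \<noteq> 0"
  proof -
    let ?W = "ball 0 e0 \<inter> {y :: complex \<times> complex. fst y \<noteq> 0}"
    have "open ?W" by (intro open_Int open_ball open_Collect_neq continuous_intros)
    moreover have "?W \<inter> ball 0 e \<noteq> {}" if "e > 0" for e
    proof -
      have "(of_real (min e e0 / 2), 0) \<in> ?W \<inter> ball 0 e" using that e0(1) by (auto simp: norm_Pair)
      then show ?thesis by blast
    qed
    ultimately obtain y where y: "y \<in> ?W" "card {x \<in> S. F x = y} = 3"
      using finite_germ_regular_value[OF germ, of ?W] by blast
    from y(2) have "{x \<in> S. F x = y} \<noteq> {}" by (metis card.empty zero_neq_numeral)
    then obtain x where "x \<in> {x \<in> S. F x = y}" by blast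
    then have x: "x \<in> S" "F x = y" by simp_all
    have "x \<in> ball 0 \<rho>" by (rule e0(2)[OF x(1)]) (use y(1) x(2) in simp)
    moreover have "A0 x \<noteq> 0" using y(1) x(2) by (simp add: A0_def)
    ultimately show ?thesis using that by blast
  qed
  obtain \<mu>0 \<epsilon> where \<epsilon>: "\<epsilon> > 0" and cone: "\<And>\<mu> z w. \<mu> \<in> ball \<mu>0 \<epsilon> \<Longrightarrow> norm (z::complex) < \<epsilon> * norm w \<Longrightarrow>
      norm w < \<epsilon> \<Longrightarrow> A0 (z + \<mu> * w, w) \<noteq> 0"
    by (rule noncharacteristic_directions[OF A0 x1]) (rule that)
  \<comment> \<open>Regular values converging to the origin.\<close>
  have "\<forall>n. \<exists>y. y \<in> ball 0 (1 / real (Suc n)) \<and> card {x \<in> S. F x = y} = 3 \<and>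
      (\<forall>x\<in>S. F x = y \<longrightarrow> jacobian F x \<noteq> 0)"
  proof
    fix n
    have W: "ball 0 (1 / real (Suc n)) \<inter> ball (0::complex\<times>complex) e \<noteq> {}" if "e > 0" for e
      using that by (intro ex_in_conv[THEN iffD1] exI[of _ 0]) auto
    obtain y where "y \<in> ball 0 (1 / real (Suc n))" "card {x \<in> S. F x = y} = 3"
        "\<And>x. x \<in> S \<Longrightarrow> F x = y \<Longrightarrow> jacobian F x \<noteq> 0"
      by (rule finite_germ_regular_value[OF germ open_ball W]) (assumption, rule that)
    then show "\<exists>y. y \<in> ball 0 (1 / real (Suc n)) \<and> card {x \<in> S. F x = y} = 3 \<and>
      (\<forall>x\<in>S. F x = y \<longrightarrow> jacobian F x \<noteq> 0)" by (intro exI[of _ y] conjI ballI impI)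
  qed
  from choice[OF this] obtain Y where Y0: "\<forall>n. Y n \<in> ball 0 (1 / real (Suc n)) \<and>
      card {x \<in> S. F x = Y n} = 3 \<and> (\<forall>x\<in>S. F x = Y n \<longrightarrow> jacobian F x \<noteq> 0)" ..
  have Y: "Y n \<in> ball 0 (1 / real (Suc n))" "card {x \<in> S. F x = Y n} = 3"
    "x \<in> S \<Longrightarrow> F x = Y n \<Longrightarrow> jacobian F x \<noteq> 0" for n x
    using Y0[rule_format, of n] by simp_all
  define fib where "fib n = {x \<in> S. F x = Y n}" for n
  have fib_fin: "finite (fib n)" for n
    using Y(2)[of n] card.infinite[of "fib n"] unfolding fib_def by force
  let ?bad = "(\<Union>n. \<Union>x\<in>fib n. {\<mu>. \<mu> * d1 A0 x + d2 A0 x = 0}) \<union>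
     (\<Union>n. \<Union>x\<in>fib n. \<Union>x'\<in>fib n - {x}. {\<mu>::complex. \<mu> * (snd x - snd x') + (fst x' - fst x) = 0})"
  have "countable ?bad"
  proof (rule countable_bad_shears[OF fib_fin])
    fix n x assume "x \<in> fib n"
    then have "jacobian F x \<noteq> 0" using Y(3) by (auto simp: fib_def)
    then show "d1 A0 x \<noteq> 0 \<or> d2 A0 x \<noteq> 0" by (auto simp: jacobian_def A0_def[abs_def])
  qed
  then have "\<not> ball \<mu>0 \<epsilon> \<subseteq> ?bad"
    using uncountable_ball[OF \<epsilon>, of \<mu>0] countable_subset[of "ball \<mu>0 \<epsilon>" ?bad] by blast
  then obtain \<mu> where \<mu>: "\<mu> \<in> ball \<mu>0 \<epsilon>" "\<mu> \<notin> ?bad"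
    unfolding subset_iff not_all not_imp by (elim exE conjE)
  let ?L = "\<lambda>p. (fst p + \<mu> * snd p, snd p)"
  define A where "A p = A0 (?L p)" for p
  define B where "B p = B0 (?L p)" for p
  define S' where "S' = ?L -` ball 0 \<rho>"
  have S': "open S'" unfolding S'_def by (intro open_vimage continuous_intros) auto
  have A: "holomorphic2_on A S'"
    unfolding A_def[abs_def]
    by (rule holomorphic2_on_compose2[OF _ _ A0]) (intro holomorphic2_intros | simp add: S'_def)+
  have B: "holomorphic2_on B S'"
    unfolding B_def[abs_def]
    by (rule holomorphic2_on_compose2[OF _ _ B0]) (intro holomorphic2_intros | simp add: S'_def)+
  have "(0, 0) \<in> S'" using \<rho>(1) by (simp add: S'_def flip: zero_prod_def)
  then obtain R where R: "R > 0" "cball 0 R \<times> cball 0 R \<subseteq> S'"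
    by (rule open_contains_polydisc[OF S']) (rule that)
  define r where "r = min R \<epsilon> / 2"
  have r: "0 < r" "r < R" "r < \<epsilon>" using R \<epsilon> by (auto simp: r_def)
  have inS': "(z, w) \<in> S'" if "z \<in> cball 0 R" "w \<in> cball 0 R" for z w using R(2) that by blast
  have A_cone: "A (z, w) \<noteq> 0" if "norm z < \<epsilon> * norm w" "norm w \<le> r" for z w
    using cone[OF \<mu>(1) that(1)] that(2) r by (simp add: A_def)
  have cAB: "continuous_on (cball 0 R \<times> cball 0 R) A" "continuous_on (cball 0 R \<times> cball 0 R) B"
    using A B R(2) holomorphic2_on_continuous continuous_on_subset by blast+
  have A0w: "(\<lambda>w. A (0, w)) holomorphic_on ball 0 R"
    by (intro holomorphic2_on_slices(2)[OF A] inS') (use R in auto)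
  have only0: "z = 0 \<and> w = 0" if "A (z, w) = 0" "B (z, w) = 0" "(z, w) \<in> S'" for z w
  proof -
    have "F (?L (z, w)) = 0" using that by (simp add: FAB A_def B_def zero_prod_def)
    moreover have LS: "?L (z, w) \<in> S" using that(3) \<rho>(2) by (auto simp: S'_def)
    ultimately have "?L (z, w) \<in> N" if "open N" "0 \<in> N" for N
      using finite_germ_proper[OF germ that] by (metis centre_in_ball)
    then have "?L (z, w) = 0"
      by (metis separation_t1)
    then show ?thesis by (auto simp: zero_prod_def)
  qed
  \<comment> \<open>The order of the first component in the direction chosen.\<close>
  obtain C s where C: "C > 0" "s > 0" "\<And>x. x \<in> ball 0 s \<Longrightarrow> norm (A0 x) \<le> C * norm x ^ 2"
    by (rule quadratic_bound[OF A0 \<rho>(1) A00(1) critA]) (rule that)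
  obtain C' s' where C': "C' > 0" "s' > 0" "\<And>x. x \<in> ball 0 s' \<Longrightarrow> norm (B0 x) \<le> C' * norm x ^ 2"
    by (rule quadratic_bound[OF B0 \<rho>(1) A00(2) critB]) (rule that)
  define D where "D = norm \<mu> + 2"
  have D: "D > 0" by (simp add: D_def add_nonneg_pos)
  have normL: "norm (?L (z, w)) \<le> norm z + D * norm w" for z w
  proof -
    have "norm (?L (z, w)) \<le> norm (z + \<mu> * w) + norm w" using norm_Pair_le by simp
    also have "\<dots> \<le> norm z + norm \<mu> * norm w + norm w"
      using norm_triangle_ineq[of z "\<mu> * w"] by (simp add: norm_mult)
    also have "\<dots> \<le> norm z + D * norm w" by (simp add: D_def distrib_right)
    finally show ?thesis .
  qed
  have rR: "of_real r \<in> ball (0::complex) R" "A (0, of_real r) \<noteq> 0"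
    using r \<epsilon> A_cone[of 0 "of_real r"] by simp_all
  have ordA: "2 \<le> zorder (\<lambda>w. A (0, w)) 0"
  proof -
    have "int 2 \<le> zorder (\<lambda>w. A (0, w)) 0"
    proof (rule zorder_ge_if_bounded[OF A0w _ rR, of _ "s / D" "C * D ^ 2"])
      show "norm (A (0, w)) \<le> C * D ^ 2 * norm (w - 0) ^ 2" if "w \<in> ball 0 (s / D)" for w
      proof -
        have "norm (?L (0, w)) \<le> D * norm w" using normL[of 0 w] by simp
        moreover have "D * norm w < s" using that D by (simp add: field_simps)
        ultimately have "norm (A0 (?L (0, w))) \<le> C * norm (?L (0, w)) ^ 2" by (intro C(3)) simp
        also have "\<dots> \<le> C * (D * norm w) ^ 2"
          using \<open>norm (?L (0, w)) \<le> D * norm w\<close> C(1) by (intro mult_left_mono power_mono) auto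
        finally show ?thesis by (simp add: A_def power_mult_distrib mult_ac)
      qed
    qed (use R D C in auto)
    then show ?thesis by simp
  qed
  define m where "m = nat (zorder (\<lambda>w. A (0, w)) 0)"
  have m: "zorder (\<lambda>w. A (0, w)) 0 = int m" "m \<ge> 2" using ordA by (auto simp: m_def)
  have holA: "(\<lambda>w. A (z, w) - c) holomorphic_on ball 0 R"
    and holB: "(\<lambda>w. c - B (z, w)) holomorphic_on ball 0 R" if "z \<in> cball 0 R" for z c
    using that by (auto intro!: holomorphic_intros holomorphic2_on_slices(2)[OF A]
        holomorphic2_on_slices(2)[OF B] inS')
  obtain e3 where e3: "e3 > 0" "ball (0, 0) e3 \<subseteq> ball (0::complex) R \<times> (UNIV :: complex set)"
    "\<And>p w. p \<in> ball (0, 0) e3 \<Longrightarrow> w \<in> sphere 0 r \<Longrightarrow> A (fst p, w) - snd p \<noteq> 0"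
    "\<And>p. p \<in> ball (0, 0) e3 \<Longrightarrow> finite {w \<in> ball 0 r. A (fst p, w) - snd p = 0}"
    "\<And>p. p \<in> ball (0, 0) e3 \<Longrightarrow>
      (\<Sum>w | w \<in> ball 0 r \<and> A (fst p, w) - snd p = 0. zorder (\<lambda>w. A (fst p, w) - snd p) w) =
        zorder (\<lambda>w. A (fst (0::complex, 0::complex), w) - snd (0::complex, 0::complex)) 0"
  proof (rule zero_count_stable[of "ball 0 R \<times> UNIV" "(0::complex, 0::complex)" 0 r
        "\<lambda>p w. A (fst p, w) - snd p" R])
    have "continuous_on ((ball 0 R \<times> UNIV) \<times> sphere 0 r) (\<lambda>q::(complex \<times> complex) \<times> complex. A (fst (fst q), snd q))"
      by (rule continuous_on_compose2[OF cAB(1)]) (use r in \<open>auto intro!: continuous_intros\<close>)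
    then show "continuous_on ((ball 0 R \<times> UNIV) \<times> sphere 0 r) (\<lambda>(p, w). A (fst p, w) - snd p)"
      by (auto simp: case_prod_beta intro!: continuous_intros)
    show "A (fst (0, 0), z) - snd (0::complex, 0) \<noteq> 0" if "z \<in> cball 0 r - {0}" for z
      using that \<epsilon> A_cone[of 0 z] by simp
    show "A (fst (0::complex, 0::complex), 0) - snd (0::complex, 0::complex) = 0"
      using A00 by (simp add: A_def zero_prod_def)
    show "open (ball (0::complex) R \<times> (UNIV :: complex set))" by (intro open_Times) auto
    show "(0, 0) \<in> ball (0::complex) R \<times> (UNIV :: complex set)" using R by simp
    show "(\<lambda>w. A (fst p, w) - snd p) holomorphic_on ball 0 R" if "p \<in> ball 0 R \<times> UNIV" for p
      by (rule holA) (use that in auto)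
  qed (rule r(1), rule r(2), rule that)
  define \<delta> where "\<delta> = min (e3 / 2) R"
  have \<delta>: "\<delta> > 0" "\<delta> \<le> R" using e3 R by (auto simp: \<delta>_def)
  have in_e3: "(z, y1) \<in> ball (0, 0) e3" if "norm z < \<delta>" "norm y1 < \<delta>" for z y1 :: complex
  proof -
    have "norm (z, y1) \<le> norm z + norm y1" by (rule norm_Pair_le)
    also have "\<dots> < e3" using that by (simp add: \<delta>_def)
    finally show ?thesis by (simp flip: zero_prod_def)
  qed
  have nz: "A (z, w) - y1 \<noteq> 0" if "norm z < \<delta>" "norm y1 < \<delta>" "w \<in> sphere 0 r" for z y1 w
    using e3(3)[OF in_e3[OF that(1,2)] that(3)] by simp
  have cnt: "(\<Sum>w | w \<in> ball 0 r \<and> A (z, w) - y1 = 0. zorder (\<lambda>w. A (z, w) - y1) w) = int m"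
    if "norm z < \<delta>" "norm y1 < \<delta>" for z y1
    using e3(5)[OF in_e3[OF that]] m(1) by simp
  obtain M where M: "\<And>z w. z \<in> cball 0 R \<Longrightarrow> w \<in> cball 0 R \<Longrightarrow> norm (B (z, w)) \<le> M"
  proof -
    have "bounded (B ` (cball 0 R \<times> cball 0 R))"
      by (intro compact_imp_bounded compact_continuous_image cAB compact_Times compact_cball)
    then show ?thesis using that unfolding bounded_iff by (metis SigmaI imageI)
  qed
  define M' where "M' = \<bar>M\<bar> + \<delta> + 1"
  have M': "M' > 0" using \<delta> by (simp add: M'_def)
  have B_bound: "norm (snd y - B (z, w)) < M'" if "norm y < \<delta>" "z \<in> cball 0 R" "w \<in> cball 0 R" for y :: "complex \<times> complex" and z w
  proof -
    have "norm (snd y) < \<delta>" using norm_snd_le[of "snd y" "fst y"] that(1) by simp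
    then show ?thesis
      using norm_triangle_ineq4[of "snd y" "B (z, w)"] M[OF that(2,3)] by (simp add: M'_def)
  qed
  have y1_less: "norm (fst y) < \<delta>" if "norm y < \<delta>" for y :: "complex \<times> complex"
    using norm_fst_le[of "fst y" "snd y"] that by simp
  define N where "N y z = root_product r (\<lambda>w. A (z, w) - fst y) (\<lambda>w. snd y - B (z, w))" for y :: "complex \<times> complex" and z
  have dA: "deriv (\<lambda>w. A (z, w) - c) w = d2 A (z, w)" if "z \<in> cball 0 R" "w \<in> cball 0 R" for z w c
    using d2_minus_const[OF A S' inS'[OF that], of c] by simp
  have cd2: "continuous_on (cball 0 R \<times> cball 0 R) (d2 A)"
    using holomorphic2_on_continuous[OF holomorphic2_on_d2[OF S' A]] R(2) continuous_on_subset by blast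
  have N_cont: "continuous_on (ball 0 \<delta> \<times> ball 0 \<delta>) (\<lambda>p. N (fst p) (snd p))"
    unfolding N_def
  proof (rule continuous_on_root_product[where R = R and m = m and M = M'])
    fix p :: "(complex \<times> complex) \<times> complex" assume "p \<in> ball 0 \<delta> \<times> ball 0 \<delta>"
    then have p: "norm (fst p) < \<delta>" "norm (snd p) < \<delta>" by auto
    then have pR: "snd p \<in> cball 0 R" using \<delta> by simp
    show "(\<lambda>w. A (snd p, w) - fst (fst p)) holomorphic_on ball 0 R"
      "(\<lambda>w. snd (fst p) - B (snd p, w)) holomorphic_on ball 0 R" using holA holB pR by blast+
    show "A (snd p, w) - fst (fst p) \<noteq> 0" if "w \<in> sphere 0 r" for w
      using nz[OF p(2) y1_less[OF p(1)] that] .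
    show "norm (snd (fst p) - B (snd p, w)) < M'" if "w \<in> ball 0 R" for w
      using B_bound[OF p(1) pR] that by simp
    show "(\<Sum>w | w \<in> ball 0 r \<and> A (snd p, w) - fst (fst p) = 0. zorder (\<lambda>w. A (snd p, w) - fst (fst p)) w) = int m"
      using cnt[OF p(2) y1_less[OF p(1)]] .
  next
    let ?T = "(ball (0 :: complex \<times> complex) \<delta> \<times> ball (0::complex) \<delta>) \<times> sphere (0::complex) r"
    have c: "continuous_on ?T (\<lambda>q. k (snd (fst q), snd q))"
      if "continuous_on (cball 0 R \<times> cball 0 R) k" for k :: "complex \<times> complex \<Rightarrow> complex"
      by (rule continuous_on_compose2[OF that]) (use r \<delta> in \<open>auto intro!: continuous_intros\<close>)
    show "continuous_on ?T (\<lambda>q. A (snd (fst q), snd q) - fst (fst (fst q)))"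
      "continuous_on ?T (\<lambda>q. snd (fst (fst q)) - B (snd (fst q), snd q))"
      by (intro continuous_intros c cAB)+
    show "continuous_on ?T (\<lambda>q. deriv (\<lambda>w. A (snd (fst q), w) - fst (fst (fst q))) (snd q))"
      by (rule continuous_on_eq[OF c[OF cd2]]) (use r \<delta> in \<open>auto simp: dA\<close>)
  qed (use r M' in auto)
  have N_hol: "N y holomorphic_on ball 0 \<delta>" if y: "norm y < \<delta>" for y
    unfolding N_def[abs_def]
  proof (rule holomorphic_on_root_product[where R = R and m = m and M = M'])
    fix z assume "z \<in> ball (0::complex) \<delta>"
    then have p: "norm z < \<delta>" "z \<in> cball 0 R" using \<delta> by auto
    show "(\<lambda>w. A (z, w) - fst y) holomorphic_on ball 0 R"
      "(\<lambda>w. snd y - B (z, w)) holomorphic_on ball 0 R" using holA holB p by blast+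
    show "A (z, w) - fst y \<noteq> 0" if "w \<in> sphere 0 r" for w
      using nz[OF p(1) y1_less[OF y] that] .
    show "norm (snd y - B (z, w)) < M'" if "w \<in> ball 0 R" for w
      using B_bound[OF y p(2)] that by simp
    show "(\<Sum>w | w \<in> ball 0 r \<and> A (z, w) - fst y = 0. zorder (\<lambda>w. A (z, w) - fst y) w) = int m"
      using cnt[OF p(1) y1_less[OF y]] .
  next
    let ?T = "ball (0::complex) \<delta> \<times> sphere (0::complex) r"
    have c: "continuous_on ?T (\<lambda>q. k (fst q, snd q))"
      if "continuous_on (cball 0 R \<times> cball 0 R) k" for k :: "complex \<times> complex \<Rightarrow> complex"
      by (rule continuous_on_compose2[OF that]) (use r \<delta> in \<open>auto intro!: continuous_intros\<close>)
    show "continuous_on ?T (\<lambda>q. A (fst q, snd q) - fst y)"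
      "continuous_on ?T (\<lambda>q. snd y - B (fst q, snd q))"
      by (intro continuous_intros c cAB)+
    show "continuous_on ?T (\<lambda>q. deriv (\<lambda>w. A (fst q, w) - fst y) (snd q))"
      by (rule continuous_on_eq[OF c[OF cd2]]) (use r \<delta> in \<open>auto simp: dA\<close>)
    fix w assume w: "w \<in> sphere (0::complex) r"
    then have wR: "w \<in> cball 0 R" using r by simp
    show "(\<lambda>z. A (z, w) - fst y) holomorphic_on ball 0 \<delta>"
      using wR \<delta> by (intro holomorphic_intros holomorphic2_on_slices(1)[OF A] inS') auto
    show "(\<lambda>z. snd y - B (z, w)) holomorphic_on ball 0 \<delta>"
      using wR \<delta> by (intro holomorphic_intros holomorphic2_on_slices(1)[OF B] inS') auto
    have "(\<lambda>z. d2 A (z, w)) holomorphic_on ball 0 \<delta>"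
      using wR \<delta> by (intro holomorphic2_on_slices(1)[OF holomorphic2_on_d2[OF S' A]] inS') auto
    then show "(\<lambda>z. deriv (\<lambda>w. A (z, w) - fst y) w) holomorphic_on ball 0 \<delta>"
      by (rule holomorphic_transform) (use wR \<delta> in \<open>auto simp: dA\<close>)
  qed (use r M' in auto)
  have N_zero: "N y z = 0 \<longleftrightarrow> (\<exists>w\<in>ball 0 r. A (z, w) = fst y \<and> B (z, w) = snd y)"
    if "norm y < \<delta>" "norm z < \<delta>" for y z
  proof -
    have "z \<in> cball 0 R" using that \<delta> by simp
    from root_product_eq_0_iff[OF holA[OF this] r(1,2) nz[OF that(2) y1_less[OF that(1)]]]
    show ?thesis unfolding N_def by auto
  qed
  have N0_nz: "N 0 z \<noteq> 0" if z: "z \<noteq> 0" "norm z < \<delta>" for z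
  proof
    assume "N 0 z = 0"
    then obtain w where w: "w \<in> ball 0 r" "A (z, w) = 0" "B (z, w) = 0"
      using N_zero[of 0 z] z(2) \<delta>(1) by auto
    have "(z, w) \<in> S'" using w(1) z(2) \<delta> r by (intro inS') auto
    from only0[OF w(2,3) this] show False using z(1) by simp
  qed
  have N00: "N 0 0 = 0"
  proof -
    have "A (0, 0) = 0" "B (0, 0) = 0" using A00 by (simp_all add: A_def B_def zero_prod_def)
    then have "\<exists>w\<in>ball 0 r. A (0, w) = fst (0 :: complex \<times> complex) \<and> B (0, w) = snd (0 :: complex \<times> complex)"
      using r(1) by (intro bexI[of _ 0]) simp_all
    then show ?thesis using N_zero[of 0 0] \<delta>(1) by simp
  qed
  \<comment> \<open>The roots lie in a cone, where the second component is quadratically small.\<close>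
  define E where "E = 1 + D / \<epsilon>"
  have E: "E > 0" using D \<epsilon> by (simp add: E_def add_pos_pos)
  have N0_bound: "norm (N 0 z) \<le> (C' * E ^ 2) ^ m * norm z ^ (2 * m)" if z: "norm z < min \<delta> (s' / E)" for z
  proof -
    let ?f = "\<lambda>w. A (z, w) - 0"
    let ?Z = "{w. w \<in> ball 0 r \<and> ?f w = 0}"
    let ?k = "\<lambda>w. nat (zorder ?f w)"
    have zR: "z \<in> cball 0 R" "norm z < \<delta>" using z \<delta> by auto
    have one: "norm (0 - B (z, w)) \<le> C' * E ^ 2 * norm z ^ 2" if w: "w \<in> ?Z" for w
    proof -
      have "\<not> norm z < \<epsilon> * norm w" using A_cone[of z w] w by auto
      then have "norm w \<le> norm z / \<epsilon>" using \<epsilon> by (simp add: field_simps)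
      then have "D * norm w \<le> D * (norm z / \<epsilon>)" using D by (intro mult_left_mono) auto
      then have n: "norm (?L (z, w)) \<le> E * norm z"
        using normL[of z w] by (simp add: E_def algebra_simps)
      also have "\<dots> < s'" using z E by (simp add: pos_less_divide_eq mult.commute)
      finally have "norm (B0 (?L (z, w))) \<le> C' * norm (?L (z, w)) ^ 2" by (intro C'(3)) simp
      also have "\<dots> \<le> C' * (E * norm z) ^ 2"
        using n C'(1) by (intro mult_left_mono power_mono) auto
      finally show ?thesis by (simp add: B_def power_mult_distrib mult_ac)
    qed
    have pos: "1 \<le> zorder ?f w" if "w \<in> ?Z" for w
    proof (rule zorder_pos_at_zero[OF holA[OF zR(1)] _ rR(1)])
      have "of_real r \<in> sphere (0::complex) r" using r by simp
      from nz[OF zR(2) _ this, of 0] show "A (z, of_real r) - 0 \<noteq> 0" using \<delta> by simp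
    qed (use that r in auto)
    have sumk: "sum ?k ?Z = m"
    proof -
      have "int (sum ?k ?Z) = (\<Sum>w\<in>?Z. zorder ?f w)"
        unfolding of_nat_sum by (rule sum.cong) (use pos in force)+
      also have "\<dots> = int m" by (rule cnt) (use zR \<delta> in auto)
      finally show ?thesis by (simp only: of_nat_eq_iff)
    qed
    have "norm (N 0 z) = (\<Prod>w\<in>?Z. norm (0 - B (z, w)) ^ ?k w)"
      by (simp add: N_def root_product_def prod_norm[symmetric] norm_power)
    also have "\<dots> \<le> (\<Prod>w\<in>?Z. (C' * E ^ 2 * norm z ^ 2) ^ ?k w)"
      using one by (intro prod_mono) (auto intro!: power_mono)
    also have "\<dots> = (C' * E ^ 2 * norm z ^ 2) ^ sum ?k ?Z" by (rule power_sum[symmetric])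
    also have "\<dots> = (C' * E ^ 2 * norm z ^ 2) ^ m" by (simp only: sumk)
    finally show ?thesis by (simp add: power_mult_distrib power_mult)
  qed
  have \<delta>2: "of_real (\<delta> / 2) \<in> ball (0::complex) \<delta>" "N 0 (of_real (\<delta> / 2)) \<noteq> 0"
    using \<delta> N0_nz[of "of_real (\<delta> / 2)"] by simp_all
  have "int (2 * m) \<le> zorder (N 0) 0"
  proof (rule zorder_ge_if_bounded[OF N_hol _ \<delta>2, of _ "min \<delta> (s' / E)" "(C' * E ^ 2) ^ m"])
    show "norm (N 0 w) \<le> (C' * E\<^sup>2) ^ m * norm (w - 0) ^ (2 * m)" if "w \<in> ball 0 (min \<delta> (s' / E))" for w
      using N0_bound[of w] that by simp
  qed (use \<delta> C' E in auto)
  then have ord4: "4 \<le> zorder (N 0) 0" using m(2) by linarith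
  obtain e4 where e4: "e4 > 0" "ball 0 e4 \<subseteq> ball (0 :: complex \<times> complex) \<delta>"
    "\<And>y z. y \<in> ball 0 e4 \<Longrightarrow> z \<in> sphere 0 (\<delta> / 2) \<Longrightarrow> N y z \<noteq> 0"
    "\<And>y. y \<in> ball 0 e4 \<Longrightarrow> finite {z \<in> ball 0 (\<delta> / 2). N y z = 0}"
    "\<And>y. y \<in> ball 0 e4 \<Longrightarrow> (\<Sum>z | z \<in> ball 0 (\<delta> / 2) \<and> N y z = 0. zorder (N y) z) = zorder (N 0) 0"
  proof (rule zero_count_stable[of "ball 0 \<delta>" "0 :: complex \<times> complex" 0 "\<delta> / 2" N \<delta>])
    show "continuous_on (ball 0 \<delta> \<times> sphere 0 (\<delta> / 2)) (\<lambda>(p, z). N p z)"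
      unfolding case_prod_beta by (rule continuous_on_subset[OF N_cont]) (use \<delta> in auto)
    show "N 0 z \<noteq> 0" if "z \<in> cball 0 (\<delta> / 2) - {0}" for z
      using that \<delta> by (intro N0_nz) auto
    show "open (ball (0 :: complex \<times> complex) \<delta>)" "(0 :: complex \<times> complex) \<in> ball 0 \<delta>" using \<delta> by simp_all
    show "N y holomorphic_on ball 0 \<delta>" if "y \<in> ball 0 \<delta>" for y by (rule N_hol) (use that in simp)
    show "0 < \<delta> / 2" "\<delta> / 2 < \<delta>" using \<delta> by simp_all
  qed (rule N00, rule that)
  let ?Q = "{x. fst x - \<mu> * snd x \<in> ball 0 (\<delta> / 2) \<and> snd x \<in> ball 0 r}"
  have "open ?Q"
    unfolding Collect_conj_eq
    by (intro open_Int open_vimage[where f = "\<lambda>x. fst x - \<mu> * snd x", unfolded vimage_def]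
        open_vimage[where f = snd, unfolded vimage_def] open_ball continuous_intros)
  moreover have "0 \<in> ?Q" using \<delta> r by (simp add: zero_prod_def)
  ultimately obtain e5 where e5: "e5 > 0" "\<And>x. x \<in> S \<Longrightarrow> F x \<in> ball 0 e5 \<Longrightarrow> x \<in> ?Q"
    by (rule finite_germ_proper[OF germ]) (rule that)
  obtain n where n: "1 / real (Suc n) < min e4 e5"
    using nat_approx_posE[of "min e4 e5"] e4(1) e5(1) by (metis min_less_iff_conj)
  define y where "y = Y n"
  have y: "y \<in> ball 0 e4" "y \<in> ball 0 e5" using Y(1)[of n] n by (auto simp: y_def)
  have y\<delta>: "norm y < \<delta>" using y(1) e4(2) by auto
  have fibQ: "x \<in> ?Q" if "x \<in> fib n" for x using e5(2)[of x] that y(2) by (auto simp: fib_def y_def)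
  let ?\<pi> = "\<lambda>x. fst x - \<mu> * snd x"
  have inj: "inj_on ?\<pi> (fib n)"
  proof (rule inj_onI, rule ccontr)
    fix x x' assume x: "x \<in> fib n" "x' \<in> fib n" "?\<pi> x = ?\<pi> x'" "x \<noteq> x'"
    then have "\<mu> \<in> {\<mu>. \<mu> * (snd x - snd x') + (fst x' - fst x) = 0}" by (simp add: algebra_simps)
    then show False using \<mu>(2) x by blast
  qed
  have AB_fib: "A (?\<pi> x, snd x) = fst y" "B (?\<pi> x, snd x) = snd y" "(?\<pi> x, snd x) \<in> S'" if "x \<in> fib n" for x
  proof -
    have x: "?L (?\<pi> x, snd x) = x" by simp
    show "A (?\<pi> x, snd x) = fst y" "B (?\<pi> x, snd x) = snd y"
      using that unfolding A_def B_def x by (auto simp: fib_def y_def A0_def B0_def)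
    have "(?\<pi> x, snd x) \<in> cball 0 R \<times> cball 0 R" using fibQ[OF that] \<delta> r by auto
    then show "(?\<pi> x, snd x) \<in> S'" using R(2) by blast
  qed
  have zeros: "{z. z \<in> ball 0 (\<delta> / 2) \<and> N y z = 0} = ?\<pi> ` fib n"
  proof (intro equalityI subsetI)
    fix z assume "z \<in> ?\<pi> ` fib n"
    then obtain x where x: "x \<in> fib n" "z = ?\<pi> x" by blast
    have zQ: "z \<in> ball 0 (\<delta> / 2)" "snd x \<in> ball 0 r" using fibQ[OF x(1)] x(2) by auto
    then have "norm z < \<delta>" using \<delta>(1) by (simp add: less_divide_eq) 
    then have "N y z = 0" using N_zero[OF y\<delta>] AB_fib[OF x(1)] zQ(2) x(2) by blast
    then show "z \<in> {z. z \<in> ball 0 (\<delta> / 2) \<and> N y z = 0}" using zQ(1) by blast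
  next
    fix z assume z: "z \<in> {z. z \<in> ball 0 (\<delta> / 2) \<and> N y z = 0}"
    then have z\<delta>: "norm z < \<delta>" using \<delta>(1) by (auto simp: less_divide_eq)
    then obtain w where w: "w \<in> ball 0 r" "A (z, w) = fst y" "B (z, w) = snd y"
      using N_zero[OF y\<delta> z\<delta>] z by auto
    have "(z, w) \<in> S'" using w(1) z\<delta> \<delta> r by (intro inS') auto
    then have "?L (z, w) \<in> S" using \<rho>(2) by (auto simp: S'_def)
    moreover have "F (?L (z, w)) = y" using w by (simp add: FAB A_def B_def)
    ultimately have "?L (z, w) \<in> fib n" by (simp add: fib_def y_def)
    then show "z \<in> ?\<pi> ` fib n" by (rule rev_image_eqI) simp
  qed
  have simple: "zorder (N y) z \<le> 1" if z: "z \<in> ?\<pi> ` fib n" for z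
  proof -
    obtain x where x: "x \<in> fib n" "z = ?\<pi> x" using z by blast
    define w0 where "w0 = snd x"
    have Lx: "?L (z, w0) = x" by (simp add: x(2) w0_def)
    have zQ: "z \<in> ball 0 (\<delta> / 2)" "w0 \<in> ball 0 r" using fibQ[OF x(1)] x(2) by (auto simp: w0_def)
    have z\<delta>: "norm z < \<delta>" using zQ(1) \<delta>(1) by auto
    have xS: "x \<in> S" "?L (z, w0) \<in> ball 0 \<rho>" using x(1) AB_fib(3)[OF x(1)] by (auto simp: fib_def S'_def x(2) w0_def)
    have d1A: "d1 A (z, w0) = d1 A0 x" "d2 A (z, w0) = \<mu> * d1 A0 x + d2 A0 x"
      using partials_shear[OF A0 open_ball, of "(z, w0)" \<mu>] xS(2) Lx by (auto simp: A_def[abs_def])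
    have d1B: "d1 B (z, w0) = d1 B0 x" "d2 B (z, w0) = \<mu> * d1 B0 x + d2 B0 x"
      using partials_shear[OF B0 open_ball, of "(z, w0)" \<mu>] xS(2) Lx by (auto simp: B_def[abs_def])
    have "jacobian (\<lambda>x. (A x, B x)) (z, w0) = jacobian F x"
      by (simp add: jacobian_def d1A d1B algebra_simps flip: A0_def[abs_def] B0_def[abs_def])
    then have J: "jacobian (\<lambda>x. (A x, B x)) (z, w0) \<noteq> 0" using Y(3) x(1) by (auto simp: fib_def)
    have d2A: "d2 A (z, w0) \<noteq> 0" using \<mu>(2) x(1) unfolding d1A by blast
    define \<delta>' where "\<delta>' = \<delta> - norm z"
    have \<delta>': "\<delta>' > 0" using z\<delta> by (simp add: \<delta>'_def)
    have in_\<delta>: "norm z' < \<delta>" if "z' \<in> ball z \<delta>'" for z'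
      using that norm_triangle_ineq2[of z' z] by (simp add: \<delta>'_def dist_norm norm_minus_commute)
    obtain c where "c > 0" "\<forall>\<^sub>F z' in at z. c * norm (z' - z) \<le>
        norm (root_product r (\<lambda>w. A (z', w) - fst y) (\<lambda>w. snd y - B (z', w)))"
    proof (rule root_product_bounded_below[OF S' A B, of z \<delta>' R r "fst y" m w0 "snd y"])
      show "(z', w) \<in> S'" if "z' \<in> ball z \<delta>'" "w \<in> ball 0 R" for z' w
        using in_\<delta>[OF that(1)] that(2) \<delta> by (intro inS') auto
      show "A (z', w) \<noteq> fst y" if "z' \<in> ball z \<delta>'" "w \<in> sphere 0 r" for z' w
        using nz[OF in_\<delta>[OF that(1)] y1_less[OF y\<delta>] that(2)] by simp
      show "(\<Sum>w | w \<in> ball 0 r \<and> A (z', w) - fst y = 0. zorder (\<lambda>w. A (z', w) - fst y) w) = int m"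
        if "z' \<in> ball z \<delta>'" for z'
        by (rule cnt[OF in_\<delta>[OF that] y1_less[OF y\<delta>]])
      show "A (z, w0) = fst y" "B (z, w0) = snd y" using AB_fib[OF x(1)] by (simp_all add: x(2) w0_def)
      fix w assume w: "w \<in> ball 0 r" "A (z, w) = fst y" "B (z, w) = snd y"
      have "(z, w) \<in> S'" using w(1) z\<delta> \<delta> r by (intro inS') auto
      then have "?L (z, w) \<in> S" using \<rho>(2) by (auto simp: S'_def)
      moreover have "F (?L (z, w)) = y" using w by (simp add: FAB A_def B_def)
      ultimately have "?L (z, w) \<in> fib n" by (simp add: fib_def y_def)
      moreover have "?\<pi> (?L (z, w)) = ?\<pi> x" using x(2) by simp
      ultimately have "?L (z, w) = x" using inj_onD[OF inj _ _ x(1)] by blast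
      then show "w = w0" by (auto simp: w0_def)
    qed (use \<delta>' r zQ d2A J in auto)
    then have c: "c > 0" "\<forall>\<^sub>F z' in at z. c * norm (z' - z) \<le> norm (N y z')" by (simp_all add: N_def)
    show ?thesis
      by (rule zorder_le_1_if_bounded_below[OF N_hol[OF y\<delta>] _ c]) (use z\<delta> in simp)
  qed
  have "zorder (N 0) 0 = (\<Sum>z\<in>?\<pi> ` fib n. zorder (N y) z)"
    using e4(5)[OF y(1)] unfolding zeros by simp
  also have "\<dots> \<le> (\<Sum>z\<in>?\<pi> ` fib n. 1)" by (intro sum_mono simple)
  also have "\<dots> = 3" using Y(2)[of n] card_image[OF inj] by (simp add: fib_def)
  finally show False using ord4 by simp
qed

section \<open>Germs of coordinate changes\<close>

text \<open>A germ of a biholomorphic map fixing the origin; by the inverse function theorem the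
  Jacobian condition suffices, and it is easy to check for triangular maps.\<close>

definition biholomorphic_germ :: "(complex \<times> complex \<Rightarrow> complex \<times> complex) \<Rightarrow> bool" where
  "biholomorphic_germ \<Phi> \<longleftrightarrow> \<Phi> 0 = 0 \<and> jacobian \<Phi> 0 \<noteq> 0 \<and>
     (\<exists>N. open N \<and> 0 \<in> N \<and> holomorphic2_map_on \<Phi> N)"

lemma holomorphic2_map_on_subset:
  "holomorphic2_map_on F S \<Longrightarrow> T \<subseteq> S \<Longrightarrow> holomorphic2_map_on F T"
  unfolding holomorphic2_map_on_def using holomorphic2_on_subset by blast

lemma holomorphic2_map_on_continuous:
  assumes "holomorphic2_map_on F S"
  shows "continuous_on S F"
  using continuous_on_Pair[OF holomorphic2_on_continuous[OF holomorphic2_map_onD(1)[OF assms]]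
      holomorphic2_on_continuous[OF holomorphic2_map_onD(2)[OF assms]]] by simp

lemma holomorphic2_on_compose_map:
  assumes "holomorphic2_map_on F S" "holomorphic2_on g T" "\<And>x. x \<in> S \<Longrightarrow> F x \<in> T"
  shows "holomorphic2_on (\<lambda>x. g (F x)) S"
  using holomorphic2_on_compose2[OF holomorphic2_map_onD[OF assms(1)] assms(2)] assms(3) by simp

lemma holomorphic2_map_on_compose:
  assumes "holomorphic2_map_on F S" "holomorphic2_map_on G T" "\<And>x. x \<in> S \<Longrightarrow> F x \<in> T"
  shows "holomorphic2_map_on (\<lambda>x. G (F x)) S"
  by (intro holomorphic2_map_onI holomorphic2_on_compose_map[OF assms(1) _ assms(3)]
      holomorphic2_map_onD[OF assms(2)])

lemma holomorphic2_map_on_cong: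
  assumes "open S" "\<And>x. x \<in> S \<Longrightarrow> F x = G x" "holomorphic2_map_on F S"
  shows "holomorphic2_map_on G S"
  by (intro holomorphic2_map_onI holomorphic2_on_cong[OF assms(1) _ holomorphic2_map_onD(1)[OF assms(3)]]
      holomorphic2_on_cong[OF assms(1) _ holomorphic2_map_onD(2)[OF assms(3)]]) (use assms(2) in auto)

lemma jacobian_nonzero_if_inj_derivative:
  assumes "(\<Phi> has_derivative L) (at p)" "inj L" "open N" "p \<in> N" "holomorphic2_map_on \<Phi> N"
  shows "jacobian \<Phi> p \<noteq> 0"
proof -
  have "L = linear2 (d1 (\<lambda>x. fst (\<Phi> x)) p) (d2 (\<lambda>x. fst (\<Phi> x)) p)
     (d1 (\<lambda>x. snd (\<Phi> x)) p) (d2 (\<lambda>x. snd (\<Phi> x)) p)"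
    by (rule has_derivative_unique[OF assms(1) holomorphic2_map_on_has_derivative[OF assms(3,5,4)]])
  then show ?thesis using assms(2) by (simp add: jacobian_def inj_linear2_iff)
qed

lemma inj_derivative_if_jacobian_nonzero:
  assumes "jacobian \<Phi> p \<noteq> 0" "open N" "p \<in> N" "holomorphic2_map_on \<Phi> N"
  obtains L where "(\<Phi> has_derivative L) (at p)" "inj L"
proof -
  let ?L = "linear2 (d1 (\<lambda>x. fst (\<Phi> x)) p) (d2 (\<lambda>x. fst (\<Phi> x)) p)
     (d1 (\<lambda>x. snd (\<Phi> x)) p) (d2 (\<lambda>x. snd (\<Phi> x)) p)"
  have "(\<Phi> has_derivative ?L) (at p)" by (rule holomorphic2_map_on_has_derivative[OF assms(2,4,3)])
  moreover have "inj ?L" using assms(1) by (simp add: jacobian_def inj_linear2_iff)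
  ultimately show ?thesis by (rule that)
qed

lemma biholomorphic_germ_compose:
  assumes \<Phi>: "biholomorphic_germ \<Phi>" and \<Psi>: "biholomorphic_germ \<Psi>"
  shows "biholomorphic_germ (\<lambda>x. \<Psi> (\<Phi> x))"
proof -
  obtain N where N: "open N" "0 \<in> N" "holomorphic2_map_on \<Phi> N"
    using \<Phi> unfolding biholomorphic_germ_def by (elim conjE exE)
  obtain M where M: "open M" "0 \<in> M" "holomorphic2_map_on \<Psi> M"
    using \<Psi> unfolding biholomorphic_germ_def by (elim conjE exE)
  have 0: "\<Phi> 0 = 0" "\<Psi> 0 = 0" using \<Phi> \<Psi> by (simp_all add: biholomorphic_germ_def)
  let ?N = "N \<inter> \<Phi> -` M"
  have op: "open ?N"
    by (rule continuous_open_preimage[OF holomorphic2_map_on_continuous[OF N(3)] N(1) M(1)])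
  have z: "0 \<in> ?N" using N(2) M(2) 0 by simp
  have hol: "holomorphic2_map_on (\<lambda>x. \<Psi> (\<Phi> x)) ?N"
    by (rule holomorphic2_map_on_compose[OF holomorphic2_map_on_subset[OF N(3)] M(3)]) auto
  obtain L where L: "(\<Phi> has_derivative L) (at 0)" "inj L"
    by (rule inj_derivative_if_jacobian_nonzero[OF _ N]) (use \<Phi> in \<open>simp_all add: biholomorphic_germ_def\<close>)
  obtain K where K: "(\<Psi> has_derivative K) (at 0)" "inj K"
    by (rule inj_derivative_if_jacobian_nonzero[OF _ M]) (use \<Psi> in \<open>simp_all add: biholomorphic_germ_def\<close>)
  have "((\<lambda>x. \<Psi> (\<Phi> x)) has_derivative (\<lambda>x. K (L x))) (at 0)"
    by (rule has_derivative_compose[OF L(1)]) (simp add: 0 K(1))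
  moreover have "inj (\<lambda>x. K (L x))" using inj_compose[OF K(2) L(2)] by (simp add: o_def)
  ultimately have "jacobian (\<lambda>x. \<Psi> (\<Phi> x)) 0 \<noteq> 0"
    using jacobian_nonzero_if_inj_derivative op z hol by blast
  then show ?thesis unfolding biholomorphic_germ_def using op z hol 0 by auto
qed

lemma biholomorphic_germ_inverse:
  assumes "biholomorphic_germ \<Phi>" "open T" "0 \<in> T"
  obtains U V G where "open U" "U \<subseteq> T" "0 \<in> U" "open V" "homeomorphism U V \<Phi> G"
    "holomorphic2_map_on \<Phi> U" "holomorphic2_map_on G V"
proof -
  obtain N where N: "open N" "0 \<in> N" "holomorphic2_map_on \<Phi> N"
    using assms(1) unfolding biholomorphic_germ_def by (elim conjE exE)
  have J: "jacobian \<Phi> 0 \<noteq> 0" using assms(1) by (simp add: biholomorphic_germ_def)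
  have hol: "holomorphic2_map_on \<Phi> (N \<inter> T)"
    by (rule holomorphic2_map_on_subset[OF N(3)]) simp
  obtain U V G where *: "open U" "U \<subseteq> N \<inter> T" "0 \<in> U" "open V" "homeomorphism U V \<Phi> G"
    "holomorphic2_map_on G V"
    by (rule holomorphic2_inverse_function[OF _ hol _ J]) (use N assms(2,3) in \<open>simp_all add: open_Int\<close>)
  have "holomorphic2_map_on \<Phi> U" by (rule holomorphic2_map_on_subset[OF hol *(2)])
  then show ?thesis using that[of U V G] * by blast
qed

lemma biholomorphic_germ_triangular:
  assumes N: "open N" "0 \<in> N" and \<alpha>: "\<alpha> holomorphic_on ball 0 s" "s > 0" "\<alpha> 0 = 0" "deriv \<alpha> 0 \<noteq> 0"
    and \<beta>: "holomorphic2_on \<beta> N" "\<beta> 0 = 0" "d2 \<beta> 0 \<noteq> 0"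
  shows "biholomorphic_germ (\<lambda>x. (\<alpha> (fst x), \<beta> x))"
proof -
  let ?N = "N \<inter> (ball 0 s \<times> UNIV)"
  have op: "open ?N" using N by (intro open_Int open_Times) auto
  have z: "0 \<in> ?N" using N \<alpha>(2) by (simp add: zero_prod_def)
  have hol: "holomorphic2_map_on (\<lambda>x. (\<alpha> (fst x), \<beta> x)) ?N"
    by (rule holomorphic2_map_onI)
      (auto intro!: holomorphic2_on_compose_fst[OF \<alpha>(1)] holomorphic2_on_subset[OF \<beta>(1)])
  have "d1 (\<lambda>x. \<alpha> (fst x)) 0 = deriv \<alpha> 0" "d2 (\<lambda>x. \<alpha> (fst x)) 0 = 0"
    by (simp_all add: d1_def d2_def)
  then have "jacobian (\<lambda>x. (\<alpha> (fst x), \<beta> x)) 0 \<noteq> 0"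
    using \<alpha>(4) \<beta>(3) by (simp add: jacobian_def)
  then show ?thesis unfolding biholomorphic_germ_def using op z hol \<alpha>(3) \<beta>(2)
    by (auto simp: zero_prod_def)
qed

lemma biholomorphic_germ_swap: "biholomorphic_germ prod.swap"
proof -
  have hol: "holomorphic2_map_on prod.swap UNIV"
    by (rule holomorphic2_map_onI) (simp_all add: holomorphic2_intros holomorphic2_on_fst[unfolded fst_def] holomorphic2_on_snd)
  have "(prod.swap has_derivative prod.swap) (at (0 :: complex \<times> complex))"
    unfolding prod.swap_def by (auto intro!: derivative_eq_intros)
  from jacobian_nonzero_if_inj_derivative[OF this _ _ _ hol]
  have "jacobian prod.swap 0 \<noteq> 0" by simp
  then show ?thesis unfolding biholomorphic_germ_def using hol by (auto simp: zero_prod_def)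
qed

lemma finite_germI:
  assumes "open S" "0 \<in> S" "holomorphic2_map_on F S" "F 0 = 0"
    and "\<And>N. open N \<Longrightarrow> 0 \<in> N \<Longrightarrow> \<exists>e>0. \<forall>x\<in>S. F x \<in> ball 0 e \<longrightarrow> x \<in> N"
    and "e > 0" "\<And>W. open W \<Longrightarrow> W \<noteq> {} \<Longrightarrow> W \<subseteq> ball 0 e \<Longrightarrow>
        \<exists>W'. open W' \<and> W' \<noteq> {} \<and> W' \<subseteq> W \<and> (\<forall>y\<in>W'. card {x \<in> S. F x = y} = d)"
  shows "finite_germ F S d"
proof -
  have "proper_at_0 F S" unfolding proper_at_0_def using assms(5) by (intro allI impI)
  moreover have "generic_degree_at_0 F S d"
    unfolding generic_degree_at_0_def using assms(6,7) by (intro exI[of _ e] conjI allI impI)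
  ultimately show ?thesis using assms(1-4) by (simp add: finite_germ_def)
qed

lemma finite_germ_generic:
  assumes "finite_germ F S d"
  obtains e where "e > 0" "\<And>W. open W \<Longrightarrow> W \<noteq> {} \<Longrightarrow> W \<subseteq> ball 0 e \<Longrightarrow>
        \<exists>W'. open W' \<and> W' \<noteq> {} \<and> W' \<subseteq> W \<and> (\<forall>y\<in>W'. card {x \<in> S. F x = y} = d)"
proof -
  have "generic_degree_at_0 F S d" using assms by (simp add: finite_germ_def)
  then obtain e where "e > 0" "\<forall>W. open W \<longrightarrow> W \<noteq> {} \<longrightarrow> W \<subseteq> ball 0 e \<longrightarrow>
        (\<exists>W'. open W' \<and> W' \<noteq> {} \<and> W' \<subseteq> W \<and> (\<forall>y\<in>W'. card {x \<in> S. F x = y} = d))"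
    unfolding generic_degree_at_0_def by (elim exE conjE)
  then show ?thesis by (intro that[of e]) simp_all
qed

lemma finite_germ_restrict:
  assumes germ: "finite_germ F S d" and T: "open T" "0 \<in> T" "T \<subseteq> S"
  shows "finite_germ F T d"
proof -
  obtain e where e: "e > 0" "\<And>W. open W \<Longrightarrow> W \<noteq> {} \<Longrightarrow> W \<subseteq> ball 0 e \<Longrightarrow>
        \<exists>W'. open W' \<and> W' \<noteq> {} \<and> W' \<subseteq> W \<and> (\<forall>y\<in>W'. card {x \<in> S. F x = y} = d)"
    by (rule finite_germ_generic[OF germ]) (rule that)
  obtain e' where e': "e' > 0" "\<And>x. x \<in> S \<Longrightarrow> F x \<in> ball 0 e' \<Longrightarrow> x \<in> T"
    by (rule finite_germ_proper[OF germ T(1,2)]) (rule that)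
  show ?thesis
  proof (rule finite_germI[where e = "min e e'"])
    show "\<exists>e>0. \<forall>x\<in>T. F x \<in> ball 0 e \<longrightarrow> x \<in> N" if N: "open N" "0 \<in> N" for N
    proof -
      obtain e where "e > 0" "\<And>x. x \<in> S \<Longrightarrow> F x \<in> ball 0 e \<Longrightarrow> x \<in> N"
        by (rule finite_germ_proper[OF germ N]) (rule that)
      then show ?thesis using T(3) by (intro exI[of _ e]) auto
    qed
    fix W assume W: "open W" "W \<noteq> {}" "W \<subseteq> ball (0 :: complex \<times> complex) (min e e')"
    have "W \<subseteq> ball 0 e" using W(3) by auto
    from e(2)[OF W(1,2) this] obtain W' where W': "open W'" "W' \<noteq> {}" "W' \<subseteq> W" "\<forall>y\<in>W'. card {x \<in> S. F x = y} = d"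
      by (elim exE conjE)
    have "{x \<in> T. F x = y} = {x \<in> S. F x = y}" if "y \<in> W'" for y
    proof -
      have "y \<in> ball 0 e'" using that W'(3) W(3) by auto
      then show ?thesis using e'(2) T(3) by blast
    qed
    then show "\<exists>W'. open W' \<and> W' \<noteq> {} \<and> W' \<subseteq> W \<and> (\<forall>y\<in>W'. card {x \<in> T. F x = y} = d)"
      using W' by (intro exI[of _ W']) simp
  qed (use T finite_germD[OF germ] e(1) e'(1) holomorphic2_map_on_subset[OF finite_germD(3)[OF germ] T(3)] in simp_all)
qed

text \<open>The change of coordinates maps fibres bijectively to fibres.\<close>

lemma finite_germ_source_change:
  assumes germ: "finite_germ F S d" and U: "open U" "0 \<in> U" "U \<subseteq> S" and V: "open V"
    and hom: "homeomorphism U V \<Theta> G" and G: "holomorphic2_map_on G V" and \<Theta>0: "\<Theta> 0 = 0"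
  shows "finite_germ (\<lambda>x. F (G x)) V d"
proof -
  note germU = finite_germ_restrict[OF germ U]
  have GU: "G x \<in> U" "\<Theta> (G x) = x" if "x \<in> V" for x
    using hom that unfolding homeomorphism_def by blast+
  have \<Theta>V: "\<Theta> x \<in> V" "G (\<Theta> x) = x" if "x \<in> U" for x
    using hom that unfolding homeomorphism_def by blast+
  have G0: "G 0 = 0" using \<Theta>V(2)[OF U(2)] \<Theta>0 by simp
  obtain e where e: "e > 0" "\<And>W. open W \<Longrightarrow> W \<noteq> {} \<Longrightarrow> W \<subseteq> ball 0 e \<Longrightarrow>
        \<exists>W'. open W' \<and> W' \<noteq> {} \<and> W' \<subseteq> W \<and> (\<forall>y\<in>W'. card {x \<in> U. F x = y} = d)"
    by (rule finite_germ_generic[OF germU]) (rule that)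
  have card: "card {x \<in> V. F (G x) = y} = card {x \<in> U. F x = y}" for y
  proof -
    have "bij_betw G {x \<in> V. F (G x) = y} {x \<in> U. F x = y}"
      by (rule bij_betw_byWitness[where f' = \<Theta>]) (use GU \<Theta>V in auto)
    then show ?thesis by (rule bij_betw_same_card)
  qed
  show ?thesis
  proof (rule finite_germI[where e = e])
    show "0 \<in> V" using \<Theta>V(1)[OF U(2)] \<Theta>0 by simp
    show "holomorphic2_map_on (\<lambda>x. F (G x)) V"
      by (rule holomorphic2_map_on_compose[OF G finite_germD(3)[OF germU]]) (rule GU)
    show "\<exists>e>0. \<forall>x\<in>V. F (G x) \<in> ball 0 e \<longrightarrow> x \<in> N" if N: "open N" "0 \<in> N" for N
    proof -
      have "continuous_on U \<Theta>" using hom unfolding homeomorphism_def by simp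
      then have op: "open (U \<inter> \<Theta> -` N)" by (rule continuous_open_preimage[OF _ U(1) N(1)])
      have "0 \<in> U \<inter> \<Theta> -` N" using U N \<Theta>0 by simp
      then obtain e where "e > 0" "\<And>x. x \<in> U \<Longrightarrow> F x \<in> ball 0 e \<Longrightarrow> x \<in> U \<inter> \<Theta> -` N"
        by (rule finite_germ_proper[OF germU op]) (rule that)
      then show ?thesis using GU by (intro exI[of _ e]) fastforce
    qed
    show "\<exists>W'. open W' \<and> W' \<noteq> {} \<and> W' \<subseteq> W \<and> (\<forall>y\<in>W'. card {x \<in> V. F (G x) = y} = d)"
      if "open W" "W \<noteq> {}" "W \<subseteq> ball 0 e" for W
      unfolding card by (rule e(2)[OF that])
  qed (use V e(1) G0 finite_germD(4)[OF germ] in simp_all)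
qed

lemma norm_swap: "norm (prod.swap x) = norm (x :: complex \<times> complex)"
  by (simp add: norm_prod_def add.commute)

lemma finite_germ_swap:
  assumes germ: "finite_germ F S d"
  shows "finite_germ (\<lambda>x. prod.swap (F x)) S d"
proof -
  obtain e where e: "e > 0" "\<And>W. open W \<Longrightarrow> W \<noteq> {} \<Longrightarrow> W \<subseteq> ball 0 e \<Longrightarrow>
        \<exists>W'. open W' \<and> W' \<noteq> {} \<and> W' \<subseteq> W \<and> (\<forall>y\<in>W'. card {x \<in> S. F x = y} = d)"
    by (rule finite_germ_generic[OF germ]) (rule that)
  have swap_open: "open (prod.swap -` W)" if "open W" for W :: "(complex \<times> complex) set"
    unfolding prod.swap_def by (intro open_vimage that continuous_intros)
  show ?thesis
  proof (rule finite_germI[where e = e])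
    show "holomorphic2_map_on (\<lambda>x. prod.swap (F x)) S"
      using holomorphic2_map_onD[OF finite_germD(3)[OF germ]] by (intro holomorphic2_map_onI) simp_all
    show "\<exists>e>0. \<forall>x\<in>S. prod.swap (F x) \<in> ball 0 e \<longrightarrow> x \<in> N" if N: "open N" "0 \<in> N" for N
    proof -
      obtain e where "e > 0" "\<And>x. x \<in> S \<Longrightarrow> F x \<in> ball 0 e \<Longrightarrow> x \<in> N"
        by (rule finite_germ_proper[OF germ N]) (rule that)
      then show ?thesis by (intro exI[of _ e]) (simp add: norm_swap)
    qed
    fix W assume W: "open W" "W \<noteq> {}" "W \<subseteq> ball (0 :: complex \<times> complex) e"
    have ne: "prod.swap -` A \<noteq> {}" if A: "A \<noteq> {}" for A :: "(complex \<times> complex) set"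
    proof -
      obtain a where "a \<in> A" using A by blast
      then have "prod.swap a \<in> prod.swap -` A" by simp
      then show ?thesis by blast
    qed
    have sub: "prod.swap -` W \<subseteq> ball 0 e"
    proof
      fix x assume "x \<in> prod.swap -` W"
      then have "prod.swap x \<in> ball 0 e" using W(3) by blast
      then show "x \<in> ball 0 e" by (simp add: norm_swap)
    qed
    from e(2)[OF swap_open[OF W(1)] ne[OF W(2)] sub] obtain W' where W': "open W'" "W' \<noteq> {}"
        "W' \<subseteq> prod.swap -` W" "\<forall>y\<in>W'. card {x \<in> S. F x = y} = d"
      by (elim exE conjE)
    show "\<exists>W'. open W' \<and> W' \<noteq> {} \<and> W' \<subseteq> W \<and> (\<forall>y\<in>W'. card {x \<in> S. prod.swap (F x) = y} = d)"
    proof (intro exI[of _ "prod.swap -` W'"] conjI ballI)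
      show "open (prod.swap -` W')" by (rule swap_open[OF W'(1)])
      show "prod.swap -` W' \<noteq> {}" by (rule ne[OF W'(2)])
      show "prod.swap -` W' \<subseteq> W"
      proof
        fix x assume "x \<in> prod.swap -` W'"
        then have "prod.swap x \<in> prod.swap -` W" using W'(3) by blast
        then show "x \<in> W" by simp
      qed
      fix y assume "y \<in> prod.swap -` W'"
      then have "card {x \<in> S. F x = prod.swap y} = d" using W'(4) by simp
      moreover have "(F x = prod.swap y) = (prod.swap (F x) = y)" for x by auto
      ultimately show "card {x \<in> S. prod.swap (F x) = y} = d" by simp
    qed
  qed (use e(1) finite_germD[OF germ] in \<open>simp_all add: zero_prod_def\<close>)
qed

section \<open>Maps that preserve the first coordinate\<close>

text \<open>The fibre over \<open>(z, v)\<close> is the set of zeros of \<open>g (z, _) - v\<close>.  Counted with multiplicity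
  their number is the order of \<open>g (0, _)\<close> by Hurwitz, and over a regular value the zeros are simple.\<close>

lemma finite_germ_fibred_order:
  assumes germ: "finite_germ F S d" and fibred: "\<And>x. x \<in> S \<Longrightarrow> fst (F x) = fst x"
  defines "g \<equiv> \<lambda>x. snd (F x)"
  obtains R where "R > 0" "cball 0 R \<times> cball 0 R \<subseteq> S"
    "\<And>w. w \<in> cball 0 R - {0} \<Longrightarrow> g (0, w) \<noteq> 0" "zorder (\<lambda>w. g (0, w)) 0 = int d"
proof -
  note gD = finite_germD[OF germ]
  have Fg: "F x = (fst x, g x)" if "x \<in> S" for x using fibred[OF that] by (simp add: g_def prod_eq_iff)
  have g: "holomorphic2_on g S" unfolding g_def by (rule holomorphic2_map_onD(2)[OF gD(3)])
  have "(0, 0) \<in> S" using gD(2) by (simp add: zero_prod_def)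
  then obtain R where R: "R > 0" "cball 0 R \<times> cball 0 R \<subseteq> S"
    by (rule open_contains_polydisc[OF gD(1)]) (rule that)
  have inS: "(z, w) \<in> S" if "norm z \<le> R" "norm w \<le> R" for z w
    using R(2) that by (intro subsetD[OF R(2)]) simp
  have g0: "g (0, 0) = 0" using gD(4) by (simp add: g_def zero_prod_def)
  have nz: "g (0, w) \<noteq> 0" if "w \<in> cball 0 R - {0}" for w
  proof
    assume *: "g (0, w) = 0"
    have wS: "(0, w) \<in> S" using that R(1) by (intro inS) auto
    have "open (- {(0 :: complex, w)})" "0 \<in> - {(0 :: complex, w)}" using that by (auto simp: zero_prod_def)
    then obtain e where "e > 0" "\<And>x. x \<in> S \<Longrightarrow> F x \<in> ball 0 e \<Longrightarrow> x \<in> - {(0, w)}"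
      by (rule finite_germ_proper[OF germ]) (rule that)
    from this(2)[OF wS] this(1) show False using Fg[OF wS] * by (simp flip: zero_prod_def)
  qed
  define r where "r = R / 2"
  have r: "0 < r" "r < R" using R by (auto simp: r_def)
  have hol: "(\<lambda>w. g (z, w) - c) holomorphic_on ball 0 R" if "norm z < R" for z c
    using that by (intro holomorphic_intros holomorphic2_on_slices(2)[OF g] inS) auto
  obtain e where e: "e > 0" "ball (0, 0) e \<subseteq> ball (0::complex) R \<times> (UNIV :: complex set)"
    "\<And>p w. p \<in> ball (0, 0) e \<Longrightarrow> w \<in> sphere 0 r \<Longrightarrow> g (fst p, w) - snd p \<noteq> 0"
    "\<And>p. p \<in> ball (0, 0) e \<Longrightarrow> finite {w \<in> ball 0 r. g (fst p, w) - snd p = 0}"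
    "\<And>p. p \<in> ball (0, 0) e \<Longrightarrow>
      (\<Sum>w | w \<in> ball 0 r \<and> g (fst p, w) - snd p = 0. zorder (\<lambda>w. g (fst p, w) - snd p) w) =
        zorder (\<lambda>w. g (fst (0::complex, 0::complex), w) - snd (0::complex, 0::complex)) 0"
  proof (rule zero_count_stable[of "ball 0 R \<times> UNIV" "(0::complex, 0::complex)" 0 r
        "\<lambda>p w. g (fst p, w) - snd p" R])
    have "continuous_on ((ball 0 R \<times> UNIV) \<times> sphere 0 r) (\<lambda>q::(complex \<times> complex) \<times> complex. g (fst (fst q), snd q))"
      by (rule continuous_on_compose2[OF holomorphic2_on_continuous[OF g]])
        (use r inS in \<open>auto intro!: continuous_intros\<close>)
    then show "continuous_on ((ball 0 R \<times> UNIV) \<times> sphere 0 r) (\<lambda>(p, w). g (fst p, w) - snd p)"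
      by (auto simp: case_prod_beta intro!: continuous_intros)
    show "g (fst (0, 0), z) - snd (0::complex, 0) \<noteq> 0" if "z \<in> cball 0 r - {0}" for z
      using that nz[of z] r by simp
    show "g (fst (0::complex, 0::complex), 0) - snd (0::complex, 0::complex) = 0"
      using g0 by simp
    show "open (ball (0::complex) R \<times> (UNIV :: complex set))" by (intro open_Times) auto
    show "(0, 0) \<in> ball (0::complex) R \<times> (UNIV :: complex set)" using R by simp
    show "(\<lambda>w. g (fst p, w) - snd p) holomorphic_on ball 0 R" if "p \<in> ball 0 R \<times> UNIV" for p
      by (rule hol) (use that in auto)
  qed (rule r(1), rule r(2), rule that)
  let ?Q = "ball (0::complex) R \<times> ball (0::complex) r"
  have "open ?Q" "0 \<in> ?Q" using r R by (auto simp: zero_prod_def intro: open_Times)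
  then obtain e' where e': "e' > 0" "\<And>x. x \<in> S \<Longrightarrow> F x \<in> ball 0 e' \<Longrightarrow> x \<in> ?Q"
    by (rule finite_germ_proper[OF germ]) (rule that)
  have meets: "ball 0 (min e e') \<inter> ball (0::complex\<times>complex) \<epsilon> \<noteq> {}" if "\<epsilon> > 0" for \<epsilon>
    using that e(1) e'(1) by (intro ex_in_conv[THEN iffD1] exI[of _ 0]) auto
  obtain y where y: "y \<in> ball 0 (min e e')" "card {x \<in> S. F x = y} = d"
    "\<And>x. x \<in> S \<Longrightarrow> F x = y \<Longrightarrow> jacobian F x \<noteq> 0"
    by (rule finite_germ_regular_value[OF germ open_ball meets]) (assumption, rule that)
  have ye: "y \<in> ball (0, 0) e" "y \<in> ball 0 e'" using y(1) by (simp_all flip: zero_prod_def)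
  then have y1: "norm (fst y) < R" using e(2) by (cases y) auto
  let ?f = "\<lambda>w. g (fst y, w) - snd y"
  let ?Z = "{w. w \<in> ball 0 r \<and> ?f w = 0}"
  have Z: "(fst y, w) \<in> {x \<in> S. F x = y}" if "w \<in> ?Z" for w
  proof -
    have "(fst y, w) \<in> S" using that y1 r by (intro inS) auto
    then show ?thesis using Fg[of "(fst y, w)"] that by (simp add: prod_eq_iff)
  qed
  have "bij_betw snd {x \<in> S. F x = y} ?Z"
  proof (rule bij_betw_byWitness[where f' = "\<lambda>w. (fst y, w)"])
    show "\<forall>x\<in>{x \<in> S. F x = y}. (fst y, snd x) = x" 
    proof
      fix x assume "x \<in> {x \<in> S. F x = y}"
      then have "fst x = fst y" using fibred[of x] by simp
      then show "(fst y, snd x) = x" by (simp add: prod_eq_iff)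
    qed
    show "snd ` {x \<in> S. F x = y} \<subseteq> ?Z"
    proof
      fix w assume "w \<in> snd ` {x \<in> S. F x = y}"
      then obtain x where x: "x \<in> S" "F x = y" "w = snd x" by (elim imageE CollectE conjE)
      have "x \<in> ?Q" by (rule e'(2)[OF x(1)]) (simp only: x(2) ye)
      then have "w \<in> ball 0 r" using x(3) by auto
      moreover have "x = (fst y, w)" using fibred[OF x(1)] x(2,3) by (simp add: prod_eq_iff)
      then have "g (fst y, w) = snd y" using x(2) by (simp add: g_def)
      ultimately show "w \<in> ?Z" by simp
    qed
    show "\<forall>w\<in>?Z. snd (fst y, w) = w" by simp
    show "(\<lambda>w. (fst y, w)) ` ?Z \<subseteq> {x \<in> S. F x = y}" by (rule image_subsetI) (rule Z)
  qed
  from bij_betw_same_card[OF this] have card: "card ?Z = d" using y(2) by simp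
  have "zorder ?f w = 1" if w: "w \<in> ?Z" for w
  proof (rule zorder_simple[OF hol[OF y1] open_ball])
    show "w \<in> ball 0 R" using w r by simp
    have xS: "(fst y, w) \<in> S" "F (fst y, w) = y" using Z[OF w] by auto
    have J: "jacobian F (fst y, w) \<noteq> 0" by (rule y(3)[OF xS])
    have "((\<lambda>x. fst (F x)) has_derivative fst) (at (fst y, w))"
      by (rule has_derivative_transform_within_open[of fst _ _ UNIV S])
        (use gD(1) xS fibred in \<open>auto intro!: derivative_eq_intros\<close>)
    then have "((\<lambda>x. fst (F x)) has_derivative (\<lambda>x. 1 * fst x + 0 * snd x)) (at (fst y, w))" by simp
    from partials_unique[OF this] have "d2 g (fst y, w) \<noteq> 0"
      using J by (simp add: jacobian_def g_def)
    then show "deriv ?f w \<noteq> 0"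
      using d2_minus_const[OF g gD(1) xS(1), of "snd y"] by simp
  qed (use w in simp)
  then have "(\<Sum>w\<in>?Z. zorder ?f w) = int d" using card by simp
  moreover have "(\<Sum>w\<in>?Z. zorder ?f w) = zorder (\<lambda>w. g (0, w)) 0" using e(5)[OF ye(1)] by simp
  ultimately have "zorder (\<lambda>w. g (0, w)) 0 = int d" by simp
  then show ?thesis using that[OF R] nz by blast
qed

section \<open>Division by a quadratic polynomial\<close>

lemma separately_holomorphic_onI:
  assumes "continuous_on (D \<times> E) g" "open D" "open E"
    and "\<And>w. w \<in> E \<Longrightarrow> (\<lambda>z. g (z, w)) holomorphic_on D"
    and "\<And>z. z \<in> D \<Longrightarrow> (\<lambda>w. g (z, w)) holomorphic_on E"
  shows "holomorphic2_on g (D \<times> E)"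
proof (rule separately_holomorphic_on_imp_holomorphic2_on)
  show "separately_holomorphic_on g (D \<times> E)"
    unfolding separately_holomorphic_on_def
  proof (intro conjI ballI)
    fix p assume p: "p \<in> D \<times> E"
    show "(\<lambda>z. g (z, snd p)) field_differentiable at (fst p)"
      by (rule holomorphic_on_imp_differentiable_at[OF assms(4,2)]) (use p in auto)
    show "(\<lambda>w. g (fst p, w)) field_differentiable at (snd p)"
      by (rule holomorphic_on_imp_differentiable_at[OF assms(5,3)]) (use p in auto)
  qed (rule assms(1))
qed (use assms in \<open>auto intro: open_Times\<close>)

text \<open>Write \<open>1 / (\<zeta> - w)\<close> in Cauchy's formula as
  \<open>(\<zeta> + w) / (\<zeta>^2 - d) + (w^2 - d) / ((\<zeta>^2 - d) (\<zeta> - w))\<close>.  The first term gives the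
  remainder and the second the quotient.\<close>

lemma division_by_quadratic:
  assumes F: "holomorphic2_on F (ball 0 \<delta> \<times> ball 0 R)" and d: "d holomorphic_on ball 0 \<delta>"
    and r: "0 < r" "r < R" and dr: "\<And>z. z \<in> ball 0 \<delta> \<Longrightarrow> norm (d z) < r ^ 2"
  obtains A B Q where "A holomorphic_on ball 0 \<delta>" "B holomorphic_on ball 0 \<delta>"
    "holomorphic2_on Q (ball 0 \<delta> \<times> ball 0 r)"
    "\<And>z w. z \<in> ball 0 \<delta> \<Longrightarrow> w \<in> ball 0 r \<Longrightarrow> F (z, w) = A z + B z * w + (w ^ 2 - d z) * Q (z, w)"
proof -
  let ?k = "1 / (2 * of_real pi * \<i>) :: complex"
  let ?D = "ball (0::complex) \<delta>" and ?S = "sphere (0::complex) r"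
  have nz: "\<zeta> ^ 2 - d z \<noteq> 0" if "z \<in> ?D" "\<zeta> \<in> ?S" for z \<zeta>
  proof
    assume "\<zeta> ^ 2 - d z = 0"
    then have "norm (\<zeta> ^ 2) = norm (d z)" by simp
    then show False using dr[OF that(1)] that(2) by (simp add: norm_power)
  qed
  define G where "G z \<zeta> = F (z, \<zeta>) / (\<zeta> ^ 2 - d z)" for z \<zeta>
  have cG: "continuous_on (?D \<times> ?S) (\<lambda>q. G (fst q) (snd q))"
  proof -
    have "continuous_on (?D \<times> ?S) (\<lambda>q. F (fst q, snd q))"
      by (rule continuous_on_compose2[OF holomorphic2_on_continuous[OF F]])
        (use r in \<open>auto intro!: continuous_intros\<close>)
    moreover have "continuous_on (?D \<times> ?S) (\<lambda>q. d (fst q))"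
      by (rule continuous_on_compose2[OF holomorphic_on_imp_continuous_on[OF d]])
        (auto intro!: continuous_intros)
    ultimately show ?thesis
      unfolding G_def using nz by (intro continuous_intros) auto
  qed
  have hG: "(\<lambda>z. G z \<zeta>) holomorphic_on ?D" if "\<zeta> \<in> ?S" for \<zeta>
  proof -
    have "(\<lambda>z. F (z, \<zeta>)) holomorphic_on ?D"
      by (rule holomorphic2_on_slices(1)[OF F]) (use that r in auto)
    then show ?thesis unfolding G_def using nz that by (intro holomorphic_intros d) auto
  qed
  have cGz: "continuous_on ?S (G z)" if "z \<in> ?D" for z
  proof -
    have "continuous_on ?S (\<lambda>\<zeta>. (\<lambda>q. G (fst q) (snd q)) (z, \<zeta>))"
      by (rule continuous_on_compose2[OF cG]) (use that in \<open>auto intro!: continuous_intros\<close>)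
    then show ?thesis by simp
  qed
  define A where "A z = ?k * contour_integral (circlepath 0 r) (\<lambda>\<zeta>. \<zeta> * G z \<zeta>)" for z
  define B where "B z = ?k * contour_integral (circlepath 0 r) (G z)" for z
  define Q where "Q p = ?k * contour_integral (circlepath 0 r) (\<lambda>\<zeta>. G (fst p) \<zeta> / (\<zeta> - snd p))" for p
  have A: "A holomorphic_on ?D"
    unfolding A_def
    by (intro holomorphic_on_mult[OF holomorphic_on_const] holomorphic_circle_integral_param)
      (use r hG cG in \<open>auto simp: case_prod_beta intro!: continuous_intros holomorphic_intros\<close>)
  have B: "B holomorphic_on ?D"
    unfolding B_def
    by (intro holomorphic_on_mult[OF holomorphic_on_const] holomorphic_circle_integral_param)
      (use r hG cG in \<open>auto simp: case_prod_beta\<close>)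
  have Q: "holomorphic2_on Q (?D \<times> ball 0 r)"
  proof (rule separately_holomorphic_onI)
    have "continuous_on ((?D \<times> ball 0 r) \<times> ?S) (\<lambda>q. (\<lambda>q. G (fst q) (snd q)) (fst (fst q), snd q))"
      by (rule continuous_on_compose2[OF cG]) (auto intro!: continuous_intros)
    then have "continuous_on ((?D \<times> ball 0 r) \<times> ?S) (\<lambda>q. G (fst (fst q)) (snd q))" by simp
    then show "continuous_on (?D \<times> ball 0 r) Q"
      unfolding Q_def
      by (intro continuous_on_mult[OF continuous_on_const] continuous_on_circle_integral_param)
        (use r in \<open>auto simp: case_prod_beta intro!: continuous_intros\<close>)
    fix w :: complex assume w: "w \<in> ball 0 r"
    show "(\<lambda>z. Q (z, w)) holomorphic_on ?D"
      unfolding Q_def fst_conv snd_conv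
      by (intro holomorphic_on_mult[OF holomorphic_on_const] holomorphic_circle_integral_param)
        (use r w cG hG in \<open>auto simp: case_prod_beta intro!: continuous_intros holomorphic_intros\<close>)
  next
    fix z assume z: "z \<in> ?D"
    have "continuous_on (ball 0 r \<times> ?S) (\<lambda>q. G z (snd q))"
      by (rule continuous_on_compose2[OF cGz[OF z]]) (auto intro!: continuous_intros)
    then show "(\<lambda>w. Q (z, w)) holomorphic_on ball 0 r"
      unfolding Q_def fst_conv snd_conv
      by (intro holomorphic_on_mult[OF holomorphic_on_const] holomorphic_circle_integral_param)
        (use r in \<open>auto simp: case_prod_beta intro!: continuous_intros holomorphic_intros\<close>)
  qed auto
  have "F (z, w) = A z + B z * w + (w ^ 2 - d z) * Q (z, w)" if z: "z \<in> ?D" and w: "w \<in> ball 0 r" for z w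
  proof -
    have "(\<lambda>\<zeta>. F (z, \<zeta>)) holomorphic_on cball 0 r"
      by (rule holomorphic2_on_slices(2)[OF F]) (use z r in auto)
    then have 1: "((\<lambda>\<zeta>. F (z, \<zeta>) / (\<zeta> - w)) has_contour_integral 2 * of_real pi * \<i> * F (z, w)) (circlepath 0 r)"
      by (rule Cauchy_integral_circlepath_simple) (use w in simp)
    have img: "path_image (circlepath 0 r) = ?S" using r by (simp add: path_image_circlepath)
    have int: "(f has_contour_integral contour_integral (circlepath 0 r) f) (circlepath 0 r)"
      if "continuous_on ?S f" for f
      by (rule has_contour_integral_integral[OF contour_integrable_continuous_circlepath])
        (use that img in simp)
    have "((\<lambda>\<zeta>. \<zeta> * G z \<zeta> + w * G z \<zeta> + (w ^ 2 - d z) * (G z \<zeta> / (\<zeta> - w))) has_contour_integral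
        contour_integral (circlepath 0 r) (\<lambda>\<zeta>. \<zeta> * G z \<zeta>) + w * contour_integral (circlepath 0 r) (G z) +
        (w ^ 2 - d z) * contour_integral (circlepath 0 r) (\<lambda>\<zeta>. G z \<zeta> / (\<zeta> - w))) (circlepath 0 r)"
      using w cGz[OF z]
      by (intro has_contour_integral_add has_contour_integral_lmul int) (auto intro!: continuous_intros)
    moreover have "\<zeta> * G z \<zeta> + w * G z \<zeta> + (w ^ 2 - d z) * (G z \<zeta> / (\<zeta> - w)) = F (z, \<zeta>) / (\<zeta> - w)"
      if "\<zeta> \<in> path_image (circlepath 0 r)" for \<zeta>
    proof -
      have \<zeta>: "\<zeta> \<in> ?S" using that unfolding img .
      have ne: "\<zeta> - w \<noteq> 0" using \<zeta> w by auto
      define X where "X = G z \<zeta> / (\<zeta> - w)"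
      have G: "G z \<zeta> = X * (\<zeta> - w)" using ne by (simp add: X_def)
      have "F (z, \<zeta>) = (\<zeta> ^ 2 - d z) * G z \<zeta>" using nz[OF z \<zeta>] by (simp add: G_def)
      then have "F (z, \<zeta>) / (\<zeta> - w) = (\<zeta> ^ 2 - d z) * X" by (simp add: X_def)
      also have "\<dots> = \<zeta> * G z \<zeta> + w * G z \<zeta> + (w ^ 2 - d z) * X"
        unfolding G by (simp add: algebra_simps power2_eq_square)
      finally show ?thesis by (simp add: X_def)
    qed
    ultimately have "((\<lambda>\<zeta>. F (z, \<zeta>) / (\<zeta> - w)) has_contour_integral
        contour_integral (circlepath 0 r) (\<lambda>\<zeta>. \<zeta> * G z \<zeta>) + w * contour_integral (circlepath 0 r) (G z) +
        (w ^ 2 - d z) * contour_integral (circlepath 0 r) (\<lambda>\<zeta>. G z \<zeta> / (\<zeta> - w))) (circlepath 0 r)"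
      by (rule has_contour_integral_eq)
    note eq = has_contour_integral_unique[OF this 1]
    let ?\<kappa> = "2 * of_real pi * \<i> :: complex"
    have "contour_integral (circlepath 0 r) (\<lambda>\<zeta>. \<zeta> * G z \<zeta>) = ?\<kappa> * A z"
      "contour_integral (circlepath 0 r) (G z) = ?\<kappa> * B z"
      "contour_integral (circlepath 0 r) (\<lambda>\<zeta>. G z \<zeta> / (\<zeta> - w)) = ?\<kappa> * Q (z, w)"
      by (simp_all add: A_def B_def Q_def)
    with eq have "?\<kappa> * F (z, w) = ?\<kappa> * (A z + B z * w + (w ^ 2 - d z) * Q (z, w))"
      by (simp only: distrib_left mult_ac)
    then show ?thesis by simp
  qed
  then show ?thesis using that[OF A B Q] by blast
qed

section \<open>The two critical points\<close>

lemma sum_eq_2_cases: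
  fixes k :: "'a \<Rightarrow> int"
  assumes "finite Z" "\<And>z. z \<in> Z \<Longrightarrow> 1 \<le> k z" "sum k Z = 2"
  obtains a where "Z = {a}" "k a = 2" | a b where "a \<noteq> b" "Z = {a, b}" "k a = 1" "k b = 1"
proof -
  have "Z \<noteq> {}" using assms(3) by auto
  then obtain a where a: "a \<in> Z" by blast
  have split: "sum k Z = k a + sum k (Z - {a})" using assms(1) a by (rule sum.remove)
  show ?thesis
  proof (cases "Z - {a} = {}")
    case True
    then have "Z = {a}" using a by blast
    then show ?thesis using that(1)[of a] assms(3) by simp
  next
    case False
    have "sum k (Z - {a}) \<ge> 1"
    proof -
      obtain b where b: "b \<in> Z - {a}" using False by blast
      have "k b \<le> sum k (Z - {a})"
        by (rule member_le_sum[OF b]) (use assms in \<open>auto intro: order.trans[of 0 1]\<close>)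
      then show ?thesis using assms(2)[of b] b by simp
    qed
    then have 1: "k a = 1" "sum k (Z - {a}) = 1" using split assms(3) assms(2)[OF a] by linarith+
    obtain b where "Z - {a} = {b}" "k b = 1"
      by (rule sum_eq_1_ge_1[of "Z - {a}" k]) (use assms 1 in auto)
    then show ?thesis using that(2)[of a b] a 1 by blast
  qed
qed

text \<open>If \<open>F (z, _)\<close> has two zeros near \<open>0\<close>, their sum and the sum of their squares are integrals
  and hence holomorphic in \<open>z\<close>.  The midpoint \<open>c z\<close> and the square \<open>d z\<close> of half the difference
  are polynomials in these power sums.\<close>

lemma quadratic_roots_germ:
  assumes F: "holomorphic2_on F (ball 0 R \<times> ball 0 R)" and R: "R > 0" and F0: "F (0, 0) = 0"
    and nz: "\<And>w. w \<in> ball 0 R - {0} \<Longrightarrow> F (0, w) \<noteq> 0" and ord: "zorder (\<lambda>w. F (0, w)) 0 = 2"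
  obtains \<delta> c d where "\<delta> > 0" "\<delta> \<le> R" "c holomorphic_on ball 0 \<delta>" "d holomorphic_on ball 0 \<delta>"
    "c 0 = 0" "d 0 = 0"
    "\<And>z s. z \<in> ball 0 \<delta> \<Longrightarrow> s ^ 2 = d z \<Longrightarrow> c z + s \<in> ball 0 R \<and> F (z, c z + s) = 0 \<and>
       (s = 0 \<longrightarrow> deriv (\<lambda>w. F (z, w)) (c z) = 0)"
proof -
  define r where "r = R / 2"
  have r: "0 < r" "r < R" using R by (auto simp: r_def)
  let ?B = "ball (0::complex) R" and ?S = "sphere (0::complex) r"
  have hol: "(\<lambda>w. F (z, w)) holomorphic_on ?B" if "z \<in> ?B" for z
    by (rule holomorphic2_on_slices(2)[OF F]) (use that in auto)
  obtain e where e: "e > 0" "ball 0 e \<subseteq> ?B"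
    "\<And>z w. z \<in> ball 0 e \<Longrightarrow> w \<in> ?S \<Longrightarrow> F (z, w) \<noteq> 0"
    "\<And>z. z \<in> ball 0 e \<Longrightarrow> finite {w \<in> ball 0 r. F (z, w) = 0}"
    "\<And>z. z \<in> ball 0 e \<Longrightarrow> (\<Sum>w | w \<in> ball 0 r \<and> F (z, w) = 0. zorder (\<lambda>w. F (z, w)) w) = zorder (\<lambda>w. F (0, w)) 0"
  proof (rule zero_count_stable[of ?B 0 0 r "\<lambda>z w. F (z, w)" R])
    have "continuous_on (?B \<times> ?S) F"
      by (rule continuous_on_subset[OF holomorphic2_on_continuous[OF F]]) (use r in auto)
    then show "continuous_on (?B \<times> ?S) (\<lambda>(z, w). F (z, w))" by simp
    show "F (0, w) \<noteq> 0" if "w \<in> cball 0 r - {0}" for w using that r by (intro nz) auto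
    show "open ?B" "0 \<in> ?B" using R by simp_all
    show "(\<lambda>w. F (z, w)) holomorphic_on ?B" if "z \<in> ?B" for z by (rule hol[OF that])
  qed (rule r(1), rule r(2), rule F0, rule that)
  let ?D = "ball (0::complex) e"
  have zR: "z \<in> ?B" if "z \<in> ?D" for z using that e(2) by blast
  have opB: "open (?B \<times> ?B)" by (intro open_Times) auto
  have dF: "deriv (\<lambda>w. F (z, w)) w = d2 F (z, w)" for z w by (simp add: d2_def)
  define p where "p j z = 1 / (2 * of_real pi * \<i>) *
      contour_integral (circlepath 0 r) (\<lambda>w. d2 F (z, w) * w ^ j / F (z, w))" for j z
  have p_hol: "p j holomorphic_on ?D" for j
    unfolding p_def
  proof (rule holomorphic_on_mult[OF holomorphic_on_const], rule holomorphic_circle_integral_param)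
    have sub: "?D \<times> ?S \<subseteq> ?B \<times> ?B" using e(2) r by auto
    have "continuous_on (?D \<times> ?S) F" "continuous_on (?D \<times> ?S) (d2 F)"
      by (rule continuous_on_subset[OF holomorphic2_on_continuous[OF F] sub],
          rule continuous_on_subset[OF holomorphic2_on_continuous[OF holomorphic2_on_d2[OF opB F]] sub])
    then show "continuous_on (?D \<times> ?S) (\<lambda>(z, w). d2 F (z, w) * w ^ j / F (z, w))"
      unfolding case_prod_beta prod.collapse using e(3) by (intro continuous_intros) auto
    fix w assume w: "w \<in> ?S"
    have "(\<lambda>z. F (z, w)) holomorphic_on ?D"
      by (rule holomorphic2_on_slices(1)[OF F]) (use w r zR in auto)
    moreover have "(\<lambda>z. d2 F (z, w)) holomorphic_on ?D"
      by (rule holomorphic2_on_slices(1)[OF holomorphic2_on_d2[OF opB F]]) (use w r zR in auto)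
    ultimately show "(\<lambda>z. d2 F (z, w) * w ^ j / F (z, w)) holomorphic_on ?D"
      using e(3) w by (intro holomorphic_intros) auto
  qed (use r in auto)
  have p_sum: "p j z = (\<Sum>w | w \<in> ball 0 r \<and> F (z, w) = 0. w ^ j * of_int (zorder (\<lambda>w. F (z, w)) w))"
    if z: "z \<in> ?D" for j z
    using argument_principle_circle(2)[OF hol[OF zR[OF z]] _ r e(3)[OF z], of "\<lambda>w. w ^ j"]
    unfolding dF p_def by (simp add: holomorphic_intros)
  define c where "c z = p 1 z / 2" for z
  define d where "d z = p 2 z / 2 - c z ^ 2" for z
  have hol_cd: "c holomorphic_on ?D" "d holomorphic_on ?D"
    unfolding c_def d_def by (intro holomorphic_intros p_hol; simp)+
  have main: "\<exists>a b. c z = (a + b) / 2 \<and> d z = ((a - b) / 2) ^ 2 \<and> a \<in> ball 0 r \<and> b \<in> ball 0 r \<and>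
      F (z, a) = 0 \<and> F (z, b) = 0 \<and> (a = b \<longrightarrow> deriv (\<lambda>w. F (z, w)) a = 0)" if z: "z \<in> ?D" for z
  proof -
    let ?Z = "{w. w \<in> ball 0 r \<and> F (z, w) = 0}"
    let ?k = "zorder (\<lambda>w. F (z, w))"
    have rR: "of_real r \<in> ?B" "of_real r \<in> ?S" using r by auto
    have fin: "finite ?Z" using e(4)[OF z] by simp
    have pos: "1 \<le> ?k w" if "w \<in> ?Z" for w
      by (rule zorder_pos_at_zero[OF hol[OF zR[OF z]] _ rR(1) e(3)[OF z rR(2)]]) (use that r in auto)
    have sum2: "sum ?k ?Z = 2" using e(5)[OF z] ord by simp
    show ?thesis
    proof (rule sum_eq_2_cases[OF fin pos sum2])
      fix a assume a: "?Z = {a}" "?k a = 2"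
      have aZ: "a \<in> ball 0 r" "F (z, a) = 0" using a(1) by auto
      have "deriv (\<lambda>w. F (z, w)) a = 0"
      proof (rule ccontr)
        assume "deriv (\<lambda>w. F (z, w)) a \<noteq> 0"
        then have "?k a = 1"
          by (intro zorder_simple[OF hol[OF zR[OF z]] open_ball]) (use aZ r in auto)
        then show False using a(2) by simp
      qed
      moreover have c: "c z = a" unfolding c_def p_sum[OF z] a(1) by (simp add: a(2))
      moreover have "d z = 0" unfolding d_def c p_sum[OF z] a(1) by (simp add: a(2))
      ultimately show ?thesis using aZ by (intro exI[of _ a]) simp
    next
      fix a b assume ab: "a \<noteq> b" "?Z = {a, b}" "?k a = 1" "?k b = 1"
      have aZ: "a \<in> ball 0 r" "F (z, a) = 0" "b \<in> ball 0 r" "F (z, b) = 0" using ab(2) by auto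
      have c: "c z = (a + b) / 2" unfolding c_def p_sum[OF z] ab(2) using ab(1) by (simp add: ab(3,4))
      moreover have "d z = ((a - b) / 2) ^ 2"
        unfolding d_def c p_sum[OF z] ab(2) using ab(1)
        by (simp add: ab(3,4) field_simps power2_eq_square)
      ultimately show ?thesis using aZ ab(1) by blast
    qed (assumption)
  qed
  have z0: "0 \<in> ?D" using e(1) by simp
  obtain a b where ab: "c 0 = (a + b) / 2" "d 0 = ((a - b) / 2) ^ 2" "a \<in> ball 0 r" "b \<in> ball 0 r"
      "F (0, a) = 0" "F (0, b) = 0"
    using main[OF z0] by blast
  have "a = 0" "b = 0" using nz[of a] nz[of b] ab r by auto
  then have "c 0 = 0" "d 0 = 0" using ab by simp_all
  moreover have "c z + s \<in> ?B \<and> F (z, c z + s) = 0 \<and> (s = 0 \<longrightarrow> deriv (\<lambda>w. F (z, w)) (c z) = 0)"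
    if z: "z \<in> ?D" and s: "s ^ 2 = d z" for z s
  proof -
    obtain a b where ab: "c z = (a + b) / 2" "d z = ((a - b) / 2) ^ 2" "a \<in> ball 0 r" "b \<in> ball 0 r"
      "F (z, a) = 0" "F (z, b) = 0" "a = b \<longrightarrow> deriv (\<lambda>w. F (z, w)) a = 0"
      using main[OF z] by blast
    have "s = (a - b) / 2 \<or> s = - ((a - b) / 2)" using s ab(2) by (simp add: power2_eq_iff)
    then have "c z + s = a \<or> c z + s = b" unfolding ab(1) by (auto simp: field_simps)
    then have "c z + s \<in> ball 0 r" "F (z, c z + s) = 0" using ab(3-6) by metis+
    moreover have "deriv (\<lambda>w. F (z, w)) (c z) = 0" if "s = 0"
    proof -
      have "a = b" using s ab(2) that by simp
      then show ?thesis using ab(1,7) by simp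
    qed
    moreover have "ball (0::complex) r \<subseteq> ?B" using r by auto
    ultimately show ?thesis by blast
  qed
  moreover have "e \<le> R"
  proof (rule ccontr)
    assume "\<not> e \<le> R"
    then have "of_real R \<in> ball (0::complex) e" using R by simp
    then have "of_real R \<in> ball (0::complex) R" using e(2) by blast
    then show False using R by simp
  qed
  ultimately show ?thesis using that[of e c d] e(1) hol_cd by blast
qed


section \<open>Simple roots and roots of powers\<close>

text \<open>At the origin the equation is linear in the unknown, with a single simple root.  By Hurwitz
  nearby equations have one simple root near it, and the argument principle with weight
  \<open>\<xi>\<close> expresses this root as an integral.\<close>

lemma cubic_root_germ:
  assumes a: "holomorphic2_on a0 (ball 0 \<delta> \<times> ball 0 \<rho>)" "holomorphic2_on a2 (ball 0 \<delta> \<times> ball 0 \<rho>)"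
      "holomorphic2_on a3 (ball 0 \<delta> \<times> ball 0 \<rho>)"
    and 0: "a2 0 = 0" "a3 0 = 0" and pos: "\<delta> > 0" "\<rho> > 0"
  obtains \<phi> e where "e > 0" "e \<le> \<delta>" "e \<le> \<rho>" "holomorphic2_on \<phi> (ball 0 e \<times> ball 0 e)"
    "\<And>p. p \<in> ball 0 e \<times> ball 0 e \<Longrightarrow> a0 p + 3 * \<phi> p + a2 p * \<phi> p ^ 2 + a3 p * \<phi> p ^ 3 = 0"
proof -
  define E where "E p \<xi> = a0 p + 3 * \<xi> + a2 p * \<xi> ^ 2 + a3 p * \<xi> ^ 3" for p \<xi>
  define E' where "E' p \<xi> = 3 + 2 * a2 p * \<xi> + 3 * a3 p * \<xi> ^ 2" for p \<xi>
  have dE: "((E p) has_field_derivative E' p \<xi>) (at \<xi>)" for p \<xi>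
    unfolding E_def E'_def by (auto intro!: derivative_eq_intros)
  have deriv_E: "deriv (E p) \<xi> = E' p \<xi>" for p \<xi> by (rule DERIV_imp_deriv[OF dE])
  have hE: "E p holomorphic_on T" for p T unfolding E_def by (intro holomorphic_intros)
  define \<xi>0 where "\<xi>0 = - a0 0 / 3"
  let ?P = "ball (0::complex) \<delta> \<times> ball (0::complex) \<rho>" and ?S = "sphere \<xi>0 1"
  note c = a[THEN holomorphic2_on_continuous]
  have cp: "continuous_on (T \<times> ?S) (\<lambda>q. k (fst q))"
    if "continuous_on ?P k" "T \<subseteq> ?P" for k :: "complex \<times> complex \<Rightarrow> complex" and T
    by (rule continuous_on_compose2[OF that(1)]) (use that(2) in \<open>auto intro!: continuous_intros\<close>)
  have cE: "continuous_on (T \<times> ?S) (\<lambda>q. E (fst q) (snd q))"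
    and cE': "continuous_on (T \<times> ?S) (\<lambda>q. E' (fst q) (snd q))" if "T \<subseteq> ?P" for T
    unfolding E_def E'_def by (intro continuous_intros cp c that)+
  have E0: "E 0 \<xi> = 3 * (\<xi> - \<xi>0)" "E' 0 \<xi> = 3" for \<xi> using 0 by (simp_all add: E_def E'_def \<xi>0_def)
  obtain e where e: "e > 0" "ball 0 e \<subseteq> ?P"
    "\<And>p \<xi>. p \<in> ball 0 e \<Longrightarrow> \<xi> \<in> ?S \<Longrightarrow> E p \<xi> \<noteq> 0"
    "\<And>p. p \<in> ball 0 e \<Longrightarrow> finite {\<xi> \<in> ball \<xi>0 1. E p \<xi> = 0}"
    "\<And>p. p \<in> ball 0 e \<Longrightarrow> (\<Sum>\<xi> | \<xi> \<in> ball \<xi>0 1 \<and> E p \<xi> = 0. zorder (E p) \<xi>) = zorder (E 0) \<xi>0"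
  proof (rule zero_count_stable[of ?P 0 \<xi>0 1 E 2])
    show "open ?P" "0 \<in> ?P" using pos by (auto simp: zero_prod_def intro: open_Times)
    show "continuous_on (?P \<times> ?S) (\<lambda>(p, \<xi>). E p \<xi>)"
      using cE[of ?P] by (simp add: case_prod_beta')
    show "E p holomorphic_on ball \<xi>0 2" for p by (rule hE)
    show "(0::real) < 1" "(1::real) < 2" by simp_all
    show "E 0 \<xi> \<noteq> 0" if "\<xi> \<in> cball \<xi>0 1 - {\<xi>0}" for \<xi> using that by (simp add: E0)
    show "E 0 \<xi>0 = 0" by (simp add: E0)
  qed (rule that)
  have ord1: "zorder (E 0) \<xi>0 = 1"
    by (rule zorder_simple[OF hE open_UNIV]) (simp_all add: E0 deriv_E)
  define \<phi> where "\<phi> p = 1 / (2 * of_real pi * \<i>) *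
      contour_integral (circlepath \<xi>0 1) (\<lambda>\<xi>. E' p \<xi> * \<xi> / E p \<xi>)" for p
  have root: "E p (\<phi> p) = 0" if p: "p \<in> ball 0 e" for p
  proof -
    let ?Z = "{\<xi>. \<xi> \<in> ball \<xi>0 1 \<and> E p \<xi> = 0}"
    have S: "\<xi>0 + 1 \<in> ?S" "\<xi>0 + 1 \<in> ball \<xi>0 2" by (simp_all add: dist_norm)
    have pos: "1 \<le> zorder (E p) \<xi>" if "\<xi> \<in> ?Z" for \<xi>
      by (rule zorder_pos_at_zero[OF hE _ S(2) e(3)[OF p S(1)]]) (use that in auto)
    obtain \<xi> where \<xi>: "?Z = {\<xi>}" "zorder (E p) \<xi> = 1"
      by (rule sum_eq_1_ge_1[of ?Z "zorder (E p)"]) (use e(4,5)[OF p] pos ord1 in simp_all)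
    have "contour_integral (circlepath \<xi>0 1) (\<lambda>x. deriv (E p) x * x / E p x) =
      2 * of_real pi * \<i> * (\<Sum>\<xi>\<in>?Z. \<xi> * of_int (zorder (E p) \<xi>))"
      by (rule argument_principle_circle(2)[where R = 2 and h = "\<lambda>x. x"])
        (use e(3)[OF p] in \<open>auto intro: hE holomorphic_intros\<close>)
    then have "\<phi> p = \<xi>" unfolding \<phi>_def deriv_E \<xi>(1) by (simp add: \<xi>(2))
    then show ?thesis using \<xi>(1) by auto
  qed
  define s where "s = min (e / 2) (min \<delta> \<rho>)"
  have s: "s > 0" "s \<le> \<delta>" "s \<le> \<rho>" using e(1) pos by (auto simp: s_def)
  let ?D = "ball (0::complex) s"
  have sub: "?D \<times> ?D \<subseteq> ball 0 e"
  proof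
    fix p assume p: "p \<in> ?D \<times> ?D"
    have "norm p \<le> norm (fst p) + norm (snd p)" using norm_Pair_le[of "fst p" "snd p"] by simp
    also have "\<dots> < e" using p by (auto simp: s_def)
    finally show "p \<in> ball 0 e" by simp
  qed
  have sub': "?D \<times> ?D \<subseteq> ?P" using s by auto
  have hol: "holomorphic2_on \<phi> (?D \<times> ?D)"
  proof (rule separately_holomorphic_onI)
    have nz: "E (fst q) (snd q) \<noteq> 0" if "q \<in> (?D \<times> ?D) \<times> ?S" for q
    proof (rule e(3))
      have "fst q \<in> ?D \<times> ?D" using that by (rule mem_Times_iff[THEN iffD1, THEN conjunct1])
      then show "fst q \<in> ball 0 e" using sub by (rule rev_subsetD)
      show "snd q \<in> ?S" using that by (rule mem_Times_iff[THEN iffD1, THEN conjunct2])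
    qed
    have cq: "continuous_on ((?D \<times> ?D) \<times> ?S) (\<lambda>q. E' (fst q) (snd q) * snd q / E (fst q) (snd q))"
      by (intro continuous_intros cE cE' sub' ballI nz)
    show "continuous_on (?D \<times> ?D) \<phi>"
      unfolding \<phi>_def
      by (rule continuous_on_mult[OF continuous_on_const], rule continuous_on_circle_integral_param)
        (use cq in \<open>simp_all add: case_prod_beta'\<close>)
    have aD: "holomorphic2_on a0 (?D \<times> ?D)" "holomorphic2_on a2 (?D \<times> ?D)" "holomorphic2_on a3 (?D \<times> ?D)"
      by (rule holomorphic2_on_subset[OF a(1) sub'], rule holomorphic2_on_subset[OF a(2) sub'],
          rule holomorphic2_on_subset[OF a(3) sub'])
    fix w assume w: "w \<in> ?D"
    show "(\<lambda>z. \<phi> (z, w)) holomorphic_on ?D"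
      unfolding \<phi>_def
    proof (rule holomorphic_on_mult[OF holomorphic_on_const], rule holomorphic_circle_integral_param)
      have "continuous_on (?D \<times> ?S) (\<lambda>q. (\<lambda>q. E' (fst q) (snd q) * snd q / E (fst q) (snd q)) ((fst q, w), snd q))"
        by (rule continuous_on_compose2[OF cq]) (use w in \<open>auto intro!: continuous_intros\<close>)
      then show "continuous_on (?D \<times> ?S) (\<lambda>(z, \<xi>). E' (z, w) \<xi> * \<xi> / E (z, w) \<xi>)"
        by (simp add: case_prod_beta')
      fix \<xi> assume \<xi>: "\<xi> \<in> ?S"
      have az: "(\<lambda>z. a0 (z, w)) holomorphic_on ?D" "(\<lambda>z. a2 (z, w)) holomorphic_on ?D"
        "(\<lambda>z. a3 (z, w)) holomorphic_on ?D"
        using aD w by (auto intro!: holomorphic2_on_slices(1))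
      show "(\<lambda>z. E' (z, w) \<xi> * \<xi> / E (z, w) \<xi>) holomorphic_on ?D"
        unfolding E_def E'_def
        by (intro holomorphic_intros az) (use nz[of "((_, w), \<xi>)"] w \<xi> in \<open>simp add: E_def\<close>)
    qed simp_all
  next
    have nz: "E (z, w) \<xi> \<noteq> 0" if "z \<in> ?D" "w \<in> ?D" "\<xi> \<in> ?S" for z w \<xi>
    proof (rule e(3))
      have "(z, w) \<in> ?D \<times> ?D" using that by (intro SigmaI)
      then show "(z, w) \<in> ball 0 e" using sub by (rule rev_subsetD)
    qed (rule that)
    have cq: "continuous_on ((?D \<times> ?D) \<times> ?S) (\<lambda>q. E' (fst q) (snd q) * snd q / E (fst q) (snd q))"
    proof (intro continuous_intros cE cE' sub' ballI)
      fix q assume "q \<in> (?D \<times> ?D) \<times> ?S"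
      then show "E (fst q) (snd q) \<noteq> 0" using nz[of "fst (fst q)" "snd (fst q)" "snd q"] by (auto simp: mem_Times_iff)
    qed
    have aD: "holomorphic2_on a0 (?D \<times> ?D)" "holomorphic2_on a2 (?D \<times> ?D)" "holomorphic2_on a3 (?D \<times> ?D)"
      by (rule holomorphic2_on_subset[OF a(1) sub'], rule holomorphic2_on_subset[OF a(2) sub'],
          rule holomorphic2_on_subset[OF a(3) sub'])
    fix z assume z: "z \<in> ?D"
    show "(\<lambda>w. \<phi> (z, w)) holomorphic_on ?D"
      unfolding \<phi>_def
    proof (rule holomorphic_on_mult[OF holomorphic_on_const], rule holomorphic_circle_integral_param)
      have "continuous_on (?D \<times> ?S) (\<lambda>q. (\<lambda>q. E' (fst q) (snd q) * snd q / E (fst q) (snd q)) ((z, fst q), snd q))"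
        by (rule continuous_on_compose2[OF cq]) (use z in \<open>auto intro!: continuous_intros\<close>)
      then show "continuous_on (?D \<times> ?S) (\<lambda>(w, \<xi>). E' (z, w) \<xi> * \<xi> / E (z, w) \<xi>)"
        by (simp add: case_prod_beta')
      fix \<xi> assume \<xi>: "\<xi> \<in> ?S"
      have az: "(\<lambda>w. a0 (z, w)) holomorphic_on ?D" "(\<lambda>w. a2 (z, w)) holomorphic_on ?D"
        "(\<lambda>w. a3 (z, w)) holomorphic_on ?D"
        using aD z by (auto intro!: holomorphic2_on_slices(2))
      show "(\<lambda>w. E' (z, w) \<xi> * \<xi> / E (z, w) \<xi>) holomorphic_on ?D"
        unfolding E_def E'_def
        by (intro holomorphic_intros az) (use nz[OF z _ \<xi>] in \<open>simp add: E_def\<close>)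
    qed simp_all
  qed simp_all
  have "a0 p + 3 * \<phi> p + a2 p * \<phi> p ^ 2 + a3 p * \<phi> p ^ 3 = 0" if "p \<in> ?D \<times> ?D" for p
    using root[OF subsetD[OF sub that]] by (simp add: E_def)
  then show ?thesis using that[OF s hol] by blast
qed

text \<open>If \<open>d\<close> has order \<open>n > 0\<close>, take \<open>z\<close> times an \<open>n\<close>-th root of the unit
  \<open>3 d z / (n z^n)\<close>.  If \<open>d\<close> vanishes identically, \<open>n = 0\<close> and any coordinate will do.\<close>

lemma root_of_order_germ:
  fixes d :: "complex \<Rightarrow> complex"
  assumes d: "d holomorphic_on ball 0 \<delta>" and \<delta>: "\<delta> > 0" and d0: "d 0 = 0"
  obtains n :: nat and \<zeta> s where "s > 0" "\<zeta> holomorphic_on ball 0 s" "\<zeta> 0 = 0" "deriv \<zeta> 0 \<noteq> 0"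
    "\<And>z. z \<in> ball 0 s \<Longrightarrow> 3 * d z = of_nat n * \<zeta> z ^ n"
proof (cases "\<exists>w\<in>ball 0 \<delta>. d w \<noteq> 0")
  case False
  show ?thesis by (rule that[of \<delta> "\<lambda>z. z" 0]) (use False \<delta> in auto)
next
  case True
  then obtain w where w: "w \<in> ball 0 \<delta>" "d w \<noteq> 0" by blast
  have z: "0 \<in> ball 0 \<delta>" using \<delta> by simp
  obtain n g t where n: "(n > 0) = (d 0 = 0)" "t > 0" "g holomorphic_on cball 0 t"
    and g: "\<And>w. w \<in> cball 0 t \<Longrightarrow> d w = g w * (w - 0) ^ n" "\<And>w. w \<in> cball 0 t \<Longrightarrow> g w \<noteq> 0"
    using zorder_factorization[OF d z w] by metis
  have n0: "n > 0" using n(1) d0 by simp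
  have g0: "g 0 \<noteq> 0" using g(2)[of 0] n(2) by simp
  have "((\<lambda>w. Re (g w / g 0)) \<longlongrightarrow> Re (g 0 / g 0)) (at 0)"
    using isCont_if_holomorphic_on_cball[OF n(3,2)] g0 unfolding isCont_def
    by (intro tendsto_intros)
  moreover have "0 < Re (g 0 / g 0)" using g0 by simp
  ultimately have "\<forall>\<^sub>F w in at 0. 0 < Re (g w / g 0)" by (rule order_tendstoD(1))
  then obtain s1 where s1: "s1 > 0" "\<And>w. w \<noteq> 0 \<Longrightarrow> dist w 0 < s1 \<Longrightarrow> Re (g w / g 0) > 0"
    unfolding eventually_at by auto
  define s where "s = min s1 t"
  have s: "s > 0" using s1 n(2) by (simp add: s_def)
  have re: "Re (g w / g 0) > 0" if "w \<in> ball 0 s" for w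
    using s1(2)[of w] that g0 by (cases "w = 0") (auto simp: s_def)
  have gs: "g holomorphic_on ball 0 s"
    by (rule holomorphic_on_subset[OF n(3)]) (auto simp: s_def)
  define c where "c = exp (Ln (3 * g 0 / of_nat n) / of_nat n)"
  have c: "c ^ n = 3 * g 0 / of_nat n"
  proof -
    have "c ^ n = exp (of_nat n * (Ln (3 * g 0 / of_nat n) / of_nat n))"
      unfolding c_def by (rule exp_of_nat_mult[symmetric])
    also have "\<dots> = 3 * g 0 / of_nat n" using n0 g0 by simp
    finally show ?thesis .
  qed
  define \<kappa> where "\<kappa> w = c * exp (Ln (g w / g 0) / of_nat n)" for w
  have \<kappa>: "\<kappa> holomorphic_on ball 0 s"
    unfolding \<kappa>_def using re g0 n0
    by (intro holomorphic_intros gs) (auto intro!: Re_pos_imp_not_nonpos_Reals)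
  have \<kappa>n: "\<kappa> w ^ n = 3 * g w / of_nat n" if "w \<in> ball 0 s" for w
  proof -
    have "g w / g 0 \<noteq> 0" using re[OF that] by auto
    have "exp (Ln (g w / g 0) / of_nat n) ^ n = exp (of_nat n * (Ln (g w / g 0) / of_nat n))"
      by (rule exp_of_nat_mult[symmetric])
    also have "\<dots> = g w / g 0" using n0 \<open>g w / g 0 \<noteq> 0\<close> by simp
    finally show ?thesis unfolding \<kappa>_def power_mult_distrib c using g0 by simp
  qed
  have \<kappa>0: "\<kappa> 0 \<noteq> 0" by (simp add: \<kappa>_def c_def)
  show ?thesis
  proof (rule that[of s "\<lambda>z. z * \<kappa> z" n])
    show "(\<lambda>z. z * \<kappa> z) holomorphic_on ball 0 s" by (intro holomorphic_intros \<kappa>)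
    have "(\<kappa> has_field_derivative deriv \<kappa> 0) (at 0)"
      using holomorphic_derivI[OF \<kappa>] s by simp
    then have "((\<lambda>z. z * \<kappa> z) has_field_derivative \<kappa> 0) (at 0)"
      by (auto intro!: derivative_eq_intros)
    then show "deriv (\<lambda>z. z * \<kappa> z) 0 \<noteq> 0" using \<kappa>0 DERIV_imp_deriv by metis
    fix z :: complex assume z: "z \<in> ball 0 s"
    have "d z = g z * z ^ n" using g(1)[of z] z by (simp add: s_def)
    then show "3 * d z = of_nat n * (z * \<kappa> z) ^ n"
      using \<kappa>n[OF z] n0 by (simp add: power_mult_distrib)
  qed (use s in simp_all)
qed

section \<open>The normal form in coordinates\<close>

lemma zorder_deriv:
  fixes f :: "complex \<Rightarrow> complex"
  assumes f: "f holomorphic_on ball 0 R" and R: "R > 0" and w: "w \<in> ball 0 R" "f w \<noteq> 0"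
    and ord: "zorder f 0 = int (Suc m)"
  obtains s where "s > 0" "s \<le> R" "\<And>w. w \<in> ball 0 s - {0} \<Longrightarrow> deriv f w \<noteq> 0" "zorder (deriv f) 0 = int m"
    "m > 0 \<Longrightarrow> deriv f 0 = 0"
proof -
  have z: "0 \<in> ball 0 R" using R by simp
  obtain n g t where n: "zorder f 0 = int n" "(n > 0) = (f 0 = 0)" "t > 0" "cball 0 t \<subseteq> ball (0::complex) R"
      "g holomorphic_on cball 0 t"
    and g: "\<And>w. w \<in> cball 0 t \<Longrightarrow> f w = g w * (w - 0) ^ n" "\<And>w. w \<in> cball 0 t \<Longrightarrow> g w \<noteq> 0"
    by (rule zorder_factorization[OF f z w]) (rule that)
  have nm: "n = Suc m" using n(1) ord by simp
  have gt: "g holomorphic_on ball 0 t" by (rule holomorphic_on_subset[OF n(5)]) auto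
  define q where "q w = of_nat (Suc m) * g w + w * deriv g w" for w
  have q: "q holomorphic_on ball 0 t"
    unfolding q_def by (intro holomorphic_intros gt holomorphic_deriv) auto
  have df: "deriv f w = q w * w ^ m" if w: "w \<in> ball 0 t" for w
  proof -
    have "(g has_field_derivative deriv g w) (at w)" using holomorphic_derivI[OF gt _ w] by simp
    moreover have "((\<lambda>w. w ^ Suc m) has_field_derivative of_nat (Suc m) * w ^ m) (at w)"
      using DERIV_power[OF DERIV_ident, where n = "Suc m"] by (simp del: power_Suc of_nat_Suc)
    ultimately have "((\<lambda>w. g w * w ^ Suc m) has_field_derivative
        deriv g w * w ^ Suc m + of_nat (Suc m) * w ^ m * g w) (at w)"
      by (rule DERIV_mult)
    also have "deriv g w * w ^ Suc m + of_nat (Suc m) * w ^ m * g w = q w * w ^ m"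
      by (simp add: q_def algebra_simps)
    finally have "((\<lambda>w. g w * w ^ Suc m) has_field_derivative q w * w ^ m) (at w)" .
    then have "(f has_field_derivative q w * w ^ m) (at w)"
      by (rule has_field_derivative_transform_within_open[of _ _ _ "ball 0 t"])
        (use w g(1) nm in auto)
    then show ?thesis by (rule DERIV_imp_deriv)
  qed
  have q0: "q 0 \<noteq> 0" using g(2)[of 0] n(3) by (simp add: q_def del: of_nat_Suc)
  have "isCont q 0"
    using holomorphic_on_imp_continuous_on[OF q] n(3) by (simp add: continuous_on_eq_continuous_at)
  then obtain s1 where s1: "s1 > 0" "\<And>w. dist 0 w < s1 \<Longrightarrow> q w \<noteq> 0"
    using continuous_at_avoid[of 0 q 0] q0 by auto
  define s where "s = min s1 t"
  have s: "s > 0" "s \<le> s1" "s \<le> t" using s1 n(3) by (auto simp: s_def)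
  have "t \<le> R"
  proof (rule ccontr)
    assume "\<not> t \<le> R"
    then have "of_real R \<in> cball (0::complex) t" using R by simp
    then have "of_real R \<in> ball (0::complex) R" using n(4) by blast
    then show False using R by simp
  qed
  show ?thesis
  proof (rule that[of s])
    show "deriv f w \<noteq> 0" if "w \<in> ball 0 s - {0}" for w
      using df[of w] s1(2)[of w] that s by auto
    show "zorder (deriv f) 0 = int m"
      by (rule zorder_eqI[of "ball 0 t" 0 q]) (use n(3) q q0 df in auto)
    show "deriv f 0 = 0" if "m > 0" using df[of 0] that n(3) by simp
  qed (use s \<open>t \<le> R\<close> in auto)
qed

lemma holomorphic_close_to_value_at_0:
  fixes c :: "complex \<Rightarrow> complex"
  assumes "c holomorphic_on ball 0 \<delta>" "\<delta> > 0" "\<epsilon> > 0"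
  obtains \<delta>' where "\<delta>' > 0" "\<delta>' \<le> \<delta>" "\<And>z. z \<in> ball 0 \<delta>' \<Longrightarrow> norm (c z - c 0) < \<epsilon>"
proof -
  have "isCont c 0"
    using holomorphic_on_imp_continuous_on[OF assms(1)] assms(2) by (simp add: continuous_on_eq_continuous_at)
  then obtain s where "s > 0" "\<And>z. dist z 0 < s \<Longrightarrow> dist (c z) (c 0) < \<epsilon>"
    unfolding continuous_at_eps_delta using assms(3) by blast
  then show ?thesis using assms(2) by (intro that[of "min s \<delta>"]) (auto simp: dist_norm)
qed

text \<open>Two divisions by \<open>w^2 - d\<close> give remainders \<open>A + B w\<close> and \<open>A1 + B1 w\<close>.  The derivative at a
  root \<open>s\<close> of \<open>w^2 = d\<close> is \<open>B + 2 s (A1 + B1 s)\<close>.  If it vanishes for \<open>s\<close> and \<open>- s\<close>, then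
  \<open>B = - 2 B1 d\<close> and \<open>s A1 = 0\<close>; in the degenerate case \<open>s = 0\<close> the second derivative
  \<open>2 A1\<close> replaces the second equation.\<close>

lemma remainders_at_critical_points:
  fixes G Q :: "complex \<Rightarrow> complex"
  assumes G: "\<And>w. w \<in> ball 0 r \<Longrightarrow> G w = A + B * w + (w ^ 2 - d) * Q w"
    and Q: "Q holomorphic_on ball 0 r" and d: "norm d < r ^ 2" and r: "r > 0"
    and Qs: "\<And>s. s ^ 2 = d \<Longrightarrow> Q s = A1 + B1 * s"
    and crit: "\<And>s. s ^ 2 = d \<Longrightarrow> deriv G s = 0" "d = 0 \<Longrightarrow> deriv (deriv G) 0 = 0"
  shows "A1 = 0" "B = - 2 * B1 * d"
proof -
  define G' where "G' w = B + 2 * w * Q w + (w ^ 2 - d) * deriv Q w" for w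
  have dQ: "(Q has_field_derivative deriv Q w) (at w)" if "w \<in> ball 0 r" for w
    using holomorphic_derivI[OF Q _ that] by simp
  have dG: "deriv G w = G' w" if w: "w \<in> ball 0 r" for w
  proof -
    have "((\<lambda>w. A + B * w + (w ^ 2 - d) * Q w) has_field_derivative G' w) (at w)"
      unfolding G'_def by (auto intro!: derivative_eq_intros dQ[OF w] simp: algebra_simps)
    then have "(G has_field_derivative G' w) (at w)"
      by (rule has_field_derivative_transform_within_open[of _ _ _ "ball 0 r"]) (use w G in auto)
    then show ?thesis by (rule DERIV_imp_deriv)
  qed
  have in_ball: "s \<in> ball 0 r" if "s ^ 2 = d" for s
  proof -
    have "norm s ^ 2 < r ^ 2" using d that by (simp flip: norm_power)
    then show ?thesis using r power_less_imp_less_base[of "norm s" 2 r] by simp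
  qed
  have eq: "B + 2 * s * (A1 + B1 * s) = 0" if s: "s ^ 2 = d" for s
    using crit(1)[OF s] dG[OF in_ball[OF s]] Qs[OF s] s by (simp add: G'_def)
  define s where "s = csqrt d"
  have s: "s ^ 2 = d" by (simp add: s_def)
  have e1: "B + 2 * s * (A1 + B1 * s) = 0" by (rule eq[OF s])
  have e2: "B + 2 * (- s) * (A1 + B1 * (- s)) = 0" by (rule eq) (simp add: s)
  have sA1: "s * A1 = 0" using e1 e2 by algebra
  have "B = - 2 * B1 * s ^ 2" using e1 e2 by algebra
  then have B: "B = - 2 * B1 * d" unfolding s .
  show "B = - 2 * B1 * d" by (rule B)
  show "A1 = 0"
  proof (cases "s = 0")
    case False
    then show ?thesis using sA1 by simp
  next
    case True
    then have d0: "d = 0" using s by simp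
    have z: "0 \<in> ball 0 r" using r by simp
    have "(deriv Q has_field_derivative deriv (deriv Q) 0) (at 0)"
      using holomorphic_derivI[OF holomorphic_deriv[OF Q open_ball] open_ball z] by simp
    then have "(G' has_field_derivative 2 * Q 0) (at 0)"
      unfolding G'_def d0 by (auto intro!: derivative_eq_intros dQ[OF z])
    then have "(deriv G has_field_derivative 2 * Q 0) (at 0)"
      by (rule has_field_derivative_transform_within_open[of _ _ _ "ball 0 r"]) (use z dG in auto)
    then have "2 * Q 0 = 0" using crit(2)[OF d0] DERIV_imp_deriv by force
    then show ?thesis using Qs[of 0] d0 by simp
  qed
qed

lemma shear_holomorphic2:
  assumes "c holomorphic_on ball 0 \<delta>"
  shows "holomorphic2_on (\<lambda>p. c (fst p)) (ball 0 \<delta> \<times> E)"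
  by (rule holomorphic2_on_compose_fst[OF assms]) auto

text \<open>The one-parameter version of the versality of \<open>w^3 + a w + b\<close>, with explicit coordinates:
  \<open>A\<close>, \<open>b\<close> come from the remainders of the two divisions, \<open>\<zeta>\<close> from the order of \<open>d\<close>, and \<open>W\<close>
  from the root of the cubic equation for the correction term.\<close>

lemma cusp_normal_form:
  assumes g: "holomorphic2_on g (ball 0 R \<times> ball 0 R)" and R: "R > 0" and g0: "g (0, 0) = 0"
    and nz: "w0 \<in> ball 0 R" "g (0, w0) \<noteq> 0" and ord: "zorder (\<lambda>w. g (0, w)) 0 = 3"
  obtains n :: nat and \<zeta> A b W N where
    "biholomorphic_germ (\<lambda>x. (\<zeta> (fst x), W x))"
    "biholomorphic_germ (\<lambda>y. (\<zeta> (fst y), (snd y - A (fst y)) / b (fst y)))"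
    "open N" "0 \<in> N"
    "\<And>x. x \<in> N \<Longrightarrow> (g x - A (fst x)) / b (fst x) = W x ^ 3 - of_nat n * \<zeta> (fst x) ^ n * W x"
proof -
  have g0w: "(\<lambda>w. g (0, w)) holomorphic_on ball 0 R"
    by (rule holomorphic2_on_slices(2)[OF g]) (use R in auto)
  have ord': "zorder (\<lambda>w. g (0, w)) 0 = int (Suc 2)" using ord by simp
  obtain s0 where s0: "s0 > 0" "s0 \<le> R" "\<And>w. w \<in> ball 0 s0 - {0} \<Longrightarrow> deriv (\<lambda>w. g (0, w)) w \<noteq> 0"
    "zorder (deriv (\<lambda>w. g (0, w))) 0 = int 2" "(2::nat) > 0 \<Longrightarrow> deriv (\<lambda>w. g (0, w)) 0 = 0"
    by (rule zorder_deriv[OF g0w R nz ord']) (rule that)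
  have opR: "open (ball (0::complex) R \<times> ball (0::complex) R)" by (intro open_Times) auto
  have d2g: "(\<lambda>w. d2 g (z, w)) = deriv (\<lambda>w. g (z, w))" for z by (simp add: d2_def fun_eq_iff)
  have F: "holomorphic2_on (d2 g) (ball 0 s0 \<times> ball 0 s0)"
    by (rule holomorphic2_on_subset[OF holomorphic2_on_d2[OF opR g]]) (use s0(2) in auto)
  obtain \<delta> c d where \<delta>: "\<delta> > 0" "\<delta> \<le> s0" and c: "c holomorphic_on ball 0 \<delta>" and d: "d holomorphic_on ball 0 \<delta>"
    and cd0: "c 0 = 0" "d 0 = 0"
    and crit: "\<And>z s. z \<in> ball 0 \<delta> \<Longrightarrow> s ^ 2 = d z \<Longrightarrow> c z + s \<in> ball 0 s0 \<and> d2 g (z, c z + s) = 0 \<and>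
       (s = 0 \<longrightarrow> deriv (\<lambda>w. d2 g (z, w)) (c z) = 0)"
  proof (rule quadratic_roots_germ[OF F s0(1)])
    show "d2 g (0, 0) = 0" using s0(5) by (simp add: d2_def)
    show "d2 g (0, w) \<noteq> 0" if "w \<in> ball 0 s0 - {0}" for w using s0(3)[OF that] by (simp add: d2_def)
    show "zorder (\<lambda>w. d2 g (0, w)) 0 = 2" unfolding d2g using s0(4) by simp
  qed (rule that)
  define \<rho> r1 r2 where "\<rho> = s0 / 2" and "r1 = s0 / 4" and "r2 = s0 / 8"
  have rs: "0 < r2" "r2 < r1" "r1 < \<rho>" "0 < r1" "0 < \<rho>" using s0(1) by (auto simp: \<rho>_def r1_def r2_def)
  obtain \<delta>a where \<delta>a: "\<delta>a > 0" "\<delta>a \<le> \<delta>" "\<And>z. z \<in> ball 0 \<delta>a \<Longrightarrow> norm (c z - c 0) < \<rho>"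
    by (rule holomorphic_close_to_value_at_0[OF c \<delta>(1) rs(5)]) (rule that)
  have r2sq: "r2 ^ 2 > 0" using rs(1) by simp
  obtain \<delta>b where \<delta>b: "\<delta>b > 0" "\<delta>b \<le> \<delta>" "\<And>z. z \<in> ball 0 \<delta>b \<Longrightarrow> norm (d z - d 0) < r2 ^ 2"
    by (rule holomorphic_close_to_value_at_0[OF d \<delta>(1) r2sq]) (rule that)
  define \<delta>1 where "\<delta>1 = min \<delta>a \<delta>b"
  have \<delta>1: "\<delta>1 > 0" "\<delta>1 \<le> \<delta>" using \<delta>a \<delta>b by (auto simp: \<delta>1_def)
  let ?D = "ball (0::complex) \<delta>1"
  have c_small: "norm (c z) < \<rho>" and d_small: "norm (d z) < r2 ^ 2" if "z \<in> ?D" for z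
    using \<delta>a(3)[of z] \<delta>b(3)[of z] that cd0 by (auto simp: \<delta>1_def)
  have d_small1: "norm (d z) < r1 ^ 2" if "z \<in> ?D" for z
    using d_small[OF that] power_strict_mono[of r2 r1 2] rs by simp
  have c1: "c holomorphic_on ?D" and d1: "d holomorphic_on ?D"
    using c d holomorphic_on_subset[of _ "ball 0 \<delta>" ?D] \<delta>1(2) by auto
  \<comment> \<open>Translate the two critical points to symmetric positions.\<close>
  define gt where "gt p = g (fst p, snd p + c (fst p))" for p
  have in_s0: "w + c z \<in> ball 0 s0" if "z \<in> ?D" "w \<in> ball 0 \<rho>" for z w
    using norm_triangle_ineq[of w "c z"] c_small[OF that(1)] that(2) by (simp add: \<rho>_def)
  have in_R: "(z, w + c z) \<in> ball 0 R \<times> ball 0 R" if "z \<in> ?D" "w \<in> ball 0 \<rho>" for z w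
    using in_s0[OF that] that(1) \<delta>1(2) \<delta>(2) s0(2) by auto
  have gt: "holomorphic2_on gt (?D \<times> ball 0 \<rho>)"
    unfolding gt_def
    by (rule holomorphic2_on_compose2[OF holomorphic2_on_fst _ g])
      (use in_R in \<open>auto intro!: holomorphic2_on_add holomorphic2_on_snd shear_holomorphic2 c1\<close>)
  obtain A B Q1 where A: "A holomorphic_on ?D" and B: "B holomorphic_on ?D"
    and Q1: "holomorphic2_on Q1 (?D \<times> ball 0 r1)"
    and div1: "\<And>z w. z \<in> ?D \<Longrightarrow> w \<in> ball 0 r1 \<Longrightarrow> gt (z, w) = A z + B z * w + (w ^ 2 - d z) * Q1 (z, w)"
    by (rule division_by_quadratic[OF gt d1 rs(4,3) d_small1]) (assumption, rule that)
  obtain A1 b Q2 where A1: "A1 holomorphic_on ?D" and b: "b holomorphic_on ?D"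
    and Q2: "holomorphic2_on Q2 (?D \<times> ball 0 r2)"
    and div2: "\<And>z w. z \<in> ?D \<Longrightarrow> w \<in> ball 0 r2 \<Longrightarrow> Q1 (z, w) = A1 z + b z * w + (w ^ 2 - d z) * Q2 (z, w)"
    by (rule division_by_quadratic[OF Q1 d1 rs(1,2) d_small]) (assumption, rule that)
  have rem: "A1 z = 0" "B z = - 2 * b z * d z" if z: "z \<in> ?D" for z
  proof -
    have z\<delta>: "z \<in> ball 0 \<delta>" "z \<in> ball 0 R" using z \<delta>1(2) \<delta>(2) s0(2) by auto
    have dG: "deriv (\<lambda>w. gt (z, w)) w = d2 g (z, w + c z)" if w: "w \<in> ball 0 \<rho>" for w
    proof -
      have "(\<lambda>w. g (z, w)) holomorphic_on ball 0 R"
        by (rule holomorphic2_on_slices(2)[OF g]) (use z\<delta> in auto)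
      from holomorphic_derivI[OF this open_ball, of "w + c z"] in_R[OF z w]
      have "((\<lambda>w. g (z, w)) has_field_derivative d2 g (z, w + c z)) (at (w + c z))"
        by (simp add: d2_def)
      then have "((\<lambda>w. g (z, w + c z)) has_field_derivative d2 g (z, w + c z)) (at w)"
        by (simp add: DERIV_shift)
      then show ?thesis by (simp add: gt_def DERIV_imp_deriv)
    qed
    have sq: "s \<in> ball 0 r2" if "s ^ 2 = d z" for s
    proof -
      have "norm s ^ 2 < r2 ^ 2" using d_small[OF z] that by (simp flip: norm_power)
      then show ?thesis using rs(1) power_less_imp_less_base[of "norm s" 2 r2] by simp
    qed
    have *: "A1 z = 0 \<and> B z = - 2 * b z * d z"
    proof (intro conjI; rule remainders_at_critical_points[of r1 "\<lambda>w. gt (z, w)" "A z" "B z" "d z" "\<lambda>w. Q1 (z, w)"])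
      show "gt (z, w) = A z + B z * w + (w ^ 2 - d z) * Q1 (z, w)" if "w \<in> ball 0 r1" for w
        by (rule div1[OF z that])
      then show "gt (z, w) = A z + B z * w + (w ^ 2 - d z) * Q1 (z, w)" if "w \<in> ball 0 r1" for w
        using that .
      show "(\<lambda>w. Q1 (z, w)) holomorphic_on ball 0 r1"
        by (rule holomorphic2_on_slices(2)[OF Q1]) (use z in auto)
      then show "(\<lambda>w. Q1 (z, w)) holomorphic_on ball 0 r1" .
      show "norm (d z) < r1 ^ 2" by (rule d_small1[OF z])
      then show "norm (d z) < r1 ^ 2" .
      show "r1 > 0" by (rule rs)
      then show "r1 > 0" .
      show 1: "Q1 (z, s) = A1 z + b z * s" if "s ^ 2 = d z" for s
        using div2[OF z sq[OF that]] that by simp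
      show "Q1 (z, s) = A1 z + b z * s" if "s ^ 2 = d z" for s by (rule 1[OF that])
      show 2: "deriv (\<lambda>w. gt (z, w)) s = 0" if "s ^ 2 = d z" for s
        using dG[of s] sq[OF that] crit[OF z\<delta>(1) that] rs by (simp add: add.commute)
      show "deriv (\<lambda>w. gt (z, w)) s = 0" if "s ^ 2 = d z" for s by (rule 2[OF that])
      show 3: "deriv (deriv (\<lambda>w. gt (z, w))) 0 = 0" if dz: "d z = 0"
      proof -
        have "c z + 0 \<in> ball 0 s0 \<and> d2 g (z, c z + 0) = 0 \<and> ((0::complex) = 0 \<longrightarrow> deriv (\<lambda>w. d2 g (z, w)) (c z) = 0)"
          by (rule crit[OF z\<delta>(1)]) (simp add: dz)
        then have cz: "c z \<in> ball 0 s0" "deriv (\<lambda>w. d2 g (z, w)) (c z) = 0" by simp_all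
        have "(\<lambda>w. d2 g (z, w)) holomorphic_on ball 0 s0"
          by (rule holomorphic2_on_slices(2)[OF F]) (use z\<delta>(1) \<delta>(2) in auto)
        from holomorphic_derivI[OF this open_ball cz(1)]
        have "((\<lambda>w. d2 g (z, w)) has_field_derivative 0) (at (0 + c z))" using cz(2) by simp
        then have "((\<lambda>w. d2 g (z, w + c z)) has_field_derivative 0) (at 0)"
          by (rule DERIV_shift[THEN iffD1])
        then have "(deriv (\<lambda>w. gt (z, w)) has_field_derivative 0) (at 0)"
          by (rule has_field_derivative_transform_within_open[of _ _ _ "ball 0 \<rho>"]) (use rs dG in auto)
        then show ?thesis by (rule DERIV_imp_deriv)
      qed
      show "deriv (deriv (\<lambda>w. gt (z, w))) 0 = 0" if "d z = 0" by (rule 3[OF that])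
    qed
    show "A1 z = 0" "B z = - 2 * b z * d z" using * by simp_all
  qed
  have gt_eq: "gt (z, w) = A z + b z * (w ^ 3 - 3 * d z * w) + (w ^ 2 - d z) ^ 2 * Q2 (z, w)"
    if z: "z \<in> ?D" and w: "w \<in> ball 0 r2" for z w
  proof -
    have "gt (z, w) = A z + B z * w + (w ^ 2 - d z) * (A1 z + b z * w + (w ^ 2 - d z) * Q2 (z, w))"
      using div1[OF z, of w] div2[OF z w] w rs by simp
    then show ?thesis unfolding rem[OF z] by (simp add: algebra_simps power2_eq_square power3_eq_cube)
  qed
  have z0: "0 \<in> ?D" using \<delta>1 by simp
  have A0: "A 0 = 0" using gt_eq[OF z0, of 0] rs(1) g0 cd0 by (simp add: gt_def)
  have b0: "b 0 \<noteq> 0"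
  proof
    assume b0: "b 0 = 0"
    have eq: "g (0, w) = w ^ 4 * Q2 (0, w)" if "w \<in> ball 0 r2" for w
      using gt_eq[OF z0 that] A0 b0 cd0 by (simp add: gt_def flip: power_mult)
    have "continuous_on (cball 0 (r2 / 2)) (\<lambda>w. Q2 (0, w))"
      by (rule continuous_on_compose2[OF holomorphic2_on_continuous[OF Q2]])
        (use z0 rs in \<open>auto intro!: continuous_intros\<close>)
    then have "bounded ((\<lambda>w. Q2 (0, w)) ` cball 0 (r2 / 2))"
      by (intro compact_imp_bounded compact_continuous_image) auto
    then obtain M where M: "\<forall>x\<in>(\<lambda>w. Q2 (0, w)) ` cball 0 (r2 / 2). norm x \<le> M"
      unfolding bounded_iff by blast
    have "int 4 \<le> zorder (\<lambda>w. g (0, w)) 0"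
    proof (rule zorder_ge_if_bounded[OF g0w _ nz, of _ "r2 / 2" M])
      fix w :: complex assume w: "w \<in> ball 0 (r2 / 2)"
      have "norm (Q2 (0, w)) \<le> M" using M w by simp
      moreover have "norm (g (0, w)) = norm w ^ 4 * norm (Q2 (0, w))"
        using eq[of w] w rs(1) by (simp add: norm_mult norm_power)
      ultimately show "norm (g (0, w)) \<le> M * norm (w - 0) ^ 4"
        by (simp add: mult.commute mult_right_mono)
    qed (use R rs in auto)
    then show False using ord by simp
  qed
  have nb0: "norm (b 0) > 0" using b0 by simp
  obtain \<delta>2 where \<delta>2: "\<delta>2 > 0" "\<delta>2 \<le> \<delta>1" "\<And>z. z \<in> ball 0 \<delta>2 \<Longrightarrow> norm (b z - b 0) < norm (b 0)"
    by (rule holomorphic_close_to_value_at_0[OF b \<delta>1(1) nb0]) (rule that)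
  have bnz: "b z \<noteq> 0" if "z \<in> ball 0 \<delta>2" for z using \<delta>2(3)[OF that] by auto
  let ?E = "ball (0::complex) \<delta>2"
  have DE: "?E \<subseteq> ?D" using \<delta>2(2) by auto
  have A2: "A holomorphic_on ?E" and b2: "b holomorphic_on ?E" and d2': "d holomorphic_on ?E" and c2: "c holomorphic_on ?E"
    using holomorphic_on_subset[OF _ DE] A b d1 c1 by auto
  have Q2E: "holomorphic2_on Q2 (?E \<times> ball 0 r2)"
    by (rule holomorphic2_on_subset[OF Q2]) (use DE in auto)
  obtain \<phi> e where e: "e > 0" "e \<le> \<delta>2" "e \<le> r2" and \<phi>: "holomorphic2_on \<phi> (ball 0 e \<times> ball 0 e)"
    and \<phi>_eq: "\<And>p. p \<in> ball 0 e \<times> ball 0 e \<Longrightarrow> - Q2 p / b (fst p) + 3 * \<phi> p + 3 * snd p * \<phi> p ^ 2 +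
        (snd p ^ 2 - d (fst p)) * \<phi> p ^ 3 = 0"
  proof (rule cubic_root_germ[of "\<lambda>p. - Q2 p / b (fst p)" \<delta>2 r2 "\<lambda>p. 3 * snd p" "\<lambda>p. snd p ^ 2 - d (fst p)"])
    show "holomorphic2_on (\<lambda>p. - Q2 p / b (fst p)) (?E \<times> ball 0 r2)"
      by (intro holomorphic2_on_divide holomorphic2_on_uminus Q2E shear_holomorphic2 b2) (use bnz in auto)
    show "holomorphic2_on (\<lambda>p. 3 * snd p) (?E \<times> ball 0 r2)" by (intro holomorphic2_intros)
    show "holomorphic2_on (\<lambda>p. snd p ^ 2 - d (fst p)) (?E \<times> ball 0 r2)"
      by (intro holomorphic2_on_diff holomorphic2_on_power holomorphic2_on_snd shear_holomorphic2 d2')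
  qed (use cd0 \<delta>2 rs that in \<open>simp_all\<close>)
  obtain n :: nat and \<zeta> s where \<zeta>: "s > 0" "\<zeta> holomorphic_on ball 0 s" "\<zeta> 0 = 0" "deriv \<zeta> 0 \<noteq> 0"
    "\<And>z. z \<in> ball 0 s \<Longrightarrow> 3 * d z = of_nat n * \<zeta> z ^ n"
    by (rule root_of_order_germ[OF d \<delta>(1) cd0(2)]) (rule that)
  define \<sigma> where "\<sigma> = min e s"
  have \<sigma>: "\<sigma> > 0" "\<sigma> \<le> e" "\<sigma> \<le> s" using e(1) \<zeta>(1) by (auto simp: \<sigma>_def)
  let ?\<tau> = "\<lambda>x. (fst x, snd x - c (fst x))"
  define N where "N = (ball (0::complex) \<sigma> \<times> (UNIV :: complex set)) \<inter> ?\<tau> -` (ball 0 \<sigma> \<times> ball 0 e)"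
  have c\<sigma>: "c holomorphic_on ball 0 \<sigma>"
    by (rule holomorphic_on_subset[OF c2]) (use \<sigma> e in auto)
  have N: "open N"
    unfolding N_def
  proof (rule continuous_open_preimage)
    have "continuous_on (ball 0 \<sigma> \<times> (UNIV :: complex set)) (\<lambda>x. c (fst x))"
      by (rule holomorphic2_on_continuous[OF shear_holomorphic2[OF c\<sigma>]])
    then show "continuous_on (ball 0 \<sigma> \<times> (UNIV :: complex set)) ?\<tau>" by (intro continuous_intros)
  qed (auto intro: open_Times)
  have N0: "0 \<in> N" using \<sigma>(1) e(1) cd0 by (simp add: N_def zero_prod_def)
  define W0 where "W0 p = snd p + (snd p ^ 2 - d (fst p)) * \<phi> p" for p
  define W where "W x = W0 (?\<tau> x)" for x
  have W0: "holomorphic2_on W0 (ball 0 \<sigma> \<times> ball 0 e)"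
    unfolding W0_def
    by (intro holomorphic2_on_add holomorphic2_on_mult holomorphic2_on_diff holomorphic2_on_power
        holomorphic2_on_snd shear_holomorphic2 holomorphic2_on_subset[OF \<phi>] holomorphic_on_subset[OF d2'])
      (use \<sigma> e in auto)
  have W: "holomorphic2_on W N"
    unfolding W_def[abs_def]
  proof (rule holomorphic2_on_compose2[OF holomorphic2_on_fst _ W0])
    have "holomorphic2_on (\<lambda>x. c (fst x)) N"
      by (rule holomorphic2_on_subset[OF shear_holomorphic2[OF c\<sigma>, of UNIV]]) (auto simp: N_def)
    then show "holomorphic2_on (\<lambda>x. snd x - c (fst x)) N" by (intro holomorphic2_on_diff holomorphic2_on_snd)
  qed (simp add: N_def)
  have "d2 W 0 = 1"
  proof -
    have "(\<lambda>w. \<phi> (0, w)) holomorphic_on ball 0 e"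
      by (rule holomorphic2_on_slices(2)[OF \<phi>]) (use e in auto)
    from holomorphic_derivI[OF this open_ball, of 0] e(1)
    have "((\<lambda>w. \<phi> (0, w)) has_field_derivative deriv (\<lambda>w. \<phi> (0, w)) 0) (at 0)" by simp
    then have "((\<lambda>w. w + (w ^ 2 - 0) * \<phi> (0, w)) has_field_derivative 1) (at 0)"
      by (auto intro!: derivative_eq_intros)
    moreover have "(\<lambda>w. W (0, w)) = (\<lambda>w. w + (w ^ 2 - 0) * \<phi> (0, w))"
      by (simp add: W_def W0_def cd0)
    ultimately show ?thesis by (simp add: d2_def DERIV_imp_deriv)
  qed
  moreover have "W 0 = 0" by (simp add: W_def W0_def cd0)
  ultimately have germ1: "biholomorphic_germ (\<lambda>x. (\<zeta> (fst x), W x))"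
    by (intro biholomorphic_germ_triangular[OF N N0 \<zeta>(2,1,3,4) W]) simp_all
  have germ2: "biholomorphic_germ (\<lambda>y. (\<zeta> (fst y), (snd y - A (fst y)) / b (fst y)))"
  proof (rule biholomorphic_germ_triangular[OF _ _ \<zeta>(2,1,3,4)])
    show "open (?E \<times> (UNIV :: complex set))" by (intro open_Times) auto
    show "0 \<in> ?E \<times> (UNIV :: complex set)" using \<delta>2 by (simp add: zero_prod_def)
    show "holomorphic2_on (\<lambda>y. (snd y - A (fst y)) / b (fst y)) (?E \<times> UNIV)"
      by (intro holomorphic2_on_divide holomorphic2_on_diff holomorphic2_on_snd shear_holomorphic2 b2 A2)
        (use bnz in auto)
    show "(snd 0 - A (fst 0)) / b (fst (0 :: complex \<times> complex)) = 0" using A0 by simp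
    have "((\<lambda>w. (w - A 0) / b 0) has_field_derivative 1 / b 0) (at 0)"
      using b0 by (auto intro!: derivative_eq_intros)
    then show "d2 (\<lambda>y. (snd y - A (fst y)) / b (fst y)) 0 \<noteq> 0"
      using b0 by (simp add: d2_def DERIV_imp_deriv)
  qed
  have main: "(g x - A (fst x)) / b (fst x) = W x ^ 3 - of_nat n * \<zeta> (fst x) ^ n * W x" if x: "x \<in> N" for x
  proof -
    define z w where "z = fst x" and "w = snd x - c z"
    have zw: "z \<in> ball 0 \<sigma>" "w \<in> ball 0 e" using x by (auto simp: N_def z_def w_def)
    have zD: "z \<in> ?E" "z \<in> ?D" "z \<in> ball 0 s" "w \<in> ball 0 r2" "(z, w) \<in> ball 0 e \<times> ball 0 e"
      using zw \<sigma> e \<delta>2 by auto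
    define f where "f = \<phi> (z, w)"
    have gx: "g x = gt (z, w)" by (simp add: gt_def z_def w_def)
    have Q: "Q2 (z, w) / b z = 3 * f + 3 * w * f ^ 2 + (w ^ 2 - d z) * f ^ 3"
      using \<phi>_eq[OF zD(5)] by (simp add: f_def algebra_simps)
    have Wx: "W x = w + (w ^ 2 - d z) * f" by (simp add: W_def W0_def z_def w_def f_def)
    have "(g x - A z) / b z = w ^ 3 - 3 * d z * w + (w ^ 2 - d z) ^ 2 * (Q2 (z, w) / b z)"
      unfolding gx gt_eq[OF zD(2,4)] using bnz[OF zD(1)] by (simp add: field_simps)
    also have "\<dots> = W x ^ 3 - 3 * d z * W x"
      unfolding Q Wx by (simp add: algebra_simps power2_eq_square power3_eq_cube)
    also have "\<dots> = W x ^ 3 - of_nat n * \<zeta> z ^ n * W x" unfolding \<zeta>(5)[OF zD(3)] ..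
    finally show ?thesis by (simp add: z_def)
  qed
  show ?thesis by (rule that[OF germ1 germ2 N N0 main])
qed

definition has_cusp_normal_form ::
    "(complex \<times> complex \<Rightarrow> complex \<times> complex) \<Rightarrow> bool" where
  "has_cusp_normal_form F \<longleftrightarrow> (\<exists>(n::nat) \<Phi> \<Psi> N. biholomorphic_germ \<Phi> \<and> biholomorphic_germ \<Psi> \<and> open N \<and> 0 \<in> N \<and>
     (\<forall>x\<in>N. fst (\<Psi> (F x)) = fst (\<Phi> x) \<and>
        snd (\<Psi> (F x)) = snd (\<Phi> x) ^ 3 - of_nat n * fst (\<Phi> x) ^ n * snd (\<Phi> x)))"

text \<open>Complete the first component by a linear coordinate, so that \<open>F\<close> becomes \<open>(z, g (z, w))\<close>.\<close>

lemma has_cusp_normal_form_if_first_noncritical: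
  assumes germ: "finite_germ F S 3"
    and nc: "d1 (\<lambda>x. fst (F x)) 0 \<noteq> 0 \<or> d2 (\<lambda>x. fst (F x)) 0 \<noteq> 0"
  shows "has_cusp_normal_form F"
proof -
  note gD = finite_germD[OF germ]
  obtain \<Theta> where \<Theta>: "biholomorphic_germ \<Theta>" and fst\<Theta>: "\<And>x. fst (\<Theta> x) = fst (F x)"
  proof (cases "d1 (\<lambda>x. fst (F x)) 0 = 0")
    case False
    have hol: "holomorphic2_map_on (\<lambda>x. (fst (F x), snd x)) S"
      using holomorphic2_map_onD(1)[OF gD(3)] by (intro holomorphic2_map_onI) (simp_all add: holomorphic2_on_snd)
    have "jacobian (\<lambda>x. (fst (F x), snd x)) 0 = d1 (\<lambda>x. fst (F x)) 0"
      by (simp add: jacobian_def d1_def d2_def)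
    then have "biholomorphic_germ (\<lambda>x. (fst (F x), snd x))"
      unfolding biholomorphic_germ_def using False gD hol by (auto simp: zero_prod_def)
    then show ?thesis by (rule that) simp
  next
    case True
    have hol: "holomorphic2_map_on (\<lambda>x. (fst (F x), fst x)) S"
      using holomorphic2_map_onD(1)[OF gD(3)] by (intro holomorphic2_map_onI) (simp_all add: holomorphic2_on_fst)
    have "jacobian (\<lambda>x. (fst (F x), fst x)) 0 = - d2 (\<lambda>x. fst (F x)) 0"
      by (simp add: jacobian_def d1_def d2_def)
    then have "biholomorphic_germ (\<lambda>x. (fst (F x), fst x))"
      unfolding biholomorphic_germ_def using True nc gD hol by (auto simp: zero_prod_def)
    then show ?thesis by (rule that) simp
  qed
  obtain U V G where U: "open U" "U \<subseteq> S" "0 \<in> U" and V: "open V" and hom: "homeomorphism U V \<Theta> G"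
    and hol: "holomorphic2_map_on \<Theta> U" "holomorphic2_map_on G V"
    by (rule biholomorphic_germ_inverse[OF \<Theta> gD(1,2)]) (rule that)
  have \<Theta>0: "\<Theta> 0 = 0" using \<Theta> by (simp add: biholomorphic_germ_def)
  have germ': "finite_germ (\<lambda>x. F (G x)) V 3"
    by (rule finite_germ_source_change[OF germ U(1,3,2) V hom hol(2) \<Theta>0])
  have fibred: "fst (F (G y)) = fst y" if "y \<in> V" for y
    using hom that unfolding homeomorphism_def by (simp flip: fst\<Theta>)
  define g where "g y = snd (F (G y))" for y
  obtain R where R: "R > 0" "cball 0 R \<times> cball 0 R \<subseteq> V"
    "\<And>w. w \<in> cball 0 R - {0} \<Longrightarrow> g (0, w) \<noteq> 0" "zorder (\<lambda>w. g (0, w)) 0 = int 3"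
  proof (rule finite_germ_fibred_order[OF germ'])
    show "fst (F (G y)) = fst y" if "y \<in> V" for y by (rule fibred[OF that])
    fix R
    assume *: "0 < R" "cball 0 R \<times> cball 0 R \<subseteq> V"
      "\<And>w. w \<in> cball 0 R - {0} \<Longrightarrow> snd (F (G (0, w))) \<noteq> 0"
      "zorder (\<lambda>w. snd (F (G (0, w)))) 0 = int 3"
    show thesis by (rule that[OF *(1,2)]) (use *(3,4) in \<open>auto simp: g_def\<close>)
  qed
  have gV: "holomorphic2_on g V"
    unfolding g_def by (rule holomorphic2_map_onD(2)[OF finite_germD(3)[OF germ']])
  have "ball 0 R \<times> ball 0 R \<subseteq> cball (0::complex) R \<times> cball (0::complex) R" by auto
  then have gR: "holomorphic2_on g (ball 0 R \<times> ball 0 R)"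
    using holomorphic2_on_subset[OF gV] R(2) by (meson order_trans)
  have g0: "g (0, 0) = 0"
    using finite_germD(4)[OF germ'] by (simp add: g_def zero_prod_def)
  have w0: "of_real (R / 2) \<in> ball (0::complex) R" "g (0, of_real (R / 2)) \<noteq> 0"
    using R(1) R(3)[of "of_real (R / 2)"] by simp_all
  have ord: "zorder (\<lambda>w. g (0, w)) 0 = 3" using R(4) by simp
  obtain n :: nat and \<zeta> A b W N where
    nf: "biholomorphic_germ (\<lambda>x. (\<zeta> (fst x), W x))"
    "biholomorphic_germ (\<lambda>y. (\<zeta> (fst y), (snd y - A (fst y)) / b (fst y)))"
    "open N" "0 \<in> N"
    "\<And>x. x \<in> N \<Longrightarrow> (g x - A (fst x)) / b (fst x) = W x ^ 3 - of_nat n * \<zeta> (fst x) ^ n * W x"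
    by (rule cusp_normal_form[OF gR R(1) g0 w0 ord]) (rule that)
  let ?\<Phi> = "\<lambda>x. (\<zeta> (fst (\<Theta> x)), W (\<Theta> x))"
  let ?\<Psi> = "\<lambda>y. (\<zeta> (fst y), (snd y - A (fst y)) / b (fst y))"
  let ?N = "U \<inter> \<Theta> -` N"
  have oN: "open ?N"
    by (rule continuous_open_preimage[OF holomorphic2_map_on_continuous[OF hol(1)] U(1) nf(3)])
  have zN: "0 \<in> ?N" using U(3) \<Theta>0 nf(4) by simp
  have germ\<Phi>: "biholomorphic_germ ?\<Phi>" by (rule biholomorphic_germ_compose[OF \<Theta> nf(1)])
  have eqs: "\<forall>x\<in>?N. fst (?\<Psi> (F x)) = fst (?\<Phi> x) \<and>
      snd (?\<Psi> (F x)) = snd (?\<Phi> x) ^ 3 - of_nat n * fst (?\<Phi> x) ^ n * snd (?\<Phi> x)"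
  proof
    fix x assume x: "x \<in> ?N"
    then have "G (\<Theta> x) = x" using homeomorphism_apply1[OF hom] by blast
    then have "g (\<Theta> x) = snd (F x)" by (simp add: g_def)
    then show "fst (?\<Psi> (F x)) = fst (?\<Phi> x) \<and>
      snd (?\<Psi> (F x)) = snd (?\<Phi> x) ^ 3 - of_nat n * fst (?\<Phi> x) ^ n * snd (?\<Phi> x)"
      using nf(5)[of "\<Theta> x"] x by (simp add: fst\<Theta>)
  qed
  show ?thesis
    unfolding has_cusp_normal_form_def using germ\<Phi> nf(2) oN zN eqs
    by (intro exI[of _ n] exI[of _ ?\<Phi>] exI[of _ ?\<Psi>] exI[of _ ?N] conjI)
qed

text \<open>By the previous results one of the two components has a nonzero differential; exchange them if necessary.\<close>

theorem finite_germ_degree_3_normal_form: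
  assumes germ: "finite_germ F S 3"
  shows "has_cusp_normal_form F"
proof (cases "d1 (\<lambda>x. fst (F x)) 0 \<noteq> 0 \<or> d2 (\<lambda>x. fst (F x)) 0 \<noteq> 0")
  case True
  then show ?thesis by (rule has_cusp_normal_form_if_first_noncritical[OF germ])
next
  case False
  then have "d1 (\<lambda>x. snd (F x)) 0 \<noteq> 0 \<or> d2 (\<lambda>x. snd (F x)) 0 \<noteq> 0"
    using finite_germ_degree_3_noncritical[OF germ] by blast
  then have "has_cusp_normal_form (\<lambda>x. prod.swap (F x))"
    by (intro has_cusp_normal_form_if_first_noncritical[OF finite_germ_swap[OF germ]]) simp
  then obtain n :: nat and \<Phi> \<Psi> N where nf: "biholomorphic_germ \<Phi>" "biholomorphic_germ \<Psi>" "open N" "0 \<in> N"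
     "\<forall>x\<in>N. fst (\<Psi> (prod.swap (F x))) = fst (\<Phi> x) \<and>
        snd (\<Psi> (prod.swap (F x))) = snd (\<Phi> x) ^ 3 - of_nat n * fst (\<Phi> x) ^ n * snd (\<Phi> x)"
    unfolding has_cusp_normal_form_def by (elim exE conjE)
  have "biholomorphic_germ (\<lambda>y. \<Psi> (prod.swap y))"
    by (rule biholomorphic_germ_compose[OF biholomorphic_germ_swap nf(2)])
  then show ?thesis
    unfolding has_cusp_normal_form_def using nf(1,3,4,5)
    by (intro exI[of _ n] exI[of _ \<Phi>] exI[of _ "\<lambda>y. \<Psi> (prod.swap y)"] exI[of _ N] conjI)
qed

section \<open>From surfaces to coordinates\<close>

lemma is_chartD:
  assumes "is_chart X (D, \<phi>)"
  shows "openin X D" "open (\<phi> ` D)" "inj_on \<phi> D"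
    and "\<And>W. openin X W \<Longrightarrow> W \<subseteq> D \<Longrightarrow> open (\<phi> ` W)"
    and "\<And>T. open T \<Longrightarrow> openin X {x \<in> D. \<phi> x \<in> T}"
proof -
  show D: "openin X D" and im: "open (\<phi> ` D)" using assms by (auto simp: is_chart_def)
  have hom: "homeomorphic_map (subtopology X D) (top_of_set (\<phi> ` D)) \<phi>"
    using assms by (auto simp: is_chart_def)
  have top: "topspace (subtopology X D) = D" using openin_subset[OF D] by auto
  show "inj_on \<phi> D" using homeomorphic_imp_injective_map[OF hom] top by simp
  show "open (\<phi> ` W)" if "openin X W" "W \<subseteq> D" for W
  proof -
    have "openin (subtopology X D) W" using that by (simp add: openin_open_subtopology[OF D])
    then have "openin (top_of_set (\<phi> ` D)) (\<phi> ` W)"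
      using homeomorphic_imp_open_map[OF hom] unfolding open_map_def by blast
    then show ?thesis using im by (simp add: openin_open_eq)
  qed
  show "openin X {x \<in> D. \<phi> x \<in> T}" if "open T" for T
  proof -
    have "openin (top_of_set (\<phi> ` D)) (\<phi> ` D \<inter> T)" using that by (simp add: openin_open_Int)
    from openin_continuous_map_preimage[OF homeomorphic_imp_continuous_map[OF hom] this]
    have "openin (subtopology X D) {x \<in> D. \<phi> x \<in> \<phi> ` D \<inter> T}" unfolding top .
    moreover have "{x \<in> D. \<phi> x \<in> \<phi> ` D \<inter> T} = {x \<in> D. \<phi> x \<in> T}" by auto
    ultimately show ?thesis by (simp add: openin_open_subtopology[OF D])
  qed
qed

lemma complex_surface_chart_at:
  assumes "complex_surface X \<A>" "p \<in> topspace X"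
  obtains D \<phi> where "(D, \<phi>) \<in> \<A>" "p \<in> D"
proof -
  have "(\<Union>c\<in>\<A>. fst c) = topspace X" using assms(1) unfolding complex_surface_def by (elim conjE)
  then have "p \<in> (\<Union>c\<in>\<A>. fst c)" using assms(2) by (simp only:)
  then obtain c where c: "c \<in> \<A>" "p \<in> fst c" by (rule UN_E)
  then show ?thesis by (intro that[of "fst c" "snd c"]) simp_all
qed

lemma open_image_minus: "open W \<Longrightarrow> open ((\<lambda>x. x - a) ` W)" for a :: "'a::real_normed_vector"
  using open_translation[of W "- a"] by simp

lemma holomorphic2_map_on_plus_const:
  assumes "holomorphic2_map_on F S"
  shows "holomorphic2_map_on (\<lambda>x. F x + a) S"
  using holomorphic2_map_onD[OF assms]
  by (intro holomorphic2_map_onI) (simp_all add: holomorphic2_on_add holomorphic2_on_const)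

lemma holomorphic2_map_on_id: "holomorphic2_map_on (\<lambda>x. x) S"
  by (intro holomorphic2_map_onI) (simp_all add: holomorphic2_on_fst holomorphic2_on_snd)

text \<open>A chart of the atlas, translated to the origin, followed by a local biholomorphic map.\<close>

lemma local_coordinates_from_chart:
  assumes surf: "complex_surface X \<A>" and c: "(D0, \<phi>) \<in> \<A>" and p: "p \<in> D0"
    and U: "open U" "0 \<in> U" and V: "open V" and hom: "homeomorphism U V \<Phi> G"
    and hol: "holomorphic2_map_on \<Phi> U" "holomorphic2_map_on G V" and \<Phi>0: "\<Phi> 0 = 0"
    and sub: "U \<subseteq> (\<lambda>x. \<phi> x - \<phi> p) ` D0"
  shows "local_coordinates X \<A> p {x \<in> D0. \<phi> x - \<phi> p \<in> U} (\<lambda>x. \<Phi> (\<phi> x - \<phi> p))"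
proof -
  let ?D = "{x \<in> D0. \<phi> x - \<phi> p \<in> U}" and ?\<chi> = "\<lambda>x. \<Phi> (\<phi> x - \<phi> p)"
  have chart: "is_chart X (D0, \<phi>)" using surf c by (auto simp: complex_surface_def)
  note ch = is_chartD[OF chart]
  have \<Phi>G: "\<And>x. x \<in> U \<Longrightarrow> \<Phi> x \<in> V \<and> G (\<Phi> x) = x" "\<And>y. y \<in> V \<Longrightarrow> G y \<in> U \<and> \<Phi> (G y) = y"
    using hom unfolding homeomorphism_def by blast+
  have D: "openin X ?D"
  proof -
    have "open ((\<lambda>y. y - \<phi> p) -` U)" by (intro open_vimage U continuous_intros)
    from ch(5)[OF this] show ?thesis by simp
  qed
  have img: "?\<chi> ` ?D = V"
  proof (intro equalityI subsetI)
    fix v assume v: "v \<in> V"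
    from subsetD[OF sub conjunct1[OF \<Phi>G(2)[OF v]]] obtain x where x: "G v = \<phi> x - \<phi> p" "x \<in> D0"
      by (rule imageE)
    have "x \<in> ?D" "v = ?\<chi> x" using \<Phi>G(2)[OF v] x by simp_all
    then show "v \<in> ?\<chi> ` ?D" by (rule rev_image_eqI)
  next
    fix v assume "v \<in> ?\<chi> ` ?D"
    then obtain x where x: "v = ?\<chi> x" "x \<in> ?D" by (rule imageE)
    show "v \<in> V" using \<Phi>G(1)[of "\<phi> x - \<phi> p"] x by simp
  qed
  have inj: "inj_on ?\<chi> ?D"
  proof (rule inj_onI)
    fix x y assume xy: "x \<in> ?D" "y \<in> ?D" "?\<chi> x = ?\<chi> y"
    have xD: "x \<in> D0" "\<phi> x - \<phi> p \<in> U" and yD: "y \<in> D0" "\<phi> y - \<phi> p \<in> U" using xy(1,2) by simp_all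
    have "\<phi> x - \<phi> p = G (?\<chi> x)" by (rule sym, rule conjunct2[OF \<Phi>G(1)[OF xD(2)]])
    also have "\<dots> = G (?\<chi> y)" by (simp only: xy(3))
    also have "\<dots> = \<phi> y - \<phi> p" by (rule conjunct2[OF \<Phi>G(1)[OF yD(2)]])
    finally have "\<phi> x = \<phi> y" by simp
    from inj_onD[OF ch(3) this xD(1) yD(1)] show "x = y" .
  qed
  have open_im: "open (?\<chi> ` W)" if W: "openin X W" "W \<subseteq> ?D" for W
  proof -
    have "open ((\<lambda>x. x - \<phi> p) ` \<phi> ` W)" by (intro open_image_minus ch(4) W) (use W in auto)
    then have "open (V \<inter> G -` ((\<lambda>x. x - \<phi> p) ` \<phi> ` W))"
      by (intro continuous_open_preimage[OF holomorphic2_map_on_continuous[OF hol(2)] V])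
    also have "V \<inter> G -` ((\<lambda>x. x - \<phi> p) ` \<phi> ` W) = ?\<chi> ` W"
    proof (intro equalityI subsetI)
      fix v assume "v \<in> V \<inter> G -` ((\<lambda>x. x - \<phi> p) ` \<phi> ` W)"
      then have v: "v \<in> V" "G v \<in> (\<lambda>x. x - \<phi> p) ` \<phi> ` W" by simp_all
      then obtain x where x: "x \<in> W" "G v = \<phi> x - \<phi> p" by (auto elim!: imageE)
      have "v = ?\<chi> x" using \<Phi>G(2)[OF v(1)] x(2) by simp
      then show "v \<in> ?\<chi> ` W" using x(1) by (rule image_eqI)
    next
      fix v assume "v \<in> ?\<chi> ` W"
      then obtain x where x: "v = ?\<chi> x" "x \<in> W" by (rule imageE)
      have "\<phi> x - \<phi> p \<in> U" using x(2) W(2) by blast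
      from \<Phi>G(1)[OF this] have "v \<in> V" "G v = \<phi> x - \<phi> p" by (simp_all add: x(1))
      then show "v \<in> V \<inter> G -` ((\<lambda>x. x - \<phi> p) ` \<phi> ` W)" using x(2) by simp
    qed
    finally show ?thesis .
  qed
  have top: "topspace (subtopology X ?D) = ?D" using openin_subset[OF D] by auto
  have "homeomorphic_map (subtopology X ?D) (top_of_set V) ?\<chi>"
  proof (rule bijective_open_imp_homeomorphic_map)
    show "continuous_map (subtopology X ?D) (top_of_set V) ?\<chi>"
      unfolding continuous_map_def
    proof (intro conjI allI impI)
      show "?\<chi> \<in> topspace (subtopology X ?D) \<rightarrow> topspace (top_of_set V)"
        unfolding top using img by auto
      fix T assume "openin (top_of_set V) T"
      then have T: "open T" "T \<subseteq> V" using V by (auto simp: openin_open_eq)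
      have "open (U \<inter> \<Phi> -` T)"
        by (rule continuous_open_preimage[OF holomorphic2_map_on_continuous[OF hol(1)] U(1) T(1)])
      then have "open ((\<lambda>y. y - \<phi> p) -` (U \<inter> \<Phi> -` T))" by (intro open_vimage continuous_intros)
      from ch(5)[OF this]
      have "openin X {x \<in> topspace (subtopology X ?D). ?\<chi> x \<in> T}"
        unfolding top by (rule back_subst[of "openin X"]) auto
      then show "openin (subtopology X ?D) {x \<in> topspace (subtopology X ?D). ?\<chi> x \<in> T}"
        unfolding top openin_open_subtopology[OF D] by (intro conjI Collect_restrict)
    qed
    show "open_map (subtopology X ?D) (top_of_set V) ?\<chi>"
      unfolding open_map_def
    proof (intro allI impI)
      fix W assume "openin (subtopology X ?D) W"
      then have W: "openin X W" "W \<subseteq> ?D" unfolding openin_open_subtopology[OF D] by (rule conjunct1, rule conjunct2)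
      have "?\<chi> ` W \<subseteq> V" using image_mono[OF W(2), of ?\<chi>] unfolding img .
      then show "openin (top_of_set V) (?\<chi> ` W)"
        using open_im[OF W] by (simp add: openin_open_eq[OF V])
    qed
    show "?\<chi> ` topspace (subtopology X ?D) = topspace (top_of_set V)" unfolding top using img by simp
    show "inj_on ?\<chi> (topspace (subtopology X ?D))" unfolding top by (rule inj)
  qed
  then have is_ch: "is_chart X (?D, ?\<chi>)" unfolding is_chart_def using D V img by simp
  have compat: "compatible (?D, ?\<chi>) d" if d: "d \<in> \<A>" for d
  proof -
    obtain E \<psi> where d': "d = (E, \<psi>)" by fastforce
    have "compatible (D0, \<phi>) (E, \<psi>)" using surf c d d' by (auto simp: complex_surface_def)
    then have cp: "holomorphic2_map_on (\<psi> \<circ> inv_into D0 \<phi>) (\<phi> ` (D0 \<inter> E))"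
      "holomorphic2_map_on (\<phi> \<circ> inv_into E \<psi>) (\<psi> ` (D0 \<inter> E))"
      by (simp_all add: compatible_def)
    have chE: "is_chart X (E, \<psi>)" using surf d d' by (auto simp: complex_surface_def)
    note e = is_chartD[OF chE]
    have DE: "openin X (?D \<inter> E)" by (intro openin_Int D e(1))
    have inv_\<phi>: "inv_into D0 \<phi> (\<phi> x) = x" if "x \<in> D0" for x using inv_into_f_f[OF ch(3) that] .
    have inv_\<chi>: "inv_into ?D ?\<chi> (?\<chi> x) = x" if "x \<in> ?D" for x using inv_into_f_f[OF inj that] .
    have inv_\<psi>: "inv_into E \<psi> (\<psi> x) = x" if "x \<in> E" for x using inv_into_f_f[OF e(3) that] .
    have 1: "holomorphic2_map_on (\<psi> \<circ> inv_into ?D ?\<chi>) (?\<chi> ` (?D \<inter> E))"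
    proof (rule holomorphic2_map_on_cong[of _ "\<lambda>v. (\<psi> \<circ> inv_into D0 \<phi>) (G v + \<phi> p)"])
      show "open (?\<chi> ` (?D \<inter> E))" by (rule open_im[OF DE]) auto
      fix v assume "v \<in> ?\<chi> ` (?D \<inter> E)"
      then obtain x where x: "v = ?\<chi> x" "x \<in> ?D \<inter> E" by (rule imageE)
      then have x: "x \<in> ?D" "v = ?\<chi> x" by simp_all
      have "G v = \<phi> x - \<phi> p" using \<Phi>G(1)[of "\<phi> x - \<phi> p"] x by simp
      then have "G v + \<phi> p = \<phi> x" by simp
      then show "(\<psi> \<circ> inv_into D0 \<phi>) (G v + \<phi> p) = (\<psi> \<circ> inv_into ?D ?\<chi>) v"
        using inv_\<phi>[of x] inv_\<chi>[OF x(1)] x by simp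
    next
      show "holomorphic2_map_on (\<lambda>v. (\<psi> \<circ> inv_into D0 \<phi>) (G v + \<phi> p)) (?\<chi> ` (?D \<inter> E))"
      proof (rule holomorphic2_map_on_compose[OF _ cp(1)])
        have "?\<chi> ` (?D \<inter> E) \<subseteq> V" using img by blast
        then show "holomorphic2_map_on (\<lambda>v. G v + \<phi> p) (?\<chi> ` (?D \<inter> E))"
          by (intro holomorphic2_map_on_plus_const holomorphic2_map_on_subset[OF hol(2)])
        fix v assume "v \<in> ?\<chi> ` (?D \<inter> E)"
        then obtain x where x: "v = ?\<chi> x" "x \<in> ?D \<inter> E" by (rule imageE)
        have "G v = \<phi> x - \<phi> p" using \<Phi>G(1)[of "\<phi> x - \<phi> p"] x by simp
        then have "G v + \<phi> p = \<phi> x" by simp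
        then show "G v + \<phi> p \<in> \<phi> ` (D0 \<inter> E)" using x(2) by auto
      qed
    qed
    have 2: "holomorphic2_map_on (?\<chi> \<circ> inv_into E \<psi>) (\<psi> ` (?D \<inter> E))"
    proof -
      have "holomorphic2_map_on (\<phi> \<circ> inv_into E \<psi>) (\<psi> ` (?D \<inter> E))"
        by (rule holomorphic2_map_on_subset[OF cp(2)]) auto
      from holomorphic2_map_on_plus_const[OF this, of "- \<phi> p"]
      have h: "holomorphic2_map_on (\<lambda>v. \<phi> (inv_into E \<psi> v) - \<phi> p) (\<psi> ` (?D \<inter> E))" by simp
      have "holomorphic2_map_on (\<lambda>v. \<Phi> (\<phi> (inv_into E \<psi> v) - \<phi> p)) (\<psi> ` (?D \<inter> E))"
        by (rule holomorphic2_map_on_compose[OF h hol(1)]) (use inv_\<psi> in auto)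
      then show ?thesis by (simp add: o_def)
    qed
    show ?thesis unfolding d' compatible_def using 1 2 by simp
  qed
  have "p \<in> ?D" "?\<chi> p = (0, 0)" using p U(2) \<Phi>0 by (simp_all add: zero_prod_def)
  then show ?thesis unfolding local_coordinates_def using is_ch compat by blast
qed

text \<open>A proper map is closed, so the image of the complement of \<open>N\<close> is a closed set missing \<open>q\<close>.\<close>

lemma fibre_concentration:
  assumes V: "openin Y V" and f: "proper_map (subtopology X U) (subtopology Y V) f"
    and U: "openin X U" and N: "openin X N" and q: "q \<in> V" "{x \<in> U. f x = q} \<subseteq> N"
  obtains V' where "openin Y V'" "q \<in> V'" "V' \<subseteq> V" "\<And>x. x \<in> U \<Longrightarrow> f x \<in> V' \<Longrightarrow> x \<in> N"
proof -
  have topU: "topspace (subtopology X U) = U" using openin_subset[OF U] by auto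
  have topV: "topspace (subtopology Y V) = V" using openin_subset[OF V] by auto
  have "openin (subtopology X U) (U \<inter> N)" by (simp add: openin_open_subtopology[OF U] openin_Int U N)
  then have "closedin (subtopology X U) (U - U \<inter> N)"
    using topU by (metis closedin_def topspace_subtopology openin_subset closedin_diff closedin_topspace)
  then have "closedin (subtopology Y V) (f ` (U - U \<inter> N))"
    using proper_imp_closed_map[OF f] unfolding closed_map_def by blast
  then have "openin (subtopology Y V) (V - f ` (U - U \<inter> N))"
    using topV by (simp add: closedin_def)
  then have "openin Y (V - f ` (U - U \<inter> N))" by (simp add: openin_open_subtopology[OF V])
  then show ?thesis
    by (rule that) (use q in auto)
qed

text \<open>Passing to charts.  By properness the fibres over points near \<open>q\<close> lie in the domain of the
  chart at \<open>p\<close>, so no points are lost.  The closure of the exceptional set \<open>T\<close> has empty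
  interior, and its complement provides the open sets of points with full fibres.\<close>

lemma finite_germ_of_cover:
  assumes X: "complex_surface X \<A>" and Y: "complex_surface Y \<B>"
    and U: "openin X U" "p \<in> U" and V: "openin Y V" "q \<in> V"
    and f: "holomorphic_map X \<A> U Y \<B> V f" "finite_map X U Y V f" "has_degree U Y \<B> V f d"
    and fib: "{x \<in> U. f x = q} = {p}"
    and c: "(D, \<phi>) \<in> \<A>" "p \<in> D" and e: "(E, \<psi>) \<in> \<B>" "q \<in> E"
  shows "finite_germ (\<lambda>x. \<psi> (f (inv_into D \<phi> (x + \<phi> p))) - \<psi> q)
    ((\<lambda>x. \<phi> x - \<phi> p) ` {x \<in> U \<inter> D. f x \<in> E}) d"
proof -
  let ?F = "\<lambda>x. \<psi> (f (inv_into D \<phi> (x + \<phi> p))) - \<psi> q"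
  let ?P = "{x \<in> U \<inter> D. f x \<in> E}"
  let ?\<tau> = "\<lambda>x. \<phi> x - \<phi> p"
  have chD: "is_chart X (D, \<phi>)" using X c by (auto simp: complex_surface_def)
  have chE: "is_chart Y (E, \<psi>)" using Y e by (auto simp: complex_surface_def)
  note D = is_chartD[OF chD] and E = is_chartD[OF chE]
  have topU: "topspace (subtopology X U) = U" using openin_subset[OF U(1)] by auto
  have cont: "continuous_map (subtopology X U) (subtopology Y V) f"
    using f(1) by (simp add: holomorphic_map_def)
  have fV: "f x \<in> V" if "x \<in> U" for x
    using continuous_map_image_subset_topspace[OF cont] that topU by auto
  have fq: "f p = q" using fib by auto
  have P: "openin X ?P"
  proof -
    have "openin (subtopology Y V) (V \<inter> E)"
      using V E by (simp add: openin_open_subtopology openin_Int)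
    from openin_continuous_map_preimage[OF cont this]
    have "openin X {x \<in> U. f x \<in> V \<inter> E}" unfolding topU by (simp add: openin_open_subtopology[OF U(1)])
    then have "openin X ({x \<in> U. f x \<in> V \<inter> E} \<inter> D)" by (rule openin_Int[OF _ D(1)])
    moreover have "{x \<in> U. f x \<in> V \<inter> E} \<inter> D = ?P" using fV by auto
    ultimately show ?thesis by simp
  qed
  have pP: "p \<in> ?P" using U c e fq by simp
  have inv: "inv_into D \<phi> (?\<tau> x + \<phi> p) = x" if "x \<in> D" for x
    using inv_into_f_f[OF D(3) that] by simp
  have F\<tau>: "?F (?\<tau> x) = \<psi> (f x) - \<psi> q" if "x \<in> D" for x unfolding inv[OF that] ..
  have \<tau>_open: "open (?\<tau> ` W)" if "openin X W" "W \<subseteq> D" for W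
    using open_image_minus[OF D(4)[OF that]] by (simp add: image_image)
  have \<tau>_inj: "inj_on ?\<tau> D" using D(3) by (auto simp: inj_on_def)
  have proper: "proper_map (subtopology X U) (subtopology Y V) f"
    using f(2) by (simp add: finite_map_def)
  have ball_in: "\<exists>r>0. \<forall>y\<in>E. \<psi> y - \<psi> q \<in> ball 0 r \<longrightarrow> y \<in> V'" and ball_sub: "\<exists>r>0. ball 0 r \<subseteq> (\<lambda>y. \<psi> y - \<psi> q) ` (V' \<inter> E)"
    if V': "openin Y V'" "q \<in> V'" for V'
  proof -
    have "open (\<psi> ` (V' \<inter> E))" by (rule E(4)) (use V' E(1) in auto)
    then obtain r where r: "r > 0" "ball (\<psi> q) r \<subseteq> \<psi> ` (V' \<inter> E)"
      using V' e(2) open_contains_ball by (metis IntI imageI)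
    show "\<exists>r>0. \<forall>y\<in>E. \<psi> y - \<psi> q \<in> ball 0 r \<longrightarrow> y \<in> V'"
    proof (intro exI[of _ r] conjI ballI impI)
      fix y assume y: "y \<in> E" "\<psi> y - \<psi> q \<in> ball 0 r"
      then have "\<psi> y \<in> ball (\<psi> q) r" by (simp add: dist_norm norm_minus_commute)
      then obtain y' where "y' \<in> V' \<inter> E" "\<psi> y = \<psi> y'" using r(2) by blast
      then show "y \<in> V'" using inj_onD[OF E(3)] y(1) by auto
    qed (rule r(1))
    show "\<exists>r>0. ball 0 r \<subseteq> (\<lambda>y. \<psi> y - \<psi> q) ` (V' \<inter> E)"
    proof (intro exI[of _ r] conjI subsetI)
      fix v assume "v \<in> ball (0 :: complex \<times> complex) r"
      then have "v + \<psi> q \<in> ball (\<psi> q) r" by (simp add: dist_norm)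
      then obtain y where "y \<in> V' \<inter> E" "v + \<psi> q = \<psi> y" using r(2) by blast
      then show "v \<in> (\<lambda>y. \<psi> y - \<psi> q) ` (V' \<inter> E)" by (intro image_eqI[of _ _ y]) (auto simp: algebra_simps)
    qed (rule r(1))
  qed
  obtain T where T: "subtopology Y V interior_of (subtopology Y V closure_of T) = {}"
      "T \<subseteq> V" "\<forall>y\<in>V - T. card {x \<in> U. f x = y} = d"
    using f(3) unfolding has_degree_def analytic_subset_def by (elim exE conjE)
  let ?K = "subtopology Y V closure_of T"
  have TK: "T \<subseteq> ?K" by (rule closure_of_subset) (use T(2) openin_subset[OF V(1)] in auto)
  have fibP: "{x \<in> U. f x = q} \<subseteq> ?P" unfolding fib by (rule subsetI) (simp only: singleton_iff pP)
  obtain V1 where V1: "openin Y V1" "q \<in> V1" "V1 \<subseteq> V" "\<And>x. x \<in> U \<Longrightarrow> f x \<in> V1 \<Longrightarrow> x \<in> ?P"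
    by (rule fibre_concentration[OF V(1) proper U(1) P V(2) fibP]) (rule that)
  obtain r where r: "r > 0" "ball 0 r \<subseteq> (\<lambda>y. \<psi> y - \<psi> q) ` (V1 \<inter> E)"
    using ball_sub[OF V1(1,2)] by (elim exE conjE)
  show ?thesis
  proof (rule finite_germI[where e = r])
    show "open (?\<tau> ` ?P)" by (rule \<tau>_open[OF P]) auto
    show "0 \<in> ?\<tau> ` ?P" using pP by (intro image_eqI[of _ _ p]) auto
    show "?F 0 = 0" using F\<tau>[OF c(2)] fq by simp
    show "holomorphic2_map_on ?F (?\<tau> ` ?P)"
    proof -
      have h: "holomorphic2_map_on (\<psi> \<circ> f \<circ> inv_into D \<phi>) (\<phi> ` ?P)"
        using f(1) c(1) e(1) by (auto simp: holomorphic_map_def)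
      have "holomorphic2_map_on (\<lambda>x. (\<psi> \<circ> f \<circ> inv_into D \<phi>) (x + \<phi> p)) (?\<tau> ` ?P)"
        by (rule holomorphic2_map_on_compose[OF holomorphic2_map_on_plus_const[OF holomorphic2_map_on_id] h]) auto
      from holomorphic2_map_on_plus_const[OF this, of "- \<psi> q"] show ?thesis by simp
    qed
    show "\<exists>e>0. \<forall>x\<in>?\<tau> ` ?P. ?F x \<in> ball 0 e \<longrightarrow> x \<in> N" if N: "open N" "0 \<in> N" for N
    proof -
      have "open ((\<lambda>y. y - \<phi> p) -` N)" by (intro open_vimage N continuous_intros)
      from D(5)[OF this] have NX: "openin X {x \<in> D. ?\<tau> x \<in> N}" by simp
      have pN: "{x \<in> U. f x = q} \<subseteq> {x \<in> D. ?\<tau> x \<in> N}" unfolding fib using c(2) N(2) by simp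
      obtain V2 where V2: "openin Y V2" "q \<in> V2" "V2 \<subseteq> V" "\<And>x. x \<in> U \<Longrightarrow> f x \<in> V2 \<Longrightarrow> x \<in> {x \<in> D. ?\<tau> x \<in> N}"
        by (rule fibre_concentration[OF V(1) proper U(1) NX V(2) pN]) (rule that)
      obtain s where s: "s > 0" "\<forall>y\<in>E. \<psi> y - \<psi> q \<in> ball 0 s \<longrightarrow> y \<in> V2"
        using ball_in[OF V2(1,2)] by blast
      show ?thesis
      proof (intro exI[of _ s] conjI ballI impI)
        fix x assume x: "x \<in> ?\<tau> ` ?P" "?F x \<in> ball 0 s"
        then obtain x' where x': "x' \<in> ?P" "x = ?\<tau> x'" by blast
        have "\<psi> (f x') - \<psi> q \<in> ball 0 s" using x(2) F\<tau>[of x'] x' by simp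
        then have "f x' \<in> V2" using s(2) x'(1) by blast
        then show "x \<in> N" using V2(4)[of x'] x' by blast
      qed (rule s(1))
    qed
    fix W assume W: "open W" "W \<noteq> {}" "W \<subseteq> ball (0 :: complex \<times> complex) r"
    define WY where "WY = {y \<in> E. \<psi> y - \<psi> q \<in> W} \<inter> V1"
    have WY: "openin Y WY"
    proof -
      have "open ((\<lambda>y. y - \<psi> q) -` W)" by (intro open_vimage W continuous_intros)
      from E(5)[OF this] show ?thesis unfolding WY_def using V1(1) by (intro openin_Int) simp_all
    qed
    have WYne: "WY \<noteq> {}"
    proof -
      obtain v where v: "v \<in> W" using W(2) by blast
      then obtain y where "y \<in> V1 \<inter> E" "v = \<psi> y - \<psi> q" using W(3) r(2) by blast
      then have "y \<in> WY" using v by (simp add: WY_def)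
      then show ?thesis by blast
    qed
    have WYV: "WY \<subseteq> V" using V1(3) by (auto simp: WY_def)
    have oWY: "openin (subtopology Y V) WY" using WY WYV by (simp add: openin_open_subtopology[OF V(1)])
    have "\<not> WY \<subseteq> ?K"
    proof
      assume "WY \<subseteq> ?K"
      then have "WY \<subseteq> subtopology Y V interior_of ?K" using oWY by (rule interior_of_maximal)
      then show False using T(1) WYne by blast
    qed
    then have ne: "WY - ?K \<noteq> {}" by blast
    have "openin (subtopology Y V) (WY - ?K)" by (rule openin_diff[OF oWY closedin_closure_of])
    then have oWK: "openin Y (WY - ?K)" by (simp add: openin_open_subtopology[OF V(1)])
    show "\<exists>W'. open W' \<and> W' \<noteq> {} \<and> W' \<subseteq> W \<and> (\<forall>y\<in>W'. card {x \<in> ?\<tau> ` ?P. ?F x = y} = d)"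
    proof (intro exI[of _ "(\<lambda>y. \<psi> y - \<psi> q) ` (WY - ?K)"] conjI ballI)
      have "open (\<psi> ` (WY - ?K))" by (rule E(4)[OF oWK]) (auto simp: WY_def)
      from open_image_minus[OF this] show "open ((\<lambda>y. \<psi> y - \<psi> q) ` (WY - ?K))" by (simp add: image_image)
      show "(\<lambda>y. \<psi> y - \<psi> q) ` (WY - ?K) \<noteq> {}" using ne by blast
      show "(\<lambda>y. \<psi> y - \<psi> q) ` (WY - ?K) \<subseteq> W" by (auto simp: WY_def)
      fix v assume "v \<in> (\<lambda>y. \<psi> y - \<psi> q) ` (WY - ?K)"
      then obtain y where y: "y \<in> WY" "y \<notin> ?K" "v = \<psi> y - \<psi> q" by blast
      have y': "y \<in> V - T" "y \<in> V1" "y \<in> E" using y TK WYV by (auto simp: WY_def)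
      have "{x \<in> ?\<tau> ` ?P. ?F x = v} = ?\<tau> ` {x \<in> U. f x = y}"
      proof (intro equalityI subsetI)
        fix x assume "x \<in> {x \<in> ?\<tau> ` ?P. ?F x = v}"
        then obtain x' where x': "x' \<in> ?P" "x = ?\<tau> x'" "?F (?\<tau> x') = v" by blast
        then have "\<psi> (f x') = \<psi> y" using F\<tau>[of x'] y(3) by simp
        then have "f x' = y" using inj_onD[OF E(3)] x'(1) y'(3) by blast
        then show "x \<in> ?\<tau> ` {x \<in> U. f x = y}" using x' by blast
      next
        fix x assume "x \<in> ?\<tau> ` {x \<in> U. f x = y}"
        then obtain x' where x': "x' \<in> U" "f x' = y" "x = ?\<tau> x'" by blast
        have "x' \<in> ?P" by (rule V1(4)) (use x' y' in auto)
        then show "x \<in> {x \<in> ?\<tau> ` ?P. ?F x = v}" using F\<tau>[of x'] x' y(3) by simp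
      qed
      moreover have "{x \<in> U. f x = y} \<subseteq> D" using V1(4) y'(2) by blast
      then have "card (?\<tau> ` {x \<in> U. f x = y}) = card {x \<in> U. f x = y}"
        by (intro card_image inj_on_subset[OF \<tau>_inj])
      ultimately show "card {x \<in> ?\<tau> ` ?P. ?F x = v} = d" using T(3) y'(1) by simp
    qed
  qed (rule r(1))
qed

theorem theorem2:
  fixes X :: "'a topology" and \<A> :: "'a chart set" and p :: 'a
    and Y :: "'b topology" and \<B> :: "'b chart set" and q :: 'b
    and f :: "'a \<Rightarrow> 'b"
  assumes "complex_surface X \<A>" and "p \<in> topspace X"
    and "complex_surface Y \<B>" and "q \<in> topspace Y"
    and "finite_cover_germ X \<A> p Y \<B> q 3 f"
  shows "\<exists>(n::nat) D z w E u v.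
    local_coordinates X \<A> p D (\<lambda>x. (z x, w x)) \<and>
    local_coordinates Y \<B> q E (\<lambda>y. (u y, v y)) \<and>
    f ` D \<subseteq> E \<and>
    (\<forall>x\<in>D. u (f x) = z x \<and> v (f x) = w x ^ 3 - of_nat n * z x ^ n * w x)"
proof -
  obtain U V where U: "openin X U" "p \<in> U" and V: "openin Y V" "q \<in> V"
    and f: "holomorphic_map X \<A> U Y \<B> V f" "finite_map X U Y V f" "has_degree U Y \<B> V f 3"
    and fib: "{x \<in> U. f x = q} = {p}"
    using assms(5) unfolding finite_cover_germ_def by (elim exE conjE)
  obtain D0 \<phi> where c: "(D0, \<phi>) \<in> \<A>" "p \<in> D0"
    by (rule complex_surface_chart_at[OF assms(1,2)])
  obtain E0 \<psi> where e: "(E0, \<psi>) \<in> \<B>" "q \<in> E0"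
    by (rule complex_surface_chart_at[OF assms(3,4)])
  let ?P = "{x \<in> U \<inter> D0. f x \<in> E0}"
  define F where "F x = \<psi> (f (inv_into D0 \<phi> (x + \<phi> p))) - \<psi> q" for x
  define S where "S = (\<lambda>x. \<phi> x - \<phi> p) ` ?P"
  have germ: "finite_germ F S 3"
    unfolding F_def S_def by (rule finite_germ_of_cover[OF assms(1,3) U V f fib c e])
  note gD = finite_germD[OF germ]
  obtain n :: nat and \<Phi> \<Psi> N where nf: "biholomorphic_germ \<Phi>" "biholomorphic_germ \<Psi>" "open N" "0 \<in> N"
     "\<forall>x\<in>N. fst (\<Psi> (F x)) = fst (\<Phi> x) \<and>
        snd (\<Psi> (F x)) = snd (\<Phi> x) ^ 3 - of_nat n * fst (\<Phi> x) ^ n * snd (\<Phi> x)"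
    using finite_germ_degree_3_normal_form[OF germ] unfolding has_cusp_normal_form_def by (elim exE conjE)
  have chD: "is_chart X (D0, \<phi>)" using assms(1) c by (auto simp: complex_surface_def)
  have chE: "is_chart Y (E0, \<psi>)" using assms(3) e by (auto simp: complex_surface_def)
  have oE: "open ((\<lambda>y. \<psi> y - \<psi> q) ` E0)"
    using open_image_minus[OF is_chartD(2)[OF chE]] by (simp add: image_image)
  have zE: "0 \<in> (\<lambda>y. \<psi> y - \<psi> q) ` E0" using e(2) by (intro image_eqI[of _ _ q]) auto
  obtain U2 V2 G2 where U2: "open U2" "U2 \<subseteq> (\<lambda>y. \<psi> y - \<psi> q) ` E0" "0 \<in> U2" "open V2" "homeomorphism U2 V2 \<Psi> G2"
    "holomorphic2_map_on \<Psi> U2" "holomorphic2_map_on G2 V2"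
    by (rule biholomorphic_germ_inverse[OF nf(2) oE zE]) (rule that)
  let ?M = "N \<inter> (S \<inter> F -` U2)"
  have oM: "open ?M"
    by (intro open_Int nf(3) continuous_open_preimage[OF holomorphic2_map_on_continuous[OF gD(3)] gD(1) U2(1)])
  have zM: "0 \<in> ?M" using nf(4) gD(2,4) U2(3) by simp
  obtain U1 V1 G1 where U1: "open U1" "U1 \<subseteq> ?M" "0 \<in> U1" "open V1" "homeomorphism U1 V1 \<Phi> G1"
    "holomorphic2_map_on \<Phi> U1" "holomorphic2_map_on G1 V1"
    by (rule biholomorphic_germ_inverse[OF nf(1) oM zM]) (rule that)
  let ?D = "{x \<in> D0. \<phi> x - \<phi> p \<in> U1}" and ?E = "{y \<in> E0. \<psi> y - \<psi> q \<in> U2}"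
  have subD: "U1 \<subseteq> (\<lambda>x. \<phi> x - \<phi> p) ` D0" using U1(2) by (auto simp: S_def)
  have lD: "local_coordinates X \<A> p ?D (\<lambda>x. \<Phi> (\<phi> x - \<phi> p))"
    using nf(1) by (intro local_coordinates_from_chart[OF assms(1) c U1(1,3,4,5,6,7) _ subD])
      (simp add: biholomorphic_germ_def)
  have lE: "local_coordinates Y \<B> q ?E (\<lambda>y. \<Psi> (\<psi> y - \<psi> q))"
    using nf(2) by (intro local_coordinates_from_chart[OF assms(3) e U2(1,3,4,5,6,7) _ U2(2)])
      (simp add: biholomorphic_germ_def)
  have key: "f x \<in> ?E \<and> F (\<phi> x - \<phi> p) = \<psi> (f x) - \<psi> q \<and> \<phi> x - \<phi> p \<in> N" if x: "x \<in> ?D" for x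
  proof -
    have M: "\<phi> x - \<phi> p \<in> ?M" using x U1(2) by blast
    then obtain x' where x': "x' \<in> ?P" "\<phi> x - \<phi> p = \<phi> x' - \<phi> p" by (auto simp: S_def)
    have "x = x'" using inj_onD[OF is_chartD(3)[OF chD], of x x'] x x' by simp
    then have xP: "x \<in> ?P" using x'(1) by simp
    have "F (\<phi> x - \<phi> p) = \<psi> (f x) - \<psi> q"
      using inv_into_f_f[OF is_chartD(3)[OF chD], of x] xP by (simp add: F_def)
    then show ?thesis using M xP by auto
  qed
  have "\<forall>x\<in>?D. fst (\<Psi> (\<psi> (f x) - \<psi> q)) = fst (\<Phi> (\<phi> x - \<phi> p)) \<and>
      snd (\<Psi> (\<psi> (f x) - \<psi> q)) = snd (\<Phi> (\<phi> x - \<phi> p)) ^ 3 -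
        of_nat n * fst (\<Phi> (\<phi> x - \<phi> p)) ^ n * snd (\<Phi> (\<phi> x - \<phi> p))"
  proof
    fix x assume x: "x \<in> ?D"
    have N: "\<phi> x - \<phi> p \<in> N" and eq: "F (\<phi> x - \<phi> p) = \<psi> (f x) - \<psi> q"
      using key[OF x] by simp_all
    from bspec[OF nf(5) N] show "fst (\<Psi> (\<psi> (f x) - \<psi> q)) = fst (\<Phi> (\<phi> x - \<phi> p)) \<and>
      snd (\<Psi> (\<psi> (f x) - \<psi> q)) = snd (\<Phi> (\<phi> x - \<phi> p)) ^ 3 -
        of_nat n * fst (\<Phi> (\<phi> x - \<phi> p)) ^ n * snd (\<Phi> (\<phi> x - \<phi> p))"
      unfolding eq .
  qed
  moreover have "f ` ?D \<subseteq> ?E" using key by blast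
  ultimately show ?thesis using lD lE
    by (intro exI[of _ n] exI[of _ ?D] exI[of _ "\<lambda>x. fst (\<Phi> (\<phi> x - \<phi> p))"] exI[of _ "\<lambda>x. snd (\<Phi> (\<phi> x - \<phi> p))"]
        exI[of _ ?E] exI[of _ "\<lambda>y. fst (\<Psi> (\<psi> y - \<psi> q))"] exI[of _ "\<lambda>y. snd (\<Psi> (\<psi> y - \<psi> q))"] conjI)
      (simp_all only: prod.collapse)
qed

end
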